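(* Let $\alpha>-1$, $\sigma>0$ and $1\le p,q\le\infty$. (a) If $\alpha\ge-1/2$, then $I_H^{\alpha,\sigma}$ is bounded from $L^p(dx)$ to $L^q(dx)$ if and only if $$\frac1p-2\sigma\le\frac1q<\frac1p+2\sigma\quad\text{and}\quad\Big(\frac1p,\frac1q\Big)\notin\big\{(2\sigma,0),(1,1-2\sigma)\big\}.$$ (b) If $\alpha<-1/2$ and $p>2/(2\alpha+3)$, then $I_H^{\alpha,\sigma}$ is bounded from $L^p(dx)$ to $L^q(dx)$ if and only if $$\frac1p-2\sigma\le\frac1q<\frac1p+2\sigma\quad\text{and}\quad\frac1q>-\alpha-\frac12.$$
   Context: For $\alpha>-1$, let $I_\alpha$ (one index) be the modified Bessel function of the first kind of order $\alpha$, and for $t,x,y>0$ let $$G_t^{\alpha}(x,y)=\frac{1}{\sinh 2t}\exp\Big(-\frac12\coth(2t)(x^2+y^2)\Big)(xy)^{-\alpha}I_\alpha\Big(\frac{xy}{\sinh 2t}\Big).$$ For $\sigma>0$ and $x,y>0$ put $$K^{\alpha,\sigma}(x,y)=\frac{1}{\Gamma(\sigma)}\int_0^\infty G_t^\alpha(x,y)\,t^{\sigma-1}\,dt\in[0,\infty],\qquad K_H^{\alpha,\sigma}(x,y)=(xy)^{\alpha+1/2}K^{\alpha,\sigma}(x,y),$$ and define the potential operator $$I_H^{\alpha,\sigma}f(x)=\int_0^\infty K_H^{\alpha,\sigma}(x,y)f(y)\,dy,\qquad x>0,$$ on its natural domain (functions $f$ for which the integral converges for a.e. $x$). Here $L^p(dx)$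 is the Lebesgue space on $\mathbb{R}_+=(0,\infty)$ with Lebesgue measure. Boundedness from $L^p$ to $L^q$ means that $L^p$ is contained in the domain and $\|I_H^{\alpha,\sigma}f\|_{L^q(dx)}\le C\|f\|_{L^p(dx)}$ for all $f\in L^p(dx)$ with $C$ independent of $f$. Convention: $1/\infty=0$. *)

theory Defs
  imports "HOL-Analysis.Analysis" "HOL-Probability.Essential_Supremum"
begin

definition bessel_I :: "real \<Rightarrow> real \<Rightarrow> real" where
  "bessel_I \<alpha> z =
     (\<Sum>k. (z / 2) powr (2 * real k + \<alpha>) / (fact k * Gamma (real k + \<alpha> + 1)))"

definition coth :: "real \<Rightarrow> real" where
  "coth u = cosh u / sinh u"

definition heat_kernel :: "real \<Rightarrow> real \<Rightarrow> real \<Rightarrow> real \<Rightarrow> real" where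
  "heat_kernel \<alpha> t x y =
     1 / sinh (2 * t) * exp (- (1 / 2) * coth (2 * t) * (x\<^sup>2 + y\<^sup>2))
       * (x * y) powr (- \<alpha>) * bessel_I \<alpha> (x * y / sinh (2 * t))"

abbreviation lebesgue_pos :: "real measure" where
  "lebesgue_pos \<equiv> lebesgue_on {0<..}"

text \<open>The potential kernels take values in $[0,\infty]$; they may be infinite on the diagonal.\<close>

definition potential_kernel :: "real \<Rightarrow> real \<Rightarrow> real \<Rightarrow> real \<Rightarrow> ennreal" where
  "potential_kernel \<alpha> \<sigma> x y =
     ennreal (1 / Gamma \<sigma>)
       * (\<integral>\<^sup>+t. ennreal (heat_kernel \<alpha> t x y * t powr (\<sigma> - 1)) \<partial>lebesgue_pos)"

definition potential_kernel_H :: "real \<Rightarrow> real \<Rightarrow> real \<Rightarrow> real \<Rightarrow> ennreal" where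
  "potential_kernel_H \<alpha> \<sigma> x y =
     ennreal ((x * y) powr (\<alpha> + 1 / 2)) * potential_kernel \<alpha> \<sigma> x y"

text \<open>Convergence of the integral means absolute convergence, computed with the
  $[0,\infty]$-valued kernel. Where it holds, the kernel is finite at almost every $y$ with
  $f(y) \neq 0$, so that passing to \<^const>\<open>enn2real\<close> in the operator loses nothing.\<close>

definition potential_domain_H :: "real \<Rightarrow> real \<Rightarrow> (real \<Rightarrow> complex) set" where
  "potential_domain_H \<alpha> \<sigma> =
     {f \<in> borel_measurable lebesgue_pos.
        AE x in lebesgue_pos.
          (\<integral>\<^sup>+y. potential_kernel_H \<alpha> \<sigma> x y * ennreal (norm (f y)) \<partial>lebesgue_pos) < \<infinity>}"

definition potential_H ::
  "real \<Rightarrow> real \<Rightarrow> (real \<Rightarrow> complex) \<Rightarrow> real \<Rightarrow> complex" where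
  "potential_H \<alpha> \<sigma> f x =
     (LINT y|lebesgue_pos. enn2real (potential_kernel_H \<alpha> \<sigma> x y) *\<^sub>R f y)"

text \<open>The $L^p$ norm, meant for $1 \le p \le \infty$. There is no power function with real
  exponent on \<^typ>\<open>ennreal\<close>, hence the detour through \<^typ>\<open>real\<close> for the $p$-th root.\<close>

definition Lp_norm :: "'a measure \<Rightarrow> ereal \<Rightarrow> ('a \<Rightarrow> complex) \<Rightarrow> ennreal" where
  "Lp_norm M p f =
     (if p = \<infinity> then esssup M (\<lambda>x. ennreal (norm (f x)))
      else let J = (\<integral>\<^sup>+x. ennreal (norm (f x) powr real_of_ereal p) \<partial>M)
           in if J = \<infinity> then \<infinity> else ennreal (enn2real J powr (1 / real_of_ereal p)))"

definition Lp_space :: "'a measure \<Rightarrow> ereal \<Rightarrow> ('a \<Rightarrow> complex) set" where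
  "Lp_space M p = {f \<in> borel_measurable M. Lp_norm M p f < \<infinity>}"

definition Lp_Lq_bounded ::
  "'a measure \<Rightarrow> ('a \<Rightarrow> complex) set \<Rightarrow> (('a \<Rightarrow> complex) \<Rightarrow> 'a \<Rightarrow> complex) \<Rightarrow>
     ereal \<Rightarrow> ereal \<Rightarrow> bool" where
  "Lp_Lq_bounded M D T p q \<longleftrightarrow>
     Lp_space M p \<subseteq> D \<and>
     (\<exists>C::real. C \<ge> 0 \<and>
        (\<forall>f\<in>Lp_space M p. T f \<in> Lp_space M q \<and> Lp_norm M q (T f) \<le> ennreal C * Lp_norm M p f))"

abbreviation potential_H_bounded :: "real \<Rightarrow> real \<Rightarrow> ereal \<Rightarrow> ereal \<Rightarrow> bool" where
  "potential_H_bounded \<alpha> \<sigma> \<equiv>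
     Lp_Lq_bounded lebesgue_pos (potential_domain_H \<alpha> \<sigma>) (potential_H \<alpha> \<sigma>)"

end

theory Submission
  imports Defs "HOL-Real_Asymp.Real_Asymp"
begin

text \<open>
  For $\sigma < 1/2$ and away from the axes the kernel $K_H^{\alpha,\sigma}(x,y)$ behaves like a Riesz
  kernel $|x-y|^{2\sigma-1}$ that is cut off at the distance $|x-y| \approx 1/(1+x+y)$; for larger
  $\sigma$ it is less singular, with the same cut-off. If $\alpha < -1/2$, a second piece, singular
  like $(xy)^{\alpha+1/2}$ on the axes and concentrated near the origin, has to be added.
  The conditions of the theorem can be read off from this picture. The singularity on the diagonal
  is responsible for $1/p - 2\sigma \le 1/q$ and for the two excluded endpoints, exactly as in
  Sobolev's inequality; the integral of $K_H(x,\cdot)$ decays like $x^{-2\sigma}$ at infinity, which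
  allows to lower the exponent, $q < p$, as long as $1/q < 1/p + 2\sigma$; and the singularity
  $x^{\alpha+1/2}$ at the origin has to belong to $L^q$ and, on the side of $y$, to the dual of $L^p$,
  which is the assumption $p > 2/(2\alpha+3)$.

  The kernel is known once the Bessel function is. Comparing the coefficients of its power series
  with those of $\cosh$ gives $\sqrt z\, I_\alpha(z) \approx \min(1,z)^{\alpha+1/2} e^z$ for all
  $z > 0$ (\<open>bessel_I_bounds\<close>). The heat kernel is thereby estimated from both sides by a constant
  multiple of Mehler's kernel
  $(\sinh 2t)^{-1/2} \exp(-\frac14 (x+y)^2 \tanh t - \frac14 (x-y)^2 \coth t)$ if $\sinh 2t \le xy$,
  and by an explicit Gaussian if $xy \le \sinh 2t$. Integration in $t$ gives
  \<open>mehler_potential_le_profile\<close> and \<open>corner_potential_le_homogeneous\<close> from above, and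
  \<open>potential_kernel_H_ge_integral\<close> and \<open>potential_kernel_H_ge_corner\<close> from below.

  Sufficiency is proved for the bilinear form
  $\int\int K_H(x,y)\, F(y)^{1/p} G(x)^{1-1/q}\,dy\,dx$, where $F, G \ge 0$ have integral at most $1$
  (\<open>bilinear_bound_imp_Lp_Lq_bounded\<close>). Written in this way every inequality that is needed comes
  from a pointwise estimate of the integrand by a sum $M_1 F(y) + M_2 G(x) + N$ in which $M_1$ has
  bounded integrals in $x$, $M_2$ has bounded integrals in $y$, and $N$ is integrable
  (\<open>bilinear_boundedI\<close>). Weighted arithmetic-geometric means give Young's inequality, its weighted
  version for $q < p$, and Schur's test for the piece near the origin. On the critical line
  $1/p - 1/q = 2\sigma$ the same scheme gives the Hardy--Littlewood--Sobolev inequality if the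
  integrand is split according to whether $G(x) \le F(y)$ or not (\<open>bilinear_bounded_riesz\<close>).

  For the necessity, boundedness is tested on indicators of intervals and on truncated powers. Their
  norms and the norms of the lower bounds for their images are powers of a parameter $L$, and each
  violated condition makes the exponent on the side of the image strictly larger.
\<close>

section \<open>The growth of the modified Bessel function\<close>

lemma bounded_between_of_positive_limit:
  fixes u :: "nat \<Rightarrow> real"
  assumes "u \<longlonglongrightarrow> L" "L > 0" "\<And>k. u k > 0"
  obtains c C where "c > 0" "C > 0" "\<And>k. c \<le> u k" "\<And>k. u k \<le> C"
proof -
  obtain C where C: "C > 0" "\<And>k. norm (u k) \<le> C"
    using convergent_imp_Bseq[OF convergentI[OF assms(1)]] by (auto elim!: BseqE)
  have "(\<lambda>k. inverse (u k)) \<longlonglongrightarrow> inverse L"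
    using assms by (intro tendsto_inverse) auto
  then obtain D where D: "D > 0" "\<And>k. norm (inverse (u k)) \<le> D"
    using convergent_imp_Bseq[OF convergentI] by (metis BseqE)
  have "inverse D \<le> u k" for k
    using D(2)[of k] assms(3)[of k] D(1)
    by (metis abs_of_pos inverse_inverse_eq inverse_positive_iff_positive le_imp_inverse_le real_norm_def)
  moreover have "u k \<le> C" for k using C(2)[of k] by auto
  ultimately show ?thesis using that[of "inverse D" C] C(1) D(1) by auto
qed

lemma Gamma_over_fact_tendsto:
  fixes a :: real
  assumes "a > 0"
  shows "(\<lambda>k. Gamma (real k + a) / (fact k * (real k + 1) powr (a - 1))) \<longlonglongrightarrow> 1"
proof -
  have G0: "Gamma a > 0" using assms by (rule Gamma_real_pos)
  have "(\<lambda>k. Gamma a / Gamma_series a k * (real k powr a / ((real k + a) * (real k + 1) powr (a - 1))))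
          \<longlonglongrightarrow> Gamma a / Gamma a * 1"
  proof (intro tendsto_mult tendsto_divide tendsto_const Gamma_series_LIMSEQ)
    show "Gamma a \<noteq> 0" using G0 by simp
    show "(\<lambda>k. real k powr a / ((real k + a) * (real k + 1) powr (a - 1))) \<longlonglongrightarrow> 1"
      by real_asymp
  qed
  moreover have "\<forall>\<^sub>F k in sequentially.
       Gamma a / Gamma_series a k * (real k powr a / ((real k + a) * (real k + 1) powr (a - 1)))
     = Gamma (real k + a) / (fact k * (real k + 1) powr (a - 1))"
    using eventually_gt_at_top[of 0]
  proof eventually_elim
    case (elim k)
    have p: "pochhammer a (k + 1) = (real k + a) * Gamma (real k + a) / Gamma a"
    proof -
      have "pochhammer a (k + 1) = Gamma (a + real (k + 1)) / Gamma a"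
        using assms by (intro pochhammer_Gamma) (auto elim!: nonpos_Ints_cases)
      also have "a + real (k + 1) = (real k + a) + 1" by simp
      also have "Gamma \<dots> = (real k + a) * Gamma (real k + a)"
        using assms by (intro Gamma_plus1) (auto elim!: nonpos_Ints_cases)
      finally show ?thesis .
    qed
    have e: "exp (a * ln (real k)) = real k powr a" using elim by (simp add: powr_def)
    have "real k + a > 0" "real k powr a > 0" using assms elim by auto
    then show ?case using G0 
      by (simp add: Gamma_series_def p[simplified] e divide_simps)
  qed
  ultimately show ?thesis using G0 by (simp add: tendsto_cong)
qed

text \<open>two sided comparison of Bessel coefficients with those of the exponential series\<close>

text \<open>
  The duplication formula $(2k)! = 4^k\, k!\, \Gamma(k+1/2)/\Gamma(1/2)$ turns the quotient of the two
  sides into a constant times $\Gamma(k+1/2)/\Gamma(k+\alpha+1)$ times a power of $k+1$, which has a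
  positive limit.
\<close>

lemma bessel_coeff_comparable:
  assumes "\<alpha> > -1"
  obtains c C where "c > 0" "C > 0"
    "\<And>k. c * ((real k + 1) powr (- (\<alpha> + 1/2)) * 4 ^ k / fact (2 * k)) \<le> 1 / (fact k * Gamma (real k + \<alpha> + 1))"
    "\<And>k. 1 / (fact k * Gamma (real k + \<alpha> + 1)) \<le> C * ((real k + 1) powr (- (\<alpha> + 1/2)) * 4 ^ k / fact (2 * k))"
proof -
  define g where "g a k = Gamma (real k + a) / (fact k * (real k + 1) powr (a - 1))" for a :: real and k
  define u where "u k = g (1/2) k / g (\<alpha> + 1) k" for k
  have gpos: "g a k > 0" if "a > 0" for a k
    unfolding g_def using that by (intro divide_pos_pos mult_pos_pos Gamma_real_pos) auto
  have "u \<longlonglongrightarrow> 1 / 1" unfolding u_def g_def using assms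
    by (intro tendsto_divide Gamma_over_fact_tendsto) auto
  then obtain c C where cC: "c > 0" "C > 0" "\<And>k. c \<le> u k" "\<And>k. u k \<le> C"
    by (rule bounded_between_of_positive_limit) (use assms gpos in \<open>auto simp: u_def\<close>)
  have pi0: "Gamma (1/2 :: real) > 0" by (rule Gamma_real_pos) auto
  have eq: "1 / (fact k * Gamma (real k + \<alpha> + 1)) =
     u k / Gamma (1/2) * ((real k + 1) powr (- (\<alpha> + 1/2)) * 4 ^ k / fact (2 * k))" for k
  proof -
    have "fact (2*k) = (4::real)^k * pochhammer (1/2) k * fact k"
      by (subst fact_double) (simp add: power_mult)
    also have "pochhammer (1/2::real) k = Gamma (real k + 1/2) / Gamma (1/2)"
      by (subst pochhammer_Gamma) (auto elim!: nonpos_Ints_cases simp: add.commute)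
    finally have f: "Gamma (real k + 1/2) / Gamma (1/2) = fact (2*k) / (4^k * fact k)"
      by (simp add: field_simps)
    have Gp: "Gamma (real k + (\<alpha> + 1)) > 0" using assms by (intro Gamma_real_pos) auto
    have "u k / Gamma (1/2) = fact (2*k) / (4^k * fact k) * ((real k + 1) powr (\<alpha> + 1 - 1) / ((real k + 1) powr (1/2 - 1) * Gamma (real k + (\<alpha> + 1))))"
      unfolding u_def g_def f[symmetric] by (simp add: field_simps)
    also have "(real k + 1) powr (\<alpha> + 1 - 1) / ((real k + 1) powr (1/2 - 1) * Gamma (real k + (\<alpha> + 1)))
        = (real k + 1) powr (\<alpha> + 1/2) / Gamma (real k + (\<alpha> + 1))"
      by (simp flip: divide_divide_eq_left powr_diff)
    finally have "u k / Gamma (1/2) = fact (2*k) / (4^k * fact k) * ((real k + 1) powr (\<alpha> + 1/2) / Gamma (real k + (\<alpha> + 1)))" .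
    note u = this
    have w: "(real k + 1) powr (- (\<alpha> + 1/2)) = inverse ((real k + 1) powr (\<alpha> + 1/2))" by (rule powr_minus)
    have "(real k + 1) powr (\<alpha> + 1/2) > 0" by auto
    then show ?thesis using Gp unfolding u w
      by (simp add: divide_simps add_ac)
  qed
  define w where "w k = (real k + 1) powr (- (\<alpha> + 1/2)) * 4 ^ k / fact (2 * k)" for k
  have w0: "w k \<ge> 0" for k unfolding w_def by simp
  show ?thesis
  proof (rule that[of "c / Gamma (1/2)" "C / Gamma (1/2)"])
    fix k
    show "c / Gamma (1/2) * ((real k + 1) powr (- (\<alpha> + 1/2)) * 4 ^ k / fact (2 * k)) \<le> 1 / (fact k * Gamma (real k + \<alpha> + 1))"
      unfolding eq w_def[symmetric] using cC pi0 w0 by (intro mult_right_mono divide_right_mono) auto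
    show "1 / (fact k * Gamma (real k + \<alpha> + 1)) \<le> C / Gamma (1/2) * ((real k + 1) powr (- (\<alpha> + 1/2)) * 4 ^ k / fact (2 * k))"
      unfolding eq w_def[symmetric] using cC pi0 w0 by (intro mult_right_mono divide_right_mono) auto
  qed (use cC pi0 in auto)
qed

lemma sum_exp_series_subset_le:
  fixes z :: real and n :: nat
  assumes "z \<ge> 0" "inj_on g {..<n}"
  shows "(\<Sum>k<n. z ^ g k / fact (g k)) \<le> exp z"
proof -
  have s: "(\<lambda>k. z ^ k / fact k) sums exp z" using exp_converges[of z] by (simp add: field_simps)
  have "(\<Sum>k<n. z ^ g k / fact (g k)) = (\<Sum>j\<in>g ` {..<n}. z ^ j / fact j)"
    using assms(2) by (simp add: sum.reindex)
  also have "\<dots> \<le> exp z"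
    unfolding sums_unique[OF s]
    by (rule sum_le_suminf[OF sums_summable[OF s]]) (use assms(1) in auto)
  finally show ?thesis .
qed

text \<open>
  The tangent at $u = 1$ lies below the convex function $u^{-e}$. Averaged over a probability
  distribution this is Jensen's inequality, the form in which it is used.
\<close>

lemma bernoulli_powr_neg:
  fixes u e :: real
  assumes "u > 0" "e \<ge> 0"
  shows "u powr (- e) \<ge> 1 + e - e * u"
proof -
  have "1 + e - e * u \<le> 1 + (- e) * ln u"
    using mult_left_mono[OF ln_le_minus_one[OF assms(1)] assms(2)] by (simp add: algebra_simps)
  also have "\<dots> \<le> u powr (- e)" using assms(1) exp_ge_add_one_self[of "(- e) * ln u"] by (simp add: powr_def)
  finally show ?thesis .
qed

lemma even_exp_terms_sums_cosh: "(\<lambda>k. z ^ (2 * k) / fact (2 * k)) sums cosh (z::real)"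
proof -
  have "(\<lambda>n. if even n then z ^ n /\<^sub>R fact n else 0) sums cosh z" by (rule cosh_converges)
  then have "(\<lambda>k. (\<lambda>n. if even n then z ^ n /\<^sub>R fact n else 0) (2 * k)) sums cosh z"
    by (subst sums_mono_reindex) (auto simp: strict_mono_def)
  then show ?thesis by (simp add: field_simps)
qed

lemma sum_odd_exp_terms_le:
  fixes z :: real
  assumes "z \<ge> 0"
  shows "(\<Sum>k<n. if k = 0 then 0 else z ^ (2 * k - 1) / fact (2 * k - 1)) \<le> exp z"
proof (cases n)
  case (Suc m)
  have "(\<Sum>k<m. z ^ (2 * Suc k - 1) / fact (2 * Suc k - 1)) \<le> exp z"
    using assms by (intro sum_exp_series_subset_le[of z "\<lambda>k. 2 * Suc k - 1"]) (auto simp: inj_on_def)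
  then show ?thesis unfolding Suc sum.lessThan_Suc_shift by simp
qed auto

lemma index_times_even_exp_term_le:
  fixes z :: real
  assumes "z \<ge> 1"
  shows "(real k + 1) / z * (z ^ (2 * k) / fact (2 * k))
    \<le> z ^ (2 * k) / fact (2 * k) + (if k = 0 then 0 else z ^ (2 * k - 1) / fact (2 * k - 1))"
proof (cases k)
  case 0
  then show ?thesis using assms by simp
next
  case (Suc j)
  define n where "n = 2 * j + 1"
  have n: "2 * k = Suc n" "2 * k - 1 = n" "real k = (real n + 1) / 2" using Suc by (simp_all add: n_def)
  have "(real k + 1) / z * (z ^ (2 * k) / fact (2 * k))
      = real k / z * (z ^ (2 * k) / fact (2 * k)) + 1 / z * (z ^ (2 * k) / fact (2 * k))"
    by (simp add: add_divide_distrib distrib_right)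
  also have "real k / z * (z ^ (2 * k) / fact (2 * k)) = 1/2 * (z ^ n / fact n)"
    unfolding n using assms by (simp add: divide_simps)
  also have "\<dots> \<le> 1 * (z ^ n / fact n)" using assms by (intro mult_right_mono) auto
  also have "1 / z * (z ^ (2 * k) / fact (2 * k)) \<le> 1 * (z ^ (2 * k) / fact (2 * k))"
    using assms by (intro mult_right_mono) auto
  finally show ?thesis using Suc unfolding n(2) by simp
qed

text \<open>
  The terms $z^{2k}/(2k)!$ concentrate where $2k$ is close to $z$, so that the ratio
  $\rho = (k+1)/z$ is essentially constant and a power of $\rho$ should not change the order of the
  sum. The bound $\rho^{-\delta} \le \rho^{-m} + \rho$ with an integer $m \ge \delta$ reduces this to the
  two exponents for which the powers of $k+1$ can be absorbed by the factorial.
\<close>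

lemma weighted_even_exp_upper:
  fixes \<delta> :: real
  assumes "\<delta> \<ge> - 1"
  obtains C where "C > 0"
   "\<And>z n. z \<ge> 1 \<Longrightarrow> (\<Sum>k<n. ((real k + 1) / z) powr (- \<delta>) * (z ^ (2 * k) / fact (2 * k))) \<le> C * exp z"
proof -
  define m where "m = nat \<lceil>\<delta>\<rceil>"
  have m: "\<delta> \<le> real m" unfolding m_def by linarith
  \<comment> \<open>\<open>(2 * k + m)! / (2 * k)!\<close> has \<open>m\<close> factors, each at most \<open>(m + 2) * (k + 1)\<close>.\<close>
  define D where "D = real (m + 2) ^ m"
  have key: "(\<Sum>k<n. ((real k + 1) / z) powr (- \<delta>) * (z ^ (2 * k) / fact (2 * k))) \<le> (D + 2) * exp z" if z: "z \<ge> 1" for z n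
  proof -
    have t: "((real k + 1) / z) powr (- \<delta>) * (z ^ (2 * k) / fact (2 * k))
        \<le> D * (z ^ (2 * k + m) / fact (2 * k + m)) + z ^ (2 * k) / fact (2 * k) + (if k = 0 then 0 else z ^ (2 * k - 1) / fact (2 * k - 1))" for k
    proof -
      define r where "r = (real k + 1) / z"
      have r: "r > 0" unfolding r_def using z by simp
      have r1: "r powr (- \<delta>) \<le> inverse r ^ m + r"
      proof (cases "r \<ge> 1")
        case True
        then have "r powr (- \<delta>) \<le> r powr 1" using assms by (intro powr_mono) auto
        then show ?thesis using r by (smt (verit) powr_one zero_le_power positive_imp_inverse_positive)
      next
        case False
        have "r powr (- \<delta>) \<le> r powr (- real m)" using m r False by (intro powr_mono') auto
        also have "\<dots> = inverse r ^ m" using r by (simp add: powr_minus powr_realpow power_inverse)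
        finally show ?thesis using r by simp
      qed
      have "inverse r ^ m * (z ^ (2 * k) / fact (2 * k)) \<le> D * (z ^ (2 * k + m) / fact (2 * k + m))"
      proof -
        have "(fact (2 * k + m) :: real) \<le> fact (2 * k) * real (2 * k + m) ^ m"
        proof (induction m)
          case (Suc j)
          have "(fact (2 * k + Suc j) :: real) = real (2 * k + Suc j) * fact (2 * k + j)" by (simp add: algebra_simps)
          also have "\<dots> \<le> real (2 * k + Suc j) * (fact (2 * k) * real (2 * k + j) ^ j)"
            by (intro mult_left_mono Suc) auto
          also have "\<dots> \<le> real (2 * k + Suc j) * (fact (2 * k) * real (2 * k + Suc j) ^ j)"
            by (intro mult_left_mono power_mono) auto
          finally show ?case by (simp add: algebra_simps)
        qed simp
        also have "\<dots> \<le> fact (2 * k) * (real (m + 2) * (real k + 1)) ^ m"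
          by (intro mult_left_mono power_mono) (auto simp: algebra_simps)
        finally have f: "(fact (2 * k + m) :: real) \<le> fact (2 * k) * (D * (real k + 1) ^ m)"
          by (simp add: D_def power_mult_distrib)
        have "inverse r ^ m * (z ^ (2 * k) / fact (2 * k)) = z ^ (2 * k + m) / (fact (2 * k) * (real k + 1) ^ m)"
          using z by (simp add: r_def power_divide power_add field_simps)
        also have "\<dots> \<le> D * (z ^ (2 * k + m) / fact (2 * k + m))"
        proof -
          have "1 / (fact (2 * k) * (real k + 1) ^ m) \<le> D / fact (2 * k + m)"
            using f by (simp add: divide_simps mult_ac)
          from mult_right_mono[OF this, of "z ^ (2 * k + m)"] show ?thesis using z by (simp add: field_simps)
        qed
        finally show ?thesis .
      qed
      moreover have "r * (z ^ (2 * k) / fact (2 * k)) \<le> z ^ (2 * k) / fact (2 * k) + (if k = 0 then 0 else z ^ (2 * k - 1) / fact (2 * k - 1))"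
        unfolding r_def by (rule index_times_even_exp_term_le[OF z])
      moreover have "r powr (- \<delta>) * (z ^ (2 * k) / fact (2 * k)) \<le> (inverse r ^ m + r) * (z ^ (2 * k) / fact (2 * k))"
        using r1 z by (intro mult_right_mono) auto
      ultimately show ?thesis unfolding r_def[symmetric] distrib_right by linarith
    qed
    have "(\<Sum>k<n. ((real k + 1) / z) powr (- \<delta>) * (z ^ (2 * k) / fact (2 * k)))
       \<le> D * (\<Sum>k<n. z ^ (2 * k + m) / fact (2 * k + m)) + (\<Sum>k<n. z ^ (2 * k) / fact (2 * k)) +
          (\<Sum>k<n. if k = 0 then 0 else z ^ (2 * k - 1) / fact (2 * k - 1))"
      unfolding sum_distrib_left sum.distrib[symmetric] by (rule sum_mono) (rule t)
    also have "\<dots> \<le> D * exp z + exp z + exp z"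
      using z by (intro add_mono mult_left_mono sum_exp_series_subset_le sum_odd_exp_terms_le) (auto simp: inj_on_def D_def)
    finally show ?thesis by (simp add: algebra_simps)
  qed
  show ?thesis by (rule that[of "D + 2"]) (use key in \<open>auto simp: D_def add_nonneg_pos\<close>)
qed

text \<open>
  The mean of $\rho = (k+1)/z$ (of $1/\rho$, if $\delta < 0$) with respect to the weights
  $z^{2k}/(2k)!$ is at most $4$, since the weighted sum is at most $2e^z$ and the total weight is
  $\cosh z \ge e^z/2$. The tangent inequality at $4$ gives the claim.
\<close>

lemma weighted_even_exp_lower:
  fixes \<delta> z :: real
  assumes "z \<ge> 1" and s: "summable (\<lambda>k. ((real k + 1) / z) powr (- \<delta>) * (z ^ (2 * k) / fact (2 * k)))"
  shows "4 powr (- \<bar>\<delta>\<bar>) / 2 * exp z \<le> (\<Sum>k. ((real k + 1) / z) powr (- \<delta>) * (z ^ (2 * k) / fact (2 * k)))"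
proof -
  define e where "e = \<bar>\<delta>\<bar>"
  define t where "t k = (if \<delta> \<ge> 0 then (real k + 1) / z else z / (real k + 1))" for k
  define w where "w k = z ^ (2 * k) / fact (2 * k)" for k
  have w0: "w k \<ge> 0" for k using assms by (simp add: w_def)
  have tpos: "t k > 0" for k using assms by (simp add: t_def)
  have tp: "((real k + 1) / z) powr (- \<delta>) = t k powr (- e)" for k
    using assms(1) by (auto simp: t_def e_def powr_divide powr_minus field_simps)
  have ws: "w sums cosh z" unfolding w_def by (rule even_exp_terms_sums_cosh)
  have tw: "(\<Sum>k<n. t k * w k) \<le> 2 * exp z" for n
  proof (cases "\<delta> \<ge> 0")
    case True
    have "(\<Sum>k<n. t k * w k) \<le> (\<Sum>k<n. z ^ (2 * k) / fact (2 * k) + (if k = 0 then 0 else z ^ (2 * k - 1) / fact (2 * k - 1)))"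
    proof (rule sum_mono)
      fix k
      show "t k * w k \<le> z ^ (2 * k) / fact (2 * k) + (if k = 0 then 0 else z ^ (2 * k - 1) / fact (2 * k - 1))"
        using index_times_even_exp_term_le[OF assms(1), of k] True by (simp add: t_def w_def)
    qed
    also have "\<dots> \<le> exp z + exp z" unfolding sum.distrib
      using assms(1) by (intro add_mono sum_exp_series_subset_le sum_odd_exp_terms_le) (auto simp: inj_on_def)
    finally show ?thesis by simp
  next
    case False
    have "(\<Sum>k<n. t k * w k) \<le> (\<Sum>k<n. 2 * (z ^ (2 * k + 1) / fact (2 * k + 1)))"
    proof (rule sum_mono)
      fix k
      define q where "q = 2 * real k + 1"
      have q: "q > 0" "fact (2 * k + 1) = q * fact (2 * k)" by (simp_all add: q_def)
      have "t k * w k = (q / (real k + 1)) * (z ^ (2 * k + 1) / fact (2 * k + 1))"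
        unfolding q(2) using False q(1) by (simp add: t_def w_def)
      also have "\<dots> \<le> 2 * (z ^ (2 * k + 1) / fact (2 * k + 1))"
        using assms(1) by (intro mult_right_mono) (auto simp: q_def field_simps)
      finally show "t k * w k \<le> 2 * (z ^ (2 * k + 1) / fact (2 * k + 1))" .
    qed
    also have "\<dots> \<le> 2 * exp z" unfolding sum_distrib_left[symmetric]
      using assms(1) by (intro mult_left_mono sum_exp_series_subset_le) (auto simp: inj_on_def)
    finally show ?thesis .
  qed
  have tw0: "t k * w k \<ge> 0" for k using tpos[of k] w0[of k] by simp
  have tws: "summable (\<lambda>k. t k * w k)" by (rule summableI_nonneg_bounded[OF tw0 tw])
  have twle: "(\<Sum>k. t k * w k) \<le> 2 * exp z" by (rule suminf_le_const[OF tws tw])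
  have "4 powr (- e) / 2 * exp z \<le> 4 powr (- e) * ((1 + e) * cosh z - e / 4 * (2 * exp z))"
  proof -
    have "exp z / 2 \<le> cosh z" by (simp add: cosh_def)
    moreover have "e \<ge> 0" by (simp add: e_def)
    ultimately have "(1 + e) * (exp z / 2) \<le> (1 + e) * cosh z" by (intro mult_left_mono) auto
    then have "1/2 * exp z \<le> (1 + e) * cosh z - e / 4 * (2 * exp z)" by (simp add: algebra_simps)
    from mult_left_mono[OF this, of "4 powr (- e)"] show ?thesis by simp
  qed
  also have "\<dots> \<le> 4 powr (- e) * ((1 + e) * cosh z - e / 4 * (\<Sum>k. t k * w k))"
    using twle by (intro mult_left_mono diff_left_mono) (auto simp: e_def)
  also have "\<dots> = (\<Sum>k. 4 powr (- e) * ((1 + e) * w k - e / 4 * (t k * w k)))"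
    using sums_unique[OF sums_mult[OF sums_diff[OF sums_mult[OF ws] sums_mult[OF summable_sums[OF tws]]]]] by blast
  also have "\<dots> \<le> (\<Sum>k. ((real k + 1) / z) powr (- \<delta>) * w k)"
  proof (rule suminf_le)
    fix k
    have "4 powr (- e) * (1 + e - e * (t k / 4)) \<le> 4 powr (- e) * (t k / 4) powr (- e)"
      using tpos[of k] by (intro mult_left_mono bernoulli_powr_neg) (auto simp: e_def)
    also have "\<dots> = t k powr (- e)" using tpos[of k] by (simp flip: powr_mult)
    finally have "4 powr (- e) * (1 + e - e * (t k / 4)) * w k \<le> t k powr (- e) * w k"
      using w0[of k] by (intro mult_right_mono) auto
    then show "4 powr (- e) * ((1 + e) * w k - e / 4 * (t k * w k)) \<le> ((real k + 1) / z) powr (- \<delta>) * w k"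
      unfolding tp by (simp add: algebra_simps)
  next
    show "summable (\<lambda>k. 4 powr (- e) * ((1 + e) * w k - e / 4 * (t k * w k)))"
      by (intro summable_mult summable_diff tws sums_summable[OF ws])
    show "summable (\<lambda>k. ((real k + 1) / z) powr (- \<delta>) * w k)" using s unfolding w_def .
  qed
  finally show ?thesis unfolding e_def w_def .
qed

text \<open>
  For $z \ge 1$ the series is compared term by term with the weighted exponential sums above. For
  $z \le 1$ the first term dominates, and $z^{2k} \le 1$ reduces the upper bound to the case $z = 1$.
\<close>

lemma bessel_I_bounds:
  assumes "\<alpha> > -1"
  obtains c C where "c > 0" "C > 0"
    "\<And>z. z > 0 \<Longrightarrow> c * min 1 z powr (\<alpha> + 1/2) * exp z \<le> sqrt z * bessel_I \<alpha> z"
    "\<And>z. z > 0 \<Longrightarrow> sqrt z * bessel_I \<alpha> z \<le> C * min 1 z powr (\<alpha> + 1/2) * exp z"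
proof -
  define \<delta> where "\<delta> = \<alpha> + 1/2"
  have d: "\<delta> \<ge> -1" using assms by (simp add: \<delta>_def)
  define b where "b z k = (z / 2) powr (2 * real k + \<alpha>) / (fact k * Gamma (real k + \<alpha> + 1))" for z k
  define v where "v z k = ((real k + 1) / z) powr (- \<delta>) * (z ^ (2 * k) / fact (2 * k))" for z :: real and k
  obtain c C where cC: "c > 0" "C > 0"
    "\<And>k. c * ((real k + 1) powr (- \<delta>) * 4 ^ k / fact (2 * k)) \<le> 1 / (fact k * Gamma (real k + \<alpha> + 1))"
    "\<And>k. 1 / (fact k * Gamma (real k + \<alpha> + 1)) \<le> C * ((real k + 1) powr (- \<delta>) * 4 ^ k / fact (2 * k))"
    using bessel_coeff_comparable[OF assms] unfolding \<delta>_def by blast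
  obtain D where D: "D > 0" "\<And>z n. z \<ge> 1 \<Longrightarrow> (\<Sum>k<n. v z k) \<le> D * exp z"
    using weighted_even_exp_upper[OF d] unfolding v_def by blast
  have v0: "v z k \<ge> 0" if "z > 0" for z k using that by (simp add: v_def)
  have v_scale: "v z k \<le> z powr \<delta> * v 1 k" if "0 < z" "z \<le> 1" for z k
  proof -
    have "v z k = z powr \<delta> * (real k + 1) powr (- \<delta>) * (z ^ (2 * k) / fact (2 * k))"
      using that by (simp add: v_def powr_divide powr_minus field_simps)
    also have "\<dots> \<le> z powr \<delta> * (real k + 1) powr (- \<delta>) * (1 / fact (2 * k))"
      using that by (intro mult_left_mono divide_right_mono power_le_one) auto
    finally show ?thesis by (simp add: v_def)
  qed
  have v_up: "(\<Sum>k<n. v z k) \<le> D * exp 1 * (min 1 z powr \<delta> * exp z)" if "z > 0" for z n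
  proof (cases "z \<ge> 1")
    case True
    have "(\<Sum>k<n. v z k) \<le> D * exp z" by (rule D(2)[OF True])
    also have "\<dots> = D * 1 * (1 * exp z)" by simp
    also have "\<dots> \<le> D * exp 1 * (1 * exp z)"
      using D(1) by (intro mult_right_mono mult_left_mono) auto
    finally show ?thesis using True by simp
  next
    case False
    have "(\<Sum>k<n. v z k) \<le> (\<Sum>k<n. z powr \<delta> * v 1 k)" using that False by (intro sum_mono v_scale) auto
    also have "\<dots> \<le> z powr \<delta> * (D * exp 1)" unfolding sum_distrib_left[symmetric]
      by (intro mult_left_mono D(2)) auto
    also have "\<dots> = D * exp 1 * (z powr \<delta> * 1)" by simp
    also have "\<dots> \<le> D * exp 1 * (z powr \<delta> * exp z)" using that D(1) by (intro mult_left_mono) auto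
    finally show ?thesis using False by simp
  qed
  have v_sum: "summable (v z)" if "z > 0" for z
    by (rule summableI_nonneg_bounded[OF v0 v_up]) (use that in auto)
  have v_low: "(\<Sum>k. v z k) \<ge> min (4 powr (- \<bar>\<delta>\<bar>) / 2) (exp (-1)) * (min 1 z powr \<delta> * exp z)" if "z > 0" for z
  proof (cases "z \<ge> 1")
    case True
    have "min (4 powr (- \<bar>\<delta>\<bar>) / 2) (exp (-1)) * exp z \<le> 4 powr (- \<bar>\<delta>\<bar>) / 2 * exp z" by (intro mult_right_mono) auto
    also have "\<dots> \<le> (\<Sum>k. v z k)" using weighted_even_exp_lower[OF True, of \<delta>] v_sum[OF that] unfolding v_def by blast
    finally show ?thesis using True by simp
  next
    case False
    have "min (4 powr (- \<bar>\<delta>\<bar>) / 2) (exp (-1)) * (z powr \<delta> * exp z) \<le> exp (-1) * (z powr \<delta> * exp 1)"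
      using False by (intro mult_mono) auto
    also have "\<dots> = v z 0" using that by (simp add: v_def powr_divide powr_minus exp_minus)
    also have "\<dots> \<le> (\<Sum>k. v z k)" using sum_le_suminf[OF v_sum[OF that], of "{0}"] v0[OF that] by simp
    finally show ?thesis using False by simp
  qed
  have beq: "sqrt z * b z k = 2 powr (- \<alpha>) * (z powr \<delta> * (z ^ (2 * k) / 4 ^ k) * (1 / (fact k * Gamma (real k + \<alpha> + 1))))" if "z > 0" for z k
  proof -
    have "(z / 2) powr (2 * real k + \<alpha>) = (z / 2) powr (real (2 * k)) * (z / 2) powr \<alpha>" by (simp add: powr_add)
    also have "(z / 2) powr (real (2 * k)) = (z / 2) ^ (2 * k)" using that by (subst powr_realpow) auto
    also have "\<dots> = z ^ (2 * k) / 4 ^ k" by (simp add: power_divide power_mult)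
    also have "(z / 2) powr \<alpha> = z powr \<alpha> * 2 powr (- \<alpha>)" unfolding powr_divide powr_minus_divide by simp
    finally have "(z / 2) powr (2 * real k + \<alpha>) = z ^ (2 * k) / 4 ^ k * (z powr \<alpha> * 2 powr (- \<alpha>))" .
    moreover have "z powr \<delta> = sqrt z * z powr \<alpha>" using that by (simp add: \<delta>_def powr_add powr_half_sqrt)
    ultimately show ?thesis by (simp add: b_def)
  qed
  have veq: "v z k = z powr \<delta> * (z ^ (2 * k) / 4 ^ k) * ((real k + 1) powr (- \<delta>) * 4 ^ k / fact (2 * k))" if "z > 0" for z k
    using that unfolding v_def powr_divide powr_minus_divide by simp
  have b_up: "sqrt z * b z k \<le> 2 powr (- \<alpha>) * C * v z k" if "z > 0" for z k
  proof -
    have "sqrt z * b z k \<le> 2 powr (- \<alpha>) * (z powr \<delta> * (z ^ (2 * k) / 4 ^ k) * (C * ((real k + 1) powr (- \<delta>) * 4 ^ k / fact (2 * k))))"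
      unfolding beq[OF that] using that by (intro mult_left_mono cC) auto
    then show ?thesis unfolding veq[OF that] by (simp add: mult_ac)
  qed
  have b_low: "2 powr (- \<alpha>) * c * v z k \<le> sqrt z * b z k" if "z > 0" for z k
  proof -
    have "2 powr (- \<alpha>) * (z powr \<delta> * (z ^ (2 * k) / 4 ^ k) * (c * ((real k + 1) powr (- \<delta>) * 4 ^ k / fact (2 * k)))) \<le> sqrt z * b z k"
      unfolding beq[OF that] using that by (intro mult_left_mono cC) auto
    then show ?thesis unfolding veq[OF that] by (simp add: mult_ac)
  qed
  have b_sum: "summable (\<lambda>k. sqrt z * b z k)" if "z > 0" for z
  proof (rule summable_comparison_test_ev)
    show "summable (\<lambda>k. 2 powr (- \<alpha>) * C * v z k)" by (intro summable_mult v_sum that)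
    have "0 \<le> sqrt z * b z k" for k using b_low[OF that, of k] v0[OF that, of k] cC
      by (smt (verit) mult_nonneg_nonneg powr_ge_zero)
    then show "\<forall>\<^sub>F k in sequentially. norm (sqrt z * b z k) \<le> 2 powr (- \<alpha>) * C * v z k"
      using b_up[OF that] by simp
  qed
  have bI: "sqrt z * bessel_I \<alpha> z = (\<Sum>k. sqrt z * b z k)" if "z > 0" for z
  proof -
    have "summable (b z)" using b_sum[OF that] that by (subst (asm) summable_cmult_iff) auto
    then show ?thesis unfolding bessel_I_def b_def[symmetric] by (simp add: suminf_mult)
  qed
  show ?thesis
  proof (rule that[of "2 powr (- \<alpha>) * c * min (4 powr (- \<bar>\<delta>\<bar>) / 2) (exp (-1))" "2 powr (- \<alpha>) * C * (D * exp 1)"])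
    fix z :: real assume z: "z > 0"
    have "2 powr (- \<alpha>) * c * (min (4 powr (- \<bar>\<delta>\<bar>) / 2) (exp (-1)) * (min 1 z powr \<delta> * exp z)) \<le> 2 powr (- \<alpha>) * c * (\<Sum>k. v z k)"
      using cC by (intro mult_left_mono v_low z) auto
    also have "\<dots> = (\<Sum>k. 2 powr (- \<alpha>) * c * v z k)" by (rule suminf_mult[symmetric]) (rule v_sum[OF z])
    also have "\<dots> \<le> (\<Sum>k. sqrt z * b z k)" by (intro suminf_le b_low z b_sum summable_mult v_sum)
    finally show "2 powr (- \<alpha>) * c * min (4 powr (- \<bar>\<delta>\<bar>) / 2) (exp (-1)) * min 1 z powr (\<alpha> + 1/2) * exp z \<le> sqrt z * bessel_I \<alpha> z"
      unfolding bI[OF z] \<delta>_def by (simp add: mult_ac)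
    have "(\<Sum>k. sqrt z * b z k) \<le> (\<Sum>k. 2 powr (- \<alpha>) * C * v z k)" by (intro suminf_le b_up z b_sum summable_mult v_sum)
    also have "\<dots> = 2 powr (- \<alpha>) * C * (\<Sum>k. v z k)" by (rule suminf_mult) (rule v_sum[OF z])
    also have "\<dots> \<le> 2 powr (- \<alpha>) * C * (D * exp 1 * (min 1 z powr \<delta> * exp z))"
      using cC by (intro mult_left_mono suminf_le_const v_sum v_up z) auto
    finally show "sqrt z * bessel_I \<alpha> z \<le> 2 powr (- \<alpha>) * C * (D * exp 1) * min 1 z powr (\<alpha> + 1/2) * exp z"
      unfolding bI[OF z] \<delta>_def by (simp add: mult_ac)
  qed (use cC D in auto)
qed

section \<open>Lebesgue measure on the half-line\<close>

text \<open>
  Fubini's theorem and measurability in two variables are available for Borel functions, not for the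
  completed measure in which the theorem is formulated. Integrals and null sets are the same for both.
\<close>

abbreviation lborel_pos :: "real measure" where
  "lborel_pos \<equiv> restrict_space lborel {0<..}"

lemma nn_integral_lebesgue_pos: "nn_integral lebesgue_pos f = nn_integral lborel_pos f"
  by (simp add: nn_integral_restrict_space nn_integral_completion)

lemma AE_lebesgue_pos_iff: "(AE x in lebesgue_pos. P x) \<longleftrightarrow> (AE x in lborel_pos. P x)"
  by (simp add: AE_restrict_space_iff AE_completion_iff)

lemma nn_integral_lborel_pos: "nn_integral lborel_pos f = (\<integral>\<^sup>+x. f x * indicator {0<..} x \<partial>lborel)"
  by (rule nn_integral_restrict_space) simp

lemma space_lborel_pos [simp]: "space lborel_pos = {0<..}"
  by (simp add: space_restrict_space)

lemma borel_imp_lborel_pos [measurable (raw)]: "f \<in> borel_measurable borel \<Longrightarrow> f \<in> borel_measurable lborel_pos"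
  by (intro measurable_restrict_space1) simp

lemma borel_imp_lebesgue_pos: "f \<in> borel_measurable borel \<Longrightarrow> f \<in> borel_measurable lebesgue_pos"
  by (intro measurable_restrict_space1 measurable_completion) simp

interpretation lborel_pos: sigma_finite_measure lborel_pos
  by (rule sigma_finite_measure_restrict_space[OF sigma_finite_lborel]) simp

interpretation lborel_pos_pair: pair_sigma_finite lborel_pos lborel_pos ..

lemma measurable_ident_lborel_pos [measurable]: "(\<lambda>x. x) \<in> lborel_pos \<rightarrow>\<^sub>M borel"
  by (intro measurable_restrict_space1) simp

lemma borel_pair_imp_lborel_pos:
  assumes [measurable]: "case_prod k \<in> borel_measurable (borel \<Otimes>\<^sub>M borel)"
  shows "case_prod k \<in> borel_measurable (lborel_pos \<Otimes>\<^sub>M lborel_pos)"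
  by (rule measurable_compose[OF _ assms, of "\<lambda>z. z", simplified])
     (rule measurable_pair; simp add: comp_def; measurable)

lemma complex_measurable_lebesgue_pos_AE_borel:
  assumes "f \<in> borel_measurable lebesgue_pos"
  obtains g :: "real \<Rightarrow> complex" where "g \<in> borel_measurable borel" "AE x in lborel_pos. f x = g x"
proof -
  have f: "(\<lambda>x. indicator {0<..} x *\<^sub>R f x) \<in> borel_measurable (completion lborel)"
    using assms by (subst (asm) borel_measurable_restrict_space_iff) auto
  have "(\<lambda>x. Re (indicator {0<..} x *\<^sub>R f x)) \<in> borel_measurable (completion lborel)" 
       "(\<lambda>x. Im (indicator {0<..} x *\<^sub>R f x)) \<in> borel_measurable (completion lborel)" 
    by (rule measurable_compose[OF f]; simp)+
  from completion_ex_borel_measurable_real[OF this(1)] completion_ex_borel_measurable_real[OF this(2)]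
  obtain a b where ab: "a \<in> borel_measurable lborel" "AE x in lborel. Re (indicator {0<..} x *\<^sub>R f x) = a x"
     "b \<in> borel_measurable lborel" "AE x in lborel. Im (indicator {0<..} x *\<^sub>R f x) = b x"
    by auto
  show ?thesis
  proof (rule that[of "\<lambda>x. Complex (a x) (b x)"])
    show "(\<lambda>x. Complex (a x) (b x)) \<in> borel_measurable borel"
      using ab unfolding complex_eq_iff Complex_eq by auto
    show "AE x in lborel_pos. f x = Complex (a x) (b x)"
      using ab(2,4) by (subst AE_restrict_space_iff) (auto simp: complex_eq_iff elim!: eventually_elim2)
  qed
qed

section \<open>Duality\<close>

text \<open>
  If $\int F \le 1$ and \<open>p\<close> is finite, then $F^{1/p}$ lies in the unit ball of $L^p$, and every
  nonnegative element of the unit ball is of this form. For $p = \infty$ the exponent is $0$, and any strictly positive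
  \<open>F\<close> gives the constant function $1$; positivity matters because \<open>0 powr 0 = 0\<close>.
\<close>

definition subdensity :: "(real \<Rightarrow> real) \<Rightarrow> bool" where
  "subdensity F \<longleftrightarrow> F \<in> borel_measurable borel \<and> (\<forall>x. 0 \<le> F x) \<and> (\<integral>\<^sup>+x. F x \<partial>lborel_pos) \<le> 1"

lemma nn_integral_inverse_square: "(\<integral>\<^sup>+x. ennreal (1 / (1 + \<bar>x\<bar>)\<^sup>2) \<partial>lborel_pos) = 1"
proof -
  have "(\<integral>\<^sup>+x. ennreal (1 / (1 + \<bar>x\<bar>)\<^sup>2) \<partial>lborel_pos) = (\<integral>\<^sup>+x. ennreal (1 / (1 + x)\<^sup>2) * indicator {0..} x \<partial>lborel)"
    unfolding nn_integral_lborel_pos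
    by (intro nn_integral_cong_AE eventually_mono[OF AE_lborel_singleton[of 0]]) (auto split: split_indicator)
  also have "\<dots> = ennreal (0 - (- 1 / (1 + 0)))"
  proof (rule nn_integral_FTC_atLeast)
    show "((\<lambda>x. - 1 / (1 + x)) \<longlongrightarrow> (0::real)) at_top" by real_asymp
    fix x :: real assume "0 \<le> x"
    then show "DERIV (\<lambda>x. - 1 / (1 + x)) x :> 1 / (1 + x)\<^sup>2"
      by (auto intro!: derivative_eq_intros simp: power2_eq_square)
  qed auto
  finally show ?thesis by simp
qed

text \<open>
  A strictly positive subdensity, which makes the case of an exponent $0$ part of the general one.
\<close>

lemma subdensity_inverse_square: "subdensity (\<lambda>x. 1 / (1 + \<bar>x\<bar>)\<^sup>2)"
  unfolding subdensity_def nn_integral_inverse_square by auto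

text \<open>
  Test against the normalized indicator of the part of $\{h > B+1\}$ that lies in $(0,n]$. The
  summand $1$ makes the contradiction strict.
\<close>

lemma dual_bound_infinity:
  fixes h :: "real \<Rightarrow> ennreal"
  assumes [measurable]: "h \<in> borel_measurable borel" and "B \<ge> 0"
    and bd: "\<And>G. subdensity G \<Longrightarrow> (\<integral>\<^sup>+x. h x * ennreal (G x) \<partial>lborel_pos) \<le> ennreal B"
  shows "AE x in lborel_pos. h x \<le> ennreal (B + 1)"
proof -
  have "AE x in lborel_pos. \<not> (x \<le> real n \<and> h x > ennreal (B + 1))" for n
  proof -
    define A where "A = {x\<in>{0<..real n}. h x > ennreal (B + 1)}"
    have A [measurable]: "A \<in> sets borel" unfolding A_def by measurable
    have fin: "emeasure lborel A \<le> ennreal (real n)"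
      by (rule order_trans[OF emeasure_mono[of _ "{0<..real n}"]]) (auto simp: A_def)
    define m where "m = measure lborel A"
    have m: "emeasure lborel A = ennreal m" unfolding m_def
      using fin by (intro emeasure_eq_ennreal_measure) (auto simp: top_unique)
    have ind: "(\<integral>\<^sup>+x. indicator A x \<partial>lborel_pos) = ennreal m"
    proof -
      have "(\<integral>\<^sup>+x. indicator A x \<partial>lborel_pos) = (\<integral>\<^sup>+x. indicator A x \<partial>lborel)"
        unfolding nn_integral_lborel_pos by (intro nn_integral_cong) (auto simp: A_def split: split_indicator)
      then show ?thesis using m by simp
    qed
    have "m = 0"
    proof (rule ccontr)
      assume "m \<noteq> 0"
      then have mp: "m > 0" by (simp add: m_def less_le)
      have "subdensity (\<lambda>x. indicator A x / m)"
      proof -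
        have "(\<integral>\<^sup>+x. ennreal (indicator A x / m) \<partial>lborel_pos) = (\<integral>\<^sup>+x. indicator A x * ennreal (1 / m) \<partial>lborel_pos)"
          by (intro nn_integral_cong) (auto split: split_indicator)
        also have "\<dots> = ennreal m * ennreal (1 / m)" by (subst nn_integral_multc) (auto simp: ind)
        also have "\<dots> = 1" using mp by (simp flip: ennreal_mult')
        finally show ?thesis unfolding subdensity_def using mp by auto
      qed
      from bd[OF this] have "(\<integral>\<^sup>+x. h x * ennreal (indicator A x / m) \<partial>lborel_pos) \<le> ennreal B" .
      moreover have "ennreal (B + 1) = (\<integral>\<^sup>+x. ennreal ((B + 1) / m) * indicator A x \<partial>lborel_pos)"
        using mp assms(2) by (subst nn_integral_cmult) (auto simp: ind simp flip: ennreal_mult')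
      moreover have "\<dots> \<le> (\<integral>\<^sup>+x. h x * ennreal (indicator A x / m) \<partial>lborel_pos)"
      proof (rule nn_integral_mono)
        fix x
        have "ennreal ((B + 1) / m) \<le> h x * ennreal (1 / m)" if "x \<in> A"
        proof -
          have "ennreal ((B + 1) / m) = ennreal (B + 1) * ennreal (1 / m)"
            using mp assms(2) by (subst ennreal_mult'[symmetric]) auto
          also have "\<dots> \<le> h x * ennreal (1 / m)" using that by (intro mult_right_mono) (auto simp: A_def)
          finally show ?thesis .
        qed
        then show "ennreal ((B + 1) / m) * indicator A x \<le> h x * ennreal (indicator A x / m)"
          by (auto split: split_indicator)
      qed
      ultimately have "ennreal (B + 1) \<le> ennreal B" by simp
      then show False using assms(2) by (subst (asm) ennreal_le_iff) auto
    qed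
    then have "emeasure lborel A = 0" using m by simp
    then have "AE x in lborel. x \<notin> A" by (intro AE_not_in) (auto simp: null_sets_def)
    then show ?thesis by (subst AE_restrict_space_iff) (auto simp: A_def elim!: eventually_mono)
  qed
  then have "AE x in lborel_pos. \<forall>n. \<not> (x \<le> real n \<and> h x > ennreal (B + 1))" by (subst AE_all_countable) blast
  then show ?thesis
  proof eventually_elim
    case (elim x)
    then show ?case using real_arch_simple[of x] by (meson linorder_not_less)
  qed
qed

text \<open>
  This is the converse of Hoelder's inequality: for the truncation \<open>u n\<close> of \<open>h\<close> the extremal
  function is $u^{q-1}$, normalized. Truncation makes the integral that is divided by finite.
\<close>

lemma dual_bound_finite:
  fixes h :: "real \<Rightarrow> ennreal"
  assumes [measurable]: "h \<in> borel_measurable borel" and "B \<ge> 0" and Q: "0 < Q" "Q \<le> 1"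
    and bd: "\<And>G. subdensity G \<Longrightarrow> (\<integral>\<^sup>+x. h x * ennreal (G x powr (1 - Q)) \<partial>lborel_pos) \<le> ennreal B"
  shows "AE x in lborel_pos. h x < \<infinity>" 
    and "(\<integral>\<^sup>+x. ennreal (enn2real (h x) powr (1 / Q)) \<partial>lborel_pos) \<le> ennreal (B powr (1 / Q))"
proof -
  have "AE x in lborel_pos. h x * ennreal ((1 / (1 + \<bar>x\<bar>)\<^sup>2) powr (1 - Q)) \<noteq> \<infinity>"
    using bd[OF subdensity_inverse_square] by (intro nn_integral_PInf_AE) (auto simp: top_unique)
  then show fin: "AE x in lborel_pos. h x < \<infinity>"
    by eventually_elim (auto simp: less_top[symmetric] ennreal_mult_eq_top_iff)
  define q where "q = 1 / Q"
  have q: "q \<ge> 1" "Q = 1 / q" using Q by (auto simp: q_def)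
  \<comment> \<open>bounded and with bounded support, hence with a finite integral of the \<open>q\<close>-th power\<close>
  define u where "u n x = (if \<bar>x\<bar> \<le> real n then min (enn2real (h x)) (real n) else 0)" for n x
  have u [measurable]: "u n \<in> borel_measurable borel" for n unfolding u_def by measurable
  have u0: "0 \<le> u n x" for n x by (auto simp: u_def)
  have un: "(\<integral>\<^sup>+x. ennreal (u n x powr q) \<partial>lborel_pos) \<le> ennreal (B powr q)" for n
  proof -
    define J where "J = (\<integral>\<^sup>+x. ennreal (u n x powr q) \<partial>lborel_pos)"
    have "J \<le> (\<integral>\<^sup>+x. ennreal (real n powr q) * indicator {0<..real n} x \<partial>lborel)"
      unfolding J_def nn_integral_lborel_pos
      using q by (intro nn_integral_mono) (auto simp: u_def split: split_indicator intro!: powr_mono2)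
    also have "\<dots> = ennreal (real n powr q) * ennreal (real n)" by (subst nn_integral_cmult_indicator) auto
    finally have "J < \<infinity>" by (auto simp: top_unique less_top[symmetric] simp flip: ennreal_mult')
    then obtain j where j: "J = ennreal j" "j \<ge> 0" by (cases J) auto
    show ?thesis
    proof (cases "j = 0")
      case True
      then show ?thesis using j unfolding J_def by simp
    next
      case False
      then have jp: "j > 0" using j by simp
      have "subdensity (\<lambda>x. u n x powr q / j)"
      proof -
        have "(\<integral>\<^sup>+x. ennreal (u n x powr q / j) \<partial>lborel_pos) = (\<integral>\<^sup>+x. ennreal (u n x powr q) * ennreal (1 / j) \<partial>lborel_pos)"
          using jp by (intro nn_integral_cong) (auto simp flip: ennreal_mult')
        also have "\<dots> = J * ennreal (1 / j)" unfolding J_def by (subst nn_integral_multc) auto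
        also have "\<dots> = 1" using jp j by (simp flip: ennreal_mult')
        finally show ?thesis unfolding subdensity_def using jp by auto
      qed
      note bd[OF this]
      moreover have "(\<integral>\<^sup>+x. ennreal (u n x powr q) * ennreal (j powr (Q - 1)) \<partial>lborel_pos) \<le> 
        (\<integral>\<^sup>+x. h x * ennreal ((u n x powr q / j) powr (1 - Q)) \<partial>lborel_pos)"
      proof (intro nn_integral_mono_AE eventually_mono[OF fin])
        fix x assume hx: "h x < \<infinity>"
        have e: "(u n x powr q / j) powr (1 - Q) = u n x powr (q - 1) * j powr (Q - 1)"
        proof -
          have "q * (1 - Q) = q - 1" using Q by (simp add: q_def field_simps)
          then have "(u n x powr q) powr (1 - Q) = u n x powr (q - 1)" by (simp add: powr_powr)
          moreover have "(1 / j) powr (1 - Q) = j powr (Q - 1)" 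
            using jp by (simp add: powr_divide flip: powr_minus_divide) 
          moreover have "(u n x powr q / j) powr (1 - Q) = (u n x powr q) powr (1 - Q) * (1 / j) powr (1 - Q)"
            using jp u0 by (simp flip: powr_mult)
          ultimately show ?thesis by simp
        qed
        have "u n x powr q = u n x * u n x powr (q - 1)" using u0[of n x]
          by (cases "u n x = 0") (auto simp: powr_diff)
        then have "ennreal (u n x powr q) * ennreal (j powr (Q - 1)) = ennreal (u n x) * ennreal (u n x powr (q - 1) * j powr (Q - 1))"
          using u0 by (simp add: mult.assoc flip: ennreal_mult')
        also have "\<dots> \<le> h x * ennreal (u n x powr (q - 1) * j powr (Q - 1))"
        proof (intro mult_right_mono)
          have "ennreal (u n x) \<le> ennreal (enn2real (h x))" by (intro ennreal_leI) (auto simp: u_def)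
          then show "ennreal (u n x) \<le> h x" using hx by (cases "h x") auto
        qed auto
        finally show "ennreal (u n x powr q) * ennreal (j powr (Q - 1)) \<le> h x * ennreal ((u n x powr q / j) powr (1 - Q))"
          unfolding e .
      qed
      moreover have "(\<integral>\<^sup>+x. ennreal (u n x powr q) * ennreal (j powr (Q - 1)) \<partial>lborel_pos) = J * ennreal (j powr (Q - 1))"
        unfolding J_def by (subst nn_integral_multc) auto
      moreover have "\<dots> = ennreal (j powr Q)" using jp j by (simp add: powr_diff flip: ennreal_mult')
      ultimately have "ennreal (j powr Q) \<le> ennreal B" by simp
      then have "j powr Q \<le> B" using assms(2) by simp
      then have "(j powr Q) powr q \<le> B powr q" using q by (intro powr_mono2) auto
      moreover have "(j powr Q) powr q = j" using q jp by (simp add: powr_powr)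
      ultimately show ?thesis using j assms(2) unfolding J_def by (simp add: ennreal_leI)
    qed
  qed
  have "(\<integral>\<^sup>+x. ennreal (enn2real (h x) powr q) \<partial>lborel_pos) = (\<integral>\<^sup>+x. (SUP n. ennreal (u n x powr q)) \<partial>lborel_pos)"
  proof (intro nn_integral_cong antisym)
    fix x :: real
    define n where "n = nat \<lceil>max \<bar>x\<bar> (enn2real (h x))\<rceil>"
    have "\<bar>x\<bar> \<le> real n" "enn2real (h x) \<le> real n" unfolding n_def by linarith+
    then have "u n x = enn2real (h x)" by (simp add: u_def)
    then show "ennreal (enn2real (h x) powr q) \<le> (SUP n. ennreal (u n x powr q))"
      by (metis SUP_upper UNIV_I)
    show "(SUP n. ennreal (u n x powr q)) \<le> ennreal (enn2real (h x) powr q)"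
      using q by (intro SUP_least ennreal_leI powr_mono2) (auto simp: u_def)
  qed
  also have "\<dots> = (SUP n. \<integral>\<^sup>+x. ennreal (u n x powr q) \<partial>lborel_pos)"
  proof (rule nn_integral_monotone_convergence_SUP)
    show "incseq (\<lambda>n x. ennreal (u n x powr q))"
      using q u0 by (intro monoI le_funI ennreal_leI powr_mono2) (auto simp: u_def)
  qed auto
  also have "\<dots> \<le> ennreal (B powr q)" by (intro SUP_least un)
  finally show "(\<integral>\<^sup>+x. ennreal (enn2real (h x) powr (1 / Q)) \<partial>lborel_pos) \<le> ennreal (B powr (1 / Q))" unfolding q_def .
qed

section \<open>From bilinear bounds to boundedness\<close>

definition bilinear_bound :: "(real \<Rightarrow> real \<Rightarrow> ennreal) \<Rightarrow> real \<Rightarrow> real \<Rightarrow> real \<Rightarrow> bool" where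
  "bilinear_bound k P Q B \<longleftrightarrow> (\<forall>F G. subdensity F \<longrightarrow> subdensity G \<longrightarrow>
     (\<integral>\<^sup>+x. (\<integral>\<^sup>+y. k x y * ennreal (F y powr P * G x powr (1 - Q)) \<partial>lborel_pos) \<partial>lborel_pos) \<le> ennreal B)"

lemma ereal_one_over_cases:
  fixes p :: ereal
  assumes "1 \<le> p"
  obtains "p = \<infinity>" "1 / p = ereal 0" 
    | r where "p = ereal r" "r \<ge> 1" "1 / p = ereal (1 / r)"
  using assms by (cases p) (auto simp: one_ereal_def zero_ereal_def)

lemma Lp_norm_eq_0_imp_AE:
  assumes "f \<in> borel_measurable M" "Lp_norm M (ereal r) f = 0" "r \<ge> 1"
  shows "AE x in M. f x = 0"
proof -
  define J where "J = (\<integral>\<^sup>+x. ennreal (norm (f x) powr r) \<partial>M)"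
  have "J = 0" 
  proof -
    have "J \<noteq> \<infinity>" "enn2real J powr (1 / r) \<le> 0" using assms(2) unfolding Lp_norm_def
      by (auto simp: Let_def ennreal_eq_0_iff J_def split: if_splits)
    then show ?thesis by (simp add: enn2real_eq_0_iff)
  qed
  then have "AE x in M. ennreal (norm (f x) powr r) = 0"
    unfolding J_def using assms(1) by (subst (asm) nn_integral_0_iff_AE) auto
  then show ?thesis by eventually_elim (auto simp: ennreal_eq_0_iff)
qed

text \<open>
  Normalization of an $L^p$ function. The norm may vanish, and then any strictly positive
  subdensity serves.
\<close>

lemma Lp_space_le_subdensity_powr:
  assumes f: "f \<in> Lp_space lebesgue_pos p" and p: "1 \<le> p" "1 / p = ereal P"
  obtains F where "subdensity F" "AE x in lborel_pos. norm (f x) \<le> enn2real (Lp_norm lebesgue_pos p f) * F x powr P"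
proof -
  have [measurable]: "f \<in> borel_measurable lebesgue_pos" and fin: "Lp_norm lebesgue_pos p f < \<infinity>"
    using f by (auto simp: Lp_space_def)
  obtain g where g [measurable]: "g \<in> borel_measurable borel" and fg: "AE x in lborel_pos. f x = g x"
    using complex_measurable_lebesgue_pos_AE_borel[of f] by auto
  define n where "n = enn2real (Lp_norm lebesgue_pos p f)"
  have nn: "Lp_norm lebesgue_pos p f = ennreal n" "n \<ge> 0" using fin by (auto simp: n_def)
  from p(1) show ?thesis
  proof (cases rule: ereal_one_over_cases)
    case 1
    then have P: "P = 0" using p(2) by simp
    have "AE x in lebesgue_pos. ennreal (norm (f x)) \<le> esssup lebesgue_pos (\<lambda>x. ennreal (norm (f x)))"
      by (rule esssup_AE)
    then have "AE x in lborel_pos. norm (f x) \<le> n"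
      using nn 1 by (subst AE_lebesgue_pos_iff[symmetric]) (auto simp: Lp_norm_def elim!: eventually_mono)
    then show ?thesis using P
      by (intro that[OF subdensity_inverse_square]) (auto simp: n_def elim!: eventually_mono)
  next
    case (2 r)
    then have P: "P = 1 / r" "P > 0" using p(2) by auto
    show ?thesis
    proof (cases "n = 0")
      case True
      then have "AE x in lborel_pos. f x = 0"
        using Lp_norm_eq_0_imp_AE[of f lebesgue_pos r] 2 nn by (simp add: AE_lebesgue_pos_iff)
      then show ?thesis by (intro that[OF subdensity_inverse_square]) (auto elim!: eventually_mono)
    next
      case False
      then have np: "n > 0" using nn by simp
      define J where "J = (\<integral>\<^sup>+x. ennreal (norm (f x) powr r) \<partial>lebesgue_pos)"
      have J: "J \<noteq> \<infinity>" "n = enn2real J powr (1 / r)"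
        using fin 2 unfolding n_def Lp_norm_def by (auto simp: Let_def J_def split: if_splits)
      then have "n powr r = enn2real J" using 2 by (simp add: powr_powr)
      then have Jn: "J = ennreal (n powr r)" using J(1) by (simp add: less_top)
      have "J = (\<integral>\<^sup>+x. ennreal (norm (g x) powr r) \<partial>lborel_pos)"
        unfolding J_def nn_integral_lebesgue_pos using fg by (intro nn_integral_cong_AE) (auto elim!: eventually_mono)
      then have gJ: "(\<integral>\<^sup>+x. ennreal (norm (g x) powr r) \<partial>lborel_pos) = ennreal (n powr r)" using Jn by simp
      define F where "F x = norm (g x) powr r / n powr r" for x
      have "subdensity F"
      proof -
        have "(\<integral>\<^sup>+x. ennreal (F x) \<partial>lborel_pos) = (\<integral>\<^sup>+x. ennreal (norm (g x) powr r) * ennreal (1 / n powr r) \<partial>lborel_pos)"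
          unfolding F_def by (intro nn_integral_cong) (simp flip: ennreal_mult')
        also have "\<dots> = ennreal (n powr r) * ennreal (1 / n powr r)"
          by (subst nn_integral_multc) (auto simp: gJ)
        also have "\<dots> = 1" using np by (simp flip: ennreal_mult')
        finally show ?thesis unfolding subdensity_def F_def by auto
      qed
      moreover have "n * F x powr P = norm (g x)" for x
        using np 2 by (simp add: F_def P powr_divide powr_powr)
      ultimately show ?thesis using fg
        by (intro that[of F]) (auto simp: n_def[symmetric] elim!: eventually_mono)
    qed
  qed
qed

text \<open>
  The parametrized integral does not change if the function is replaced by a Borel function that
  agrees with it almost everywhere, and then Fubini's theorem applies to the Borel measure.
\<close>

lemma kernel_integral_measurable:
  fixes f :: "real \<Rightarrow> complex"
  assumes k [measurable]: "case_prod k \<in> borel_measurable (borel \<Otimes>\<^sub>M borel)"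
    and f [measurable]: "f \<in> borel_measurable lebesgue_pos"
  shows "(\<lambda>x. LINT y|lebesgue_pos. enn2real (k x y) *\<^sub>R f y) \<in> borel_measurable lebesgue_pos"
proof -
  obtain g where g [measurable]: "g \<in> borel_measurable borel" and fg: "AE x in lborel_pos. f x = g x"
    using complex_measurable_lebesgue_pos_AE_borel[OF f] by auto
  have kx [measurable]: "k x \<in> borel_measurable borel" for x by measurable
  have eq: "(LINT y|lebesgue_pos. enn2real (k x y) *\<^sub>R f y) = (LINT y|lborel. indicator {0<..} y *\<^sub>R (enn2real (k x y) *\<^sub>R g y))" for x
  proof -
    have [measurable]: "(\<lambda>y. enn2real (k x y)) \<in> borel_measurable lebesgue_pos" "g \<in> borel_measurable lebesgue_pos"
      by (auto intro!: borel_imp_lebesgue_pos)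
    have "(LINT y|lebesgue_pos. enn2real (k x y) *\<^sub>R f y) = (LINT y|lebesgue_pos. enn2real (k x y) *\<^sub>R g y)"
      using fg by (intro integral_cong_AE) (auto simp: AE_lebesgue_pos_iff elim!: eventually_mono)
    also have "\<dots> = (LINT y|completion lborel. indicator {0<..} y *\<^sub>R (enn2real (k x y) *\<^sub>R g y))"
      by (rule integral_restrict_space) simp
    also have "\<dots> = (LINT y|lborel. indicator {0<..} y *\<^sub>R (enn2real (k x y) *\<^sub>R g y))"
    proof (rule integral_completion)
      have "(\<lambda>y. enn2real (k x y)) \<in> borel_measurable borel" by measurable
      then show "(\<lambda>y. indicator {0<..} y *\<^sub>R (enn2real (k x y) *\<^sub>R g y)) \<in> borel_measurable lborel"
        using g by (intro borel_measurable_scaleR borel_measurable_indicator) auto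
    qed
    finally show ?thesis .
  qed
  have "(\<lambda>x. LINT y|lborel. indicator {0<..} y *\<^sub>R (enn2real (k x y) *\<^sub>R g y)) \<in> borel_measurable borel"
    by measurable
  then show ?thesis unfolding eq by (rule borel_imp_lebesgue_pos)
qed

lemma norm_kernel_integral_le:
  "ennreal (norm (LINT y|lebesgue_pos. enn2real (k x y) *\<^sub>R (f y :: complex))) \<le> (\<integral>\<^sup>+y. k x y * ennreal (norm (f y)) \<partial>lebesgue_pos)"
proof -
  have e: "ennreal (enn2real a) \<le> a" for a by (cases a) auto
  have "ennreal (norm (LINT y|lebesgue_pos. enn2real (k x y) *\<^sub>R f y)) \<le> (\<integral>\<^sup>+y. ennreal (norm (enn2real (k x y) *\<^sub>R f y)) \<partial>lebesgue_pos)"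
    by (cases "integrable lebesgue_pos (\<lambda>y. enn2real (k x y) *\<^sub>R f y)")
       (auto intro: integral_norm_bound_ennreal simp: not_integrable_integral_eq simp del: norm_scaleR)
  also have "\<dots> \<le> (\<integral>\<^sup>+y. k x y * ennreal (norm (f y)) \<partial>lebesgue_pos)"
    by (intro nn_integral_mono) (auto simp: ennreal_mult intro!: mult_right_mono e)
  finally show ?thesis .
qed

text \<open>
  Duality turns the bound for the bilinear form into a bound for the nonnegative function
  $h(x) = \int k(x,y) F(y)^{1/p}\,dy$, which majorizes the image of a normalized function. Finiteness of
  \<open>h\<close> almost everywhere shows that the function belongs to the domain.
\<close>

lemma bilinear_bound_imp_Lp_Lq_bounded:
  assumes k [measurable]: "case_prod k \<in> borel_measurable (borel \<Otimes>\<^sub>M borel)"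
    and p: "1 \<le> p" "1 / p = ereal P" and q: "1 \<le> q" "1 / q = ereal Q"
    and bb: "bilinear_bound k P Q B"
  shows "Lp_Lq_bounded lebesgue_pos
     {f \<in> borel_measurable lebesgue_pos. AE x in lebesgue_pos. (\<integral>\<^sup>+y. k x y * ennreal (norm (f y)) \<partial>lebesgue_pos) < \<infinity>}
     (\<lambda>f x. LINT y|lebesgue_pos. enn2real (k x y) *\<^sub>R f y) p q"
proof -
  define B' where "B' = max B 0"
  have B': "B' \<ge> 0" "ennreal B = ennreal B'" by (auto simp: B'_def max_def ennreal_neg)
  define T where "T f x = (LINT y|lebesgue_pos. enn2real (k x y) *\<^sub>R f y)" for f :: "real \<Rightarrow> complex" and x
  have key: "(AE x in lebesgue_pos. (\<integral>\<^sup>+y. k x y * ennreal (norm (f y)) \<partial>lebesgue_pos) < \<infinity>) \<and>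
      Lp_norm lebesgue_pos q (T f) \<le> ennreal (B' + 1) * Lp_norm lebesgue_pos p f"
    if f: "f \<in> Lp_space lebesgue_pos p" for f
  proof -
    have fm [measurable]: "f \<in> borel_measurable lebesgue_pos" and fin: "Lp_norm lebesgue_pos p f < \<infinity>"
      using f by (auto simp: Lp_space_def)
    define n where "n = enn2real (Lp_norm lebesgue_pos p f)"
    have nn: "Lp_norm lebesgue_pos p f = ennreal n" "n \<ge> 0" using fin by (auto simp: n_def)
    obtain F where F: "subdensity F" and fF: "AE x in lborel_pos. norm (f x) \<le> n * F x powr P"
      using Lp_space_le_subdensity_powr[OF f p] unfolding n_def by auto
    have [measurable]: "F \<in> borel_measurable borel" using F by (simp add: subdensity_def)
    have kx [measurable]: "k x \<in> borel_measurable borel" for x by measurable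
    define h where "h x = (\<integral>\<^sup>+y. k x y * ennreal (F y powr P) \<partial>lborel_pos)" for x
    have h [measurable]: "h \<in> borel_measurable borel"
      unfolding h_def nn_integral_lborel_pos by measurable
    have hG: "(\<integral>\<^sup>+x. h x * ennreal (G x powr (1 - Q)) \<partial>lborel_pos) \<le> ennreal B'" if G: "subdensity G" for G
    proof -
      have "(\<integral>\<^sup>+x. h x * ennreal (G x powr (1 - Q)) \<partial>lborel_pos)
         = (\<integral>\<^sup>+x. (\<integral>\<^sup>+y. k x y * ennreal (F y powr P * G x powr (1 - Q)) \<partial>lborel_pos) \<partial>lborel_pos)"
        unfolding h_def by (intro nn_integral_cong, subst nn_integral_multc[symmetric]) (auto simp: ennreal_mult mult_ac)
      also have "\<dots> \<le> ennreal B'" using bb F G unfolding bilinear_bound_def B'(2) by blast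
      finally show ?thesis .
    qed
    have kf: "(\<integral>\<^sup>+y. k x y * ennreal (norm (f y)) \<partial>lebesgue_pos) \<le> ennreal n * h x" for x
    proof -
      have "(\<integral>\<^sup>+y. k x y * ennreal (norm (f y)) \<partial>lebesgue_pos) \<le> (\<integral>\<^sup>+y. ennreal n * (k x y * ennreal (F y powr P)) \<partial>lborel_pos)"
        unfolding nn_integral_lebesgue_pos
      proof (intro nn_integral_mono_AE eventually_mono[OF fF])
        fix y assume "norm (f y) \<le> n * F y powr P"
        then have "ennreal (norm (f y)) \<le> ennreal n * ennreal (F y powr P)" by (metis ennreal_leI ennreal_mult'' powr_ge_zero)
        then have "k x y * ennreal (norm (f y)) \<le> k x y * (ennreal n * ennreal (F y powr P))" by (intro mult_left_mono) auto
        then show "k x y * ennreal (norm (f y)) \<le> ennreal n * (k x y * ennreal (F y powr P))" by (simp add: mult_ac)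
      qed
      also have "\<dots> = ennreal n * h x" unfolding h_def by (rule nn_integral_cmult) measurable
      finally show ?thesis .
    qed
    have Tm [measurable]: "T f \<in> borel_measurable lebesgue_pos" unfolding T_def by (intro kernel_integral_measurable k fm)
    have Tn: "ennreal (norm (T f x)) \<le> ennreal n * h x" for x
      unfolding T_def by (rule order_trans[OF norm_kernel_integral_le kf])
    have Q: "0 \<le> Q" "Q \<le> 1" using q by (auto elim!: ereal_one_over_cases)
    have hfin: "AE x in lborel_pos. h x < \<infinity>" 
    proof (cases "Q = 0")
      case True
      have "AE x in lborel_pos. h x \<le> ennreal (B' + 1)"
        using hG True by (intro dual_bound_infinity B') (auto simp: subdensity_def powr_one)
      then show ?thesis by eventually_elim (auto simp: le_less_trans)
    next
      case False
      then show ?thesis using hG Q by (intro dual_bound_finite(1)[of h B' Q] B') auto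
    qed
    have "AE x in lebesgue_pos. (\<integral>\<^sup>+y. k x y * ennreal (norm (f y)) \<partial>lebesgue_pos) < \<infinity>"
      unfolding AE_lebesgue_pos_iff using hfin
      by eventually_elim (auto intro: le_less_trans[OF kf] simp: ennreal_mult_less_top)
    moreover have "Lp_norm lebesgue_pos q (T f) \<le> ennreal (B' + 1) * Lp_norm lebesgue_pos p f"
      using q(1)
    proof (cases rule: ereal_one_over_cases)
      case 1
      then have "Q = 0" using q by auto
      then have "AE x in lborel_pos. h x \<le> ennreal (B' + 1)"
        using hG by (intro dual_bound_infinity B') (auto simp: subdensity_def powr_one)
      then have "AE x in lebesgue_pos. ennreal (norm (T f x)) \<le> ennreal (B' + 1) * ennreal n"
        unfolding AE_lebesgue_pos_iff
        by eventually_elim (auto intro!: order_trans[OF Tn] mult_left_mono simp: mult.commute)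
      then have "esssup lebesgue_pos (\<lambda>x. ennreal (norm (T f x))) \<le> ennreal (B' + 1) * ennreal n"
        by (intro esssup_I) auto
      then show ?thesis using 1 nn by (simp add: Lp_norm_def)
    next
      case (2 r)
      then have Qr: "Q = 1 / r" "Q > 0" "1 / Q = r" using q by auto
      have "(\<integral>\<^sup>+x. ennreal (norm (T f x) powr r) \<partial>lebesgue_pos) \<le> (\<integral>\<^sup>+x. ennreal (n powr r) * ennreal (enn2real (h x) powr r) \<partial>lborel_pos)"
        unfolding nn_integral_lebesgue_pos
      proof (intro nn_integral_mono_AE eventually_mono[OF hfin])
        fix x assume "h x < \<infinity>"
        then have "ennreal (norm (T f x)) \<le> ennreal (n * enn2real (h x))" using Tn[of x] nn by (simp add: ennreal_mult)
        then have "norm (T f x) \<le> n * enn2real (h x)" using nn by (subst (asm) ennreal_le_iff) auto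
        then have "norm (T f x) powr r \<le> (n * enn2real (h x)) powr r" using 2 by (intro powr_mono2) auto
        then show "ennreal (norm (T f x) powr r) \<le> ennreal (n powr r) * ennreal (enn2real (h x) powr r)"
          using nn by (simp add: powr_mult ennreal_leI flip: ennreal_mult')
      qed
      also have "\<dots> = ennreal (n powr r) * (\<integral>\<^sup>+x. ennreal (enn2real (h x) powr r) \<partial>lborel_pos)"
        by (rule nn_integral_cmult) measurable
      also have "\<dots> \<le> ennreal (n powr r) * ennreal (B' powr r)"
        using dual_bound_finite(2)[of h B' Q] hG Q Qr B' by (intro mult_left_mono) auto
      also have "\<dots> = ennreal ((n * B') powr r)" using nn B' by (simp add: powr_mult ennreal_mult)
      finally have J: "(\<integral>\<^sup>+x. ennreal (norm (T f x) powr r) \<partial>lebesgue_pos) \<le> ennreal ((n * B') powr r)" .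
      have "Lp_norm lebesgue_pos q (T f) \<le> ennreal (((n * B') powr r) powr (1 / r))"
      proof -
        define J where "J = (\<integral>\<^sup>+x. ennreal (norm (T f x) powr r) \<partial>lebesgue_pos)"
        have "J < \<infinity>" using J unfolding J_def[symmetric] by (auto simp: top_unique less_top[symmetric])
        moreover have "enn2real J \<le> (n * B') powr r" using J unfolding J_def[symmetric]
          by (metis enn2real_leI powr_ge_zero)
        ultimately show ?thesis using 2 unfolding Lp_norm_def
          by (auto simp: J_def[symmetric] Let_def intro!: ennreal_leI powr_mono2)
      qed
      also have "((n * B') powr r) powr (1 / r) = n * B'" using nn B' 2 by (simp add: powr_powr)
      also have "ennreal (n * B') \<le> ennreal (B' + 1) * ennreal n" using nn B'
        by (subst ennreal_mult''[symmetric]) (auto intro!: ennreal_leI simp: algebra_simps)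
      finally show ?thesis unfolding nn .
    qed
    ultimately show ?thesis by blast
  qed
  have Tm: "T f \<in> borel_measurable lebesgue_pos" if "f \<in> Lp_space lebesgue_pos p" for f
    unfolding T_def using that by (intro kernel_integral_measurable k) (auto simp: Lp_space_def)
  show ?thesis unfolding Lp_Lq_bounded_def T_def[symmetric]
  proof (intro conjI exI[of _ "B' + 1"] ballI)
    show "Lp_space lebesgue_pos p \<subseteq> {f \<in> borel_measurable lebesgue_pos. AE x in lebesgue_pos. (\<integral>\<^sup>+y. k x y * ennreal (norm (f y)) \<partial>lebesgue_pos) < \<infinity>}"
      using key by (auto simp: Lp_space_def)
    fix f assume f: "f \<in> Lp_space lebesgue_pos p"
    show "Lp_norm lebesgue_pos q (\<lambda>x. T f x) \<le> ennreal (B' + 1) * Lp_norm lebesgue_pos p f" using key[OF f] by simp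
    then have "Lp_norm lebesgue_pos q (T f) < \<infinity>"
      using f by (auto simp: Lp_space_def ennreal_mult_less_top intro: le_less_trans)
    then show "(\<lambda>x. T f x) \<in> Lp_space lebesgue_pos q" using Tm[OF f] by (simp add: Lp_space_def)
  qed (use B' in auto)
qed

\<comment> \<open>As default rules these two would also be tried on goals about \<^term>\<open>lborel\<close>, where they
  lead to unprovable subgoals.\<close>
declare borel_imp_lborel_pos [measurable del] measurable_ident_lborel_pos [measurable del]

section \<open>Power profiles\<close>

text \<open>
  Different powers near $0$ and near $\infty$: integrable on the half-line if $a < 1 < b$.
\<close>

definition power_profile :: "real \<Rightarrow> real \<Rightarrow> real \<Rightarrow> real" where
  "power_profile a b u = (if u \<le> 1 then u powr (- a) else u powr (- b))"

lemma power_profile_measurable [measurable]: "power_profile a b \<in> borel_measurable borel"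
  unfolding power_profile_def by measurable

lemma power_profile_nonneg [simp]: "0 \<le> power_profile a b u"
  by (simp add: power_profile_def)

lemma power_profile_powr: "power_profile a b u powr r = power_profile (a * r) (b * r) u"
  by (simp add: power_profile_def powr_powr)

lemma nn_integral_power_profile_finite:
  assumes "a < 1" "b > 1"
  shows "(\<integral>\<^sup>+u. power_profile a b u \<partial>lborel_pos) < \<infinity>"
proof -
  have "(\<integral>\<^sup>+u. power_profile a b u \<partial>lborel_pos)
    \<le> (\<integral>\<^sup>+u. ennreal (u powr (- a)) * indicator {0..1} u + ennreal (u powr (- b)) * indicator {1..} u \<partial>lborel)"
    unfolding nn_integral_lborel_pos by (intro nn_integral_mono) (auto simp: power_profile_def split: split_indicator)
  also have "\<dots> = (\<integral>\<^sup>+u. ennreal (u powr (- a)) * indicator {0..1} u \<partial>lborel) + (\<integral>\<^sup>+u. ennreal (u powr (- b)) * indicator {1..} u \<partial>lborel)"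
    by (rule nn_integral_add) measurable
  also have "(\<integral>\<^sup>+u. ennreal (u powr (- a)) * indicator {0..1} u \<partial>lborel) = ennreal (1 powr (- a + 1) / (- a + 1))"
    using assms by (intro nn_integral_has_integral_lebesgue' has_integral_powr_from_0) auto
  also have "(\<integral>\<^sup>+u. ennreal (u powr (- b)) * indicator {1..} u \<partial>lborel) = ennreal (- (1 powr (- b + 1)) / (- b + 1))"
    using assms by (intro nn_integral_has_integral_lebesgue' has_integral_powr_to_inf) auto
  finally show ?thesis by (auto intro: le_less_trans)
qed

text \<open>
  Translation and dilation invariance of the integral. The factor $2$ accounts for the two sides
  of \<open>y\<close>.
\<close>

lemma nn_integral_abs_scaled_le:
  fixes f :: "real \<Rightarrow> ennreal"
  assumes [measurable]: "f \<in> borel_measurable borel" and "a > 0"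
  shows "(\<integral>\<^sup>+x. ennreal a * f (a * \<bar>x - y\<bar>) \<partial>lborel_pos) \<le> 2 * (\<integral>\<^sup>+u. f u \<partial>lborel_pos)"
proof -
  have "(\<integral>\<^sup>+x. ennreal a * f (a * \<bar>x - y\<bar>) \<partial>lborel_pos) \<le> (\<integral>\<^sup>+x. ennreal a * f (a * \<bar>x - y\<bar>) \<partial>lborel)"
    unfolding nn_integral_lborel_pos by (intro nn_integral_mono) (auto split: split_indicator)
  also have "\<dots> = ennreal a * (\<integral>\<^sup>+x. f (a * \<bar>x - y\<bar>) \<partial>lborel)" by (rule nn_integral_cmult) measurable
  also have "(\<integral>\<^sup>+x. f (a * \<bar>x - y\<bar>) \<partial>lborel) = ennreal \<bar>1 / a\<bar> * (\<integral>\<^sup>+u. f (a * \<bar>(y + 1 / a * u) - y\<bar>) \<partial>lborel)"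
    using assms(2) by (intro nn_integral_real_affine) auto
  also have "(\<integral>\<^sup>+u. f (a * \<bar>(y + 1 / a * u) - y\<bar>) \<partial>lborel) = (\<integral>\<^sup>+u. f \<bar>u\<bar> \<partial>lborel)"
    using assms(2) by (intro nn_integral_cong) (simp add: abs_mult)
  also have "ennreal a * (ennreal \<bar>1 / a\<bar> * (\<integral>\<^sup>+u. f \<bar>u\<bar> \<partial>lborel)) = (\<integral>\<^sup>+u. f \<bar>u\<bar> \<partial>lborel)"
    using assms(2) by (simp flip: mult.assoc ennreal_mult')
  also have "\<dots> = (\<integral>\<^sup>+u. f u * indicator {0<..} u + f (- u) * indicator {..<0} u \<partial>lborel)"
    by (intro nn_integral_cong_AE eventually_mono[OF AE_lborel_singleton[of 0]]) (auto split: split_indicator)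
  also have "\<dots> = (\<integral>\<^sup>+u. f u * indicator {0<..} u \<partial>lborel) + (\<integral>\<^sup>+u. f (- u) * indicator {..<0} u \<partial>lborel)"
    by (rule nn_integral_add) measurable
  also have "(\<integral>\<^sup>+u. f u * indicator {0<..} u \<partial>lborel) = ennreal \<bar>-1\<bar> * (\<integral>\<^sup>+u. f (0 + (-1) * u) * indicator {0<..} (0 + (-1) * u :: real) \<partial>lborel)"
    by (rule nn_integral_real_affine) auto
  also have "(\<integral>\<^sup>+u. f (0 + (-1) * u) * indicator {0<..} (0 + (-1) * u :: real) \<partial>lborel) = (\<integral>\<^sup>+u. f (- u) * indicator {..<0} u \<partial>lborel)"
    by (intro nn_integral_cong) (auto split: split_indicator)
  also have "(\<integral>\<^sup>+u. f (- u) * indicator {..<0} u \<partial>lborel) = (\<integral>\<^sup>+u. f u * indicator {0<..} u \<partial>lborel)"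
    by (subst nn_integral_real_affine[where c = "-1" and t = 0]) (auto intro!: nn_integral_cong split: split_indicator)
  finally show ?thesis unfolding nn_integral_lborel_pos by (simp add: mult_2)
qed

lemma nn_integral_abs_diff_le:
  fixes f :: "real \<Rightarrow> ennreal"
  assumes "f \<in> borel_measurable borel"
  shows "(\<integral>\<^sup>+x. f \<bar>x - y\<bar> \<partial>lborel_pos) \<le> 2 * (\<integral>\<^sup>+u. f u \<partial>lborel_pos)"
  using nn_integral_abs_scaled_le[OF assms, of 1 y] by simp

text \<open>
  A weak form of the inequality of weighted arithmetic and geometric means, which is enough because
  constants are irrelevant: all factors are bounded by the corresponding powers of the maximum.
\<close>

lemma weighted_product_le_sum:
  fixes x y z a b c :: real
  assumes "x \<ge> 0" "y \<ge> 0" "z \<ge> 0" "a \<ge> 0" "b \<ge> 0" "c \<ge> 0" "a + b + c = 1"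
  shows "x powr a * y powr b * z powr c \<le> x + y + z"
proof -
  define m where "m = max x (max y z)"
  have m: "0 \<le> m" "x \<le> m" "y \<le> m" "z \<le> m" "m \<le> x + y + z" using assms by (auto simp: m_def)
  have "x powr a * y powr b * z powr c \<le> m powr a * m powr b * m powr c"
    using assms m by (intro mult_mono powr_mono2) auto
  also have "\<dots> = m powr (a + b + c)" by (simp add: powr_add)
  also have "\<dots> = m" using m assms by simp
  finally show ?thesis using m by simp
qed

section \<open>Majorants for bilinear forms\<close>

definition bilinear_bounded :: "(real \<Rightarrow> real \<Rightarrow> ennreal) \<Rightarrow> real \<Rightarrow> real \<Rightarrow> bool" where
  "bilinear_bounded k P Q \<longleftrightarrow> (\<exists>B. bilinear_bound k P Q B)"

lemma nn_integral_subdensity_le: "subdensity F \<Longrightarrow> (\<integral>\<^sup>+x. F x \<partial>lborel_pos) \<le> 1"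
  by (simp add: subdensity_def)

lemma AE_lborel_pos_I:
  assumes "\<And>x. x > 0 \<Longrightarrow> x \<noteq> a \<Longrightarrow> R x"
  shows "AE x in lborel_pos. R x"
proof (subst AE_restrict_space_iff)
  show "AE x\<in>{0<..} in lborel. R x"
    using AE_lborel_singleton[of a] by eventually_elim (use assms in auto)
qed auto

text \<open>
  The integral of $M_1(x,y) F(y)$ is finite since that of $M_1(\cdot,y)$ is bounded and
  $\int F \le 1$; likewise for $M_2(x,y) G(x)$. The functions may depend on \<open>F\<close> and \<open>G\<close>, so
  that a product $F(y)G(x)$ is covered by $M_1(x,y) = G(x)$. The diagonal, where the kernels may be
  infinite, is left out.
\<close>

definition bilinear_majorant where
  "bilinear_majorant k P Q B F G M1 M2 N \<longleftrightarrow>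
     case_prod M1 \<in> borel_measurable (borel \<Otimes>\<^sub>M borel) \<and> case_prod M2 \<in> borel_measurable (borel \<Otimes>\<^sub>M borel) \<and>
     case_prod N \<in> borel_measurable (borel \<Otimes>\<^sub>M borel) \<and>
     (\<forall>x>0. \<forall>y>0. x \<noteq> y \<longrightarrow> k x y * ennreal (F y powr P * G x powr (1 - Q)) \<le> M1 x y * ennreal (F y) + M2 x y * ennreal (G x) + N x y) \<and>
     (\<forall>y>0. (\<integral>\<^sup>+x. M1 x y \<partial>lborel_pos) \<le> B) \<and> (\<forall>x>0. (\<integral>\<^sup>+y. M2 x y \<partial>lborel_pos) \<le> B) \<and>
     (\<integral>\<^sup>+x. \<integral>\<^sup>+y. N x y \<partial>lborel_pos \<partial>lborel_pos) \<le> B"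
  for k M1 M2 N :: "real \<Rightarrow> real \<Rightarrow> ennreal" and F G :: "real \<Rightarrow> real"

lemma bilinear_boundedI:
  assumes "\<And>F G. subdensity F \<Longrightarrow> subdensity G \<Longrightarrow> \<exists>M1 M2 N. bilinear_majorant k P Q B F G M1 M2 N"
   and B: "B < \<infinity>"
  shows "bilinear_bounded k P Q"
  unfolding bilinear_bounded_def bilinear_bound_def
proof (intro exI[of _ "3 * enn2real B"] allI impI)
  fix F G assume F: "subdensity F" and G: "subdensity G"
  have [measurable]: "F \<in> borel_measurable borel" "G \<in> borel_measurable borel"
    using F G by (auto simp: subdensity_def)
  obtain M1 M2 N where maj: "bilinear_majorant k P Q B F G M1 M2 N"
    using assms(1)[OF F G] by auto
  have M [measurable]: "case_prod M1 \<in> borel_measurable (borel \<Otimes>\<^sub>M borel)"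
     "case_prod M2 \<in> borel_measurable (borel \<Otimes>\<^sub>M borel)" "case_prod N \<in> borel_measurable (borel \<Otimes>\<^sub>M borel)"
    and le: "\<And>x y. x > 0 \<Longrightarrow> y > 0 \<Longrightarrow> x \<noteq> y \<Longrightarrow> k x y * ennreal (F y powr P * G x powr (1 - Q)) \<le> M1 x y * ennreal (F y) + M2 x y * ennreal (G x) + N x y"
    and i1: "\<And>y. y > 0 \<Longrightarrow> (\<integral>\<^sup>+x. M1 x y \<partial>lborel_pos) \<le> B" and i2: "\<And>x. x > 0 \<Longrightarrow> (\<integral>\<^sup>+y. M2 x y \<partial>lborel_pos) \<le> B"
    and i3: "(\<integral>\<^sup>+x. \<integral>\<^sup>+y. N x y \<partial>lborel_pos \<partial>lborel_pos) \<le> B"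
    using maj unfolding bilinear_majorant_def by simp_all
  note [measurable] = borel_imp_lborel_pos borel_pair_imp_lborel_pos[OF M(1)] borel_pair_imp_lborel_pos[OF M(2)] borel_pair_imp_lborel_pos[OF M(3)]
  have Mx: "M1 x \<in> borel_measurable borel" "M2 x \<in> borel_measurable borel" "N x \<in> borel_measurable borel" for x
    by measurable
  have My: "(\<lambda>x. M1 x y) \<in> borel_measurable borel" for y by measurable
  have m2: "(\<lambda>x. \<integral>\<^sup>+y. g x y \<partial>lborel_pos) \<in> borel_measurable lborel_pos" 
    if [measurable]: "case_prod g \<in> borel_measurable (borel \<Otimes>\<^sub>M borel)" for g :: "real \<Rightarrow> real \<Rightarrow> ennreal"
    unfolding nn_integral_lborel_pos by (rule borel_imp_lborel_pos) measurable
  have "(\<integral>\<^sup>+x. \<integral>\<^sup>+y. k x y * ennreal (F y powr P * G x powr (1 - Q)) \<partial>lborel_pos \<partial>lborel_pos)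
     \<le> (\<integral>\<^sup>+x. \<integral>\<^sup>+y. M1 x y * ennreal (F y) + M2 x y * ennreal (G x) + N x y \<partial>lborel_pos \<partial>lborel_pos)"
  proof (rule nn_integral_mono, rule nn_integral_mono_AE)
    fix x assume "x \<in> space lborel_pos"
    then show "AE y in lborel_pos. k x y * ennreal (F y powr P * G x powr (1 - Q)) \<le> M1 x y * ennreal (F y) + M2 x y * ennreal (G x) + N x y"
      by (intro AE_lborel_pos_I[of x] le) auto
  qed
  also have "\<dots> = (\<integral>\<^sup>+x. (\<integral>\<^sup>+y. M1 x y * ennreal (F y) \<partial>lborel_pos) + (\<integral>\<^sup>+y. M2 x y * ennreal (G x) \<partial>lborel_pos) + (\<integral>\<^sup>+y. N x y \<partial>lborel_pos) \<partial>lborel_pos)"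
  proof (intro nn_integral_cong)
    fix x
    have "(\<lambda>y. M1 x y * ennreal (F y)) \<in> borel_measurable lborel_pos" "(\<lambda>y. M2 x y * ennreal (G x)) \<in> borel_measurable lborel_pos"
      "(\<lambda>y. N x y) \<in> borel_measurable lborel_pos"
      by (rule borel_imp_lborel_pos; measurable)+
    then show "(\<integral>\<^sup>+y. M1 x y * ennreal (F y) + M2 x y * ennreal (G x) + N x y \<partial>lborel_pos) =
      (\<integral>\<^sup>+y. M1 x y * ennreal (F y) \<partial>lborel_pos) + (\<integral>\<^sup>+y. M2 x y * ennreal (G x) \<partial>lborel_pos) + (\<integral>\<^sup>+y. N x y \<partial>lborel_pos)"
      by (simp add: nn_integral_add borel_measurable_add)
  qed
  also have "\<dots> = (\<integral>\<^sup>+x. (\<integral>\<^sup>+y. M1 x y * ennreal (F y) \<partial>lborel_pos) \<partial>lborel_pos) + (\<integral>\<^sup>+x. (\<integral>\<^sup>+y. M2 x y * ennreal (G x) \<partial>lborel_pos) \<partial>lborel_pos)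
      + (\<integral>\<^sup>+x. (\<integral>\<^sup>+y. N x y \<partial>lborel_pos) \<partial>lborel_pos)"
  proof -
    have "(\<lambda>x. \<integral>\<^sup>+y. M1 x y * ennreal (F y) \<partial>lborel_pos) \<in> borel_measurable lborel_pos"
      "(\<lambda>x. \<integral>\<^sup>+y. M2 x y * ennreal (G x) \<partial>lborel_pos) \<in> borel_measurable lborel_pos"
      "(\<lambda>x. \<integral>\<^sup>+y. N x y \<partial>lborel_pos) \<in> borel_measurable lborel_pos"
      by (rule m2; measurable)+
    then show ?thesis by (simp add: nn_integral_add borel_measurable_add)
  qed
  also have "\<dots> \<le> B + B + B"
  proof (intro add_mono i3)
    have "(\<integral>\<^sup>+x. (\<integral>\<^sup>+y. M1 x y * ennreal (F y) \<partial>lborel_pos) \<partial>lborel_pos) = (\<integral>\<^sup>+y. (\<integral>\<^sup>+x. M1 x y * ennreal (F y) \<partial>lborel_pos) \<partial>lborel_pos)"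
      by (rule lborel_pos_pair.Fubini'[symmetric]) measurable
    also have "\<dots> = (\<integral>\<^sup>+y. (\<integral>\<^sup>+x. M1 x y \<partial>lborel_pos) * ennreal (F y) \<partial>lborel_pos)"
      by (intro nn_integral_cong nn_integral_multc borel_imp_lborel_pos My)
    also have "\<dots> \<le> (\<integral>\<^sup>+y. B * ennreal (F y) \<partial>lborel_pos)"
      by (intro nn_integral_mono mult_right_mono i1) auto
    also have "\<dots> = B * (\<integral>\<^sup>+y. ennreal (F y) \<partial>lborel_pos)" by (rule nn_integral_cmult) (auto intro: borel_imp_lborel_pos)
    also have "\<dots> \<le> B * 1" by (intro mult_left_mono nn_integral_subdensity_le F) auto
    finally show "(\<integral>\<^sup>+x. (\<integral>\<^sup>+y. M1 x y * ennreal (F y) \<partial>lborel_pos) \<partial>lborel_pos) \<le> B" by simp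
    have "(\<integral>\<^sup>+x. (\<integral>\<^sup>+y. M2 x y * ennreal (G x) \<partial>lborel_pos) \<partial>lborel_pos) = (\<integral>\<^sup>+x. (\<integral>\<^sup>+y. M2 x y \<partial>lborel_pos) * ennreal (G x) \<partial>lborel_pos)"
      by (intro nn_integral_cong nn_integral_multc borel_imp_lborel_pos Mx)
    also have "\<dots> \<le> (\<integral>\<^sup>+x. B * ennreal (G x) \<partial>lborel_pos)"
      by (intro nn_integral_mono mult_right_mono i2) auto
    also have "\<dots> = B * (\<integral>\<^sup>+x. ennreal (G x) \<partial>lborel_pos)" by (rule nn_integral_cmult) (auto intro: borel_imp_lborel_pos)
    also have "\<dots> \<le> B * 1" by (intro mult_left_mono nn_integral_subdensity_le G) auto
    finally show "(\<integral>\<^sup>+x. (\<integral>\<^sup>+y. M2 x y * ennreal (G x) \<partial>lborel_pos) \<partial>lborel_pos) \<le> B" by simp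
  qed
  also have "B + B + B = ennreal (3 * enn2real B)"
    using B by (cases B) (auto simp flip: ennreal_plus)
  finally show "(\<integral>\<^sup>+x. \<integral>\<^sup>+y. k x y * ennreal (F y powr P * G x powr (1 - Q)) \<partial>lborel_pos \<partial>lborel_pos) \<le> ennreal (3 * enn2real B)" .
qed

lemma bilinear_bounded_mono:
  assumes "bilinear_bounded k' P Q" and k' [measurable]: "case_prod k' \<in> borel_measurable (borel \<Otimes>\<^sub>M borel)"
    and le: "\<And>x y. x > 0 \<Longrightarrow> y > 0 \<Longrightarrow> x \<noteq> y \<Longrightarrow> k x y \<le> ennreal c * k' x y"
  shows "bilinear_bounded k P Q"
proof -
  obtain B where B: "bilinear_bound k' P Q B" using assms by (auto simp: bilinear_bounded_def)
  show ?thesis unfolding bilinear_bounded_def bilinear_bound_def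
  proof (intro exI[of _ "max 0 c * max 0 B"] allI impI)
    fix F G assume F: "subdensity F" and G: "subdensity G"
    have [measurable]: "F \<in> borel_measurable borel" "G \<in> borel_measurable borel"
      using F G by (auto simp: subdensity_def)
    have kx [measurable]: "k' x \<in> borel_measurable borel" for x by measurable
    have "(\<integral>\<^sup>+x. \<integral>\<^sup>+y. k x y * ennreal (F y powr P * G x powr (1 - Q)) \<partial>lborel_pos \<partial>lborel_pos)
      \<le> (\<integral>\<^sup>+x. \<integral>\<^sup>+y. ennreal c * (k' x y * ennreal (F y powr P * G x powr (1 - Q))) \<partial>lborel_pos \<partial>lborel_pos)"
    proof (rule nn_integral_mono, rule nn_integral_mono_AE)
      fix x assume "x \<in> space lborel_pos"
      then show "AE y in lborel_pos. k x y * ennreal (F y powr P * G x powr (1 - Q)) \<le> ennreal c * (k' x y * ennreal (F y powr P * G x powr (1 - Q)))"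
        by (intro AE_lborel_pos_I[of x]) (auto simp flip: mult.assoc intro!: mult_right_mono le)
    qed
    also have "\<dots> = (\<integral>\<^sup>+x. ennreal c * (\<integral>\<^sup>+y. k' x y * ennreal (F y powr P * G x powr (1 - Q)) \<partial>lborel_pos) \<partial>lborel_pos)"
      by (intro nn_integral_cong nn_integral_cmult borel_imp_lborel_pos) measurable
    also have "\<dots> = ennreal c * (\<integral>\<^sup>+x. (\<integral>\<^sup>+y. k' x y * ennreal (F y powr P * G x powr (1 - Q)) \<partial>lborel_pos) \<partial>lborel_pos)"
      unfolding nn_integral_lborel_pos[of "\<lambda>y. k' x y * ennreal (F y powr P * G x powr (1 - Q))" for x]
      by (intro nn_integral_cmult borel_imp_lborel_pos) measurable
    also have "\<dots> \<le> ennreal c * ennreal B" using B F G unfolding bilinear_bound_def by (intro mult_left_mono) auto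
    also have "\<dots> = ennreal (max 0 c * max 0 B)"
      by (subst ennreal_mult) (auto simp: max_def ennreal_neg)
    finally show "(\<integral>\<^sup>+x. \<integral>\<^sup>+y. k x y * ennreal (F y powr P * G x powr (1 - Q)) \<partial>lborel_pos \<partial>lborel_pos) \<le> ennreal (max 0 c * max 0 B)" .
  qed
qed

lemma bilinear_bounded_add:
  assumes "bilinear_bounded k P Q" "bilinear_bounded k' P Q" 
    and k [measurable]: "case_prod k \<in> borel_measurable (borel \<Otimes>\<^sub>M borel)"
    and k' [measurable]: "case_prod k' \<in> borel_measurable (borel \<Otimes>\<^sub>M borel)"
  shows "bilinear_bounded (\<lambda>x y. k x y + k' x y) P Q"
proof -
  obtain B B' where B: "bilinear_bound k P Q B" "bilinear_bound k' P Q B'" using assms by (auto simp: bilinear_bounded_def)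
  show ?thesis unfolding bilinear_bounded_def bilinear_bound_def
  proof (intro exI[of _ "max 0 B + max 0 B'"] allI impI)
    fix F G assume F: "subdensity F" and G: "subdensity G"
    have [measurable]: "F \<in> borel_measurable borel" "G \<in> borel_measurable borel"
      using F G by (auto simp: subdensity_def)
    have "(\<integral>\<^sup>+x. \<integral>\<^sup>+y. (k x y + k' x y) * ennreal (F y powr P * G x powr (1 - Q)) \<partial>lborel_pos \<partial>lborel_pos)
       = (\<integral>\<^sup>+x. (\<integral>\<^sup>+y. k x y * ennreal (F y powr P * G x powr (1 - Q)) \<partial>lborel_pos) + (\<integral>\<^sup>+y. k' x y * ennreal (F y powr P * G x powr (1 - Q)) \<partial>lborel_pos) \<partial>lborel_pos)"
      unfolding distrib_right by (intro nn_integral_cong nn_integral_add borel_imp_lborel_pos) measurable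
    also have "\<dots> = (\<integral>\<^sup>+x. \<integral>\<^sup>+y. k x y * ennreal (F y powr P * G x powr (1 - Q)) \<partial>lborel_pos \<partial>lborel_pos) + (\<integral>\<^sup>+x. \<integral>\<^sup>+y. k' x y * ennreal (F y powr P * G x powr (1 - Q)) \<partial>lborel_pos \<partial>lborel_pos)"
      unfolding nn_integral_lborel_pos[of "\<lambda>y. k' x y * ennreal (F y powr P * G x powr (1 - Q))" for x]
       nn_integral_lborel_pos[of "\<lambda>y. k x y * ennreal (F y powr P * G x powr (1 - Q))" for x]
      by (intro nn_integral_add borel_imp_lborel_pos) measurable
    also have "\<dots> \<le> ennreal B + ennreal B'" using B F G unfolding bilinear_bound_def by (intro add_mono) auto
    also have "\<dots> = ennreal (max 0 B + max 0 B')" by (subst ennreal_plus) (auto simp: max_def ennreal_neg)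
    finally show "(\<integral>\<^sup>+x. \<integral>\<^sup>+y. (k x y + k' x y) * ennreal (F y powr P * G x powr (1 - Q)) \<partial>lborel_pos \<partial>lborel_pos) \<le> ennreal (max 0 B + max 0 B')" .
  qed
qed

section \<open>Convolution kernels\<close>

lemma bilinear_bounded_const:
  "bilinear_bounded (\<lambda>x y. ennreal c) 1 0"
proof (rule bilinear_boundedI[where B = "ennreal c"])
  fix F G assume F: "subdensity F" and G: "subdensity G"
  have [measurable]: "F \<in> borel_measurable borel" "G \<in> borel_measurable borel"
    using F G by (auto simp: subdensity_def)
  show "\<exists>M1 M2 N. bilinear_majorant (\<lambda>x y. ennreal c) 1 0 (ennreal c) F G M1 M2 N"
  proof (intro exI, unfold bilinear_majorant_def, intro conjI allI impI)
    show "case_prod (\<lambda>x y::real. ennreal c * ennreal (G x)) \<in> borel_measurable (borel \<Otimes>\<^sub>M borel)" by measurable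
    show "case_prod (\<lambda>x y::real. 0 :: ennreal) \<in> borel_measurable (borel \<Otimes>\<^sub>M borel)" by measurable
    show "case_prod (\<lambda>x y::real. 0 :: ennreal) \<in> borel_measurable (borel \<Otimes>\<^sub>M borel)" by measurable
    fix x y :: real
    have "F y \<ge> 0" "G x \<ge> 0" using F G by (auto simp: subdensity_def)
    then show "ennreal c * ennreal (F y powr 1 * G x powr (1 - 0)) \<le> ennreal c * ennreal (G x) * ennreal (F y) + 0 * ennreal (G x) + 0"
      by (simp add: ennreal_mult mult_ac)
    have "(\<integral>\<^sup>+x. ennreal c * ennreal (G x) \<partial>lborel_pos) = ennreal c * (\<integral>\<^sup>+x. ennreal (G x) \<partial>lborel_pos)"
      by (intro nn_integral_cmult borel_imp_lborel_pos) measurable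
    also have "\<dots> \<le> ennreal c * 1" by (intro mult_left_mono nn_integral_subdensity_le G) auto
    finally show "(\<integral>\<^sup>+x. ennreal c * ennreal (G x) \<partial>lborel_pos) \<le> ennreal c" by simp
  qed auto
qed simp

text \<open>
  With $1/r = 1-(P-Q)$ one has
  $\phi F^P G^{1-Q} = (\phi^r F)^Q (FG)^{P-Q} (\phi^r G)^{1-P}$, where the exponents add up to $1$.
\<close>

lemma bilinear_bounded_young:
  fixes \<phi> :: "real \<Rightarrow> real"
  assumes [measurable]: "\<phi> \<in> borel_measurable borel" and \<phi>: "\<And>u. \<phi> u \<ge> 0"
    and PQ: "0 \<le> Q" "Q \<le> P" "P \<le> 1" "P - Q < 1"
    and int: "(\<integral>\<^sup>+u. ennreal (\<phi> u powr (1 / (1 - (P - Q)))) \<partial>lborel_pos) < \<infinity>"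
  shows "bilinear_bounded (\<lambda>x y. ennreal (\<phi> \<bar>x - y\<bar>)) P Q"
proof -
  define r where "r = 1 / (1 - (P - Q))"
  define I where "I = (\<integral>\<^sup>+u. ennreal (\<phi> u powr r) \<partial>lborel_pos)"
  have rI: "I < \<infinity>" using int by (simp add: I_def r_def)
  have r: "r * Q + r * (1 - P) = 1"
  proof -
    have "r * Q + r * (1 - P) = r * (1 - (P - Q))" by (simp add: algebra_simps)
    then show ?thesis using PQ by (simp add: r_def)
  qed
  show ?thesis
  proof (rule bilinear_boundedI[where B = "2 * I + 1"])
    show "2 * I + 1 < \<infinity>" using rI by (simp add: ennreal_mult_less_top)
    fix F G assume F: "subdensity F" and G: "subdensity G"
    have [measurable]: "F \<in> borel_measurable borel" "G \<in> borel_measurable borel"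
      using F G by (auto simp: subdensity_def)
    have nonneg: "F y \<ge> 0" "G y \<ge> 0" for y using F G by (auto simp: subdensity_def)
    define \<psi> where "\<psi> x y = ennreal (\<phi> \<bar>x - y\<bar> powr r)" for x y
    have \<psi>1: "(\<integral>\<^sup>+x. \<psi> x y \<partial>lborel_pos) \<le> 2 * I" for y
      unfolding \<psi>_def I_def by (rule nn_integral_abs_diff_le[of "\<lambda>u. ennreal (\<phi> u powr r)"]) measurable
    have \<psi>2: "(\<integral>\<^sup>+y. \<psi> x y \<partial>lborel_pos) \<le> 2 * I + 1" for x
      using order_trans[OF \<psi>1[of x], of "2 * I + 1"] by (simp add: \<psi>_def abs_minus_commute add_increasing2)
    show "\<exists>M1 M2 N. bilinear_majorant (\<lambda>x y. ennreal (\<phi> \<bar>x - y\<bar>)) P Q (2 * I + 1) F G M1 M2 N"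
    proof (intro exI, unfold bilinear_majorant_def, intro conjI allI impI)
      show "case_prod (\<lambda>x y. \<psi> x y + ennreal (G x)) \<in> borel_measurable (borel \<Otimes>\<^sub>M borel)" unfolding \<psi>_def by measurable
      show "case_prod \<psi> \<in> borel_measurable (borel \<Otimes>\<^sub>M borel)" unfolding \<psi>_def by measurable
      show "case_prod (\<lambda>x y::real. 0 :: ennreal) \<in> borel_measurable (borel \<Otimes>\<^sub>M borel)" by measurable
      show "(\<integral>\<^sup>+y. \<psi> x y \<partial>lborel_pos) \<le> 2 * I + 1" for x by (rule \<psi>2)
      fix x y :: real
      define t where "t = \<phi> \<bar>x - y\<bar>"
      have t: "t \<ge> 0" using \<phi> by (simp add: t_def)
      have "t * (F y powr P * G x powr (1 - Q)) = (t powr r * F y) powr Q * (F y * G x) powr (P - Q) * (t powr r * G x) powr (1 - P)"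
      proof -
        have "t = t powr (r * Q + r * (1 - P))" unfolding r using t by simp
        also have "\<dots> = t powr (r * Q) * t powr (r * (1 - P))" by (rule powr_add)
        finally have 1: "t = t powr (r * Q) * t powr (r * (1 - P))" .
        have 2: "F y powr P = F y powr Q * F y powr (P - Q)" by (simp flip: powr_add)
        have 3: "G x powr (1 - Q) = G x powr (P - Q) * G x powr (1 - P)" by (simp flip: powr_add)
        have "t * (F y powr P * G x powr (1 - Q)) = (t powr (r * Q) * t powr (r * (1 - P))) * (F y powr P * G x powr (1 - Q))"
          using 1 by simp
        then show ?thesis unfolding 2 3 powr_mult powr_powr by (simp add: mult_ac)
      qed
      also have "\<dots> \<le> t powr r * F y + F y * G x + t powr r * G x"
        using PQ nonneg t by (intro weighted_product_le_sum) auto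
      finally have "ennreal (t * (F y powr P * G x powr (1 - Q))) \<le> ennreal (t powr r * F y + F y * G x + t powr r * G x)"
        by (rule ennreal_leI)
      then show "ennreal (\<phi> \<bar>x - y\<bar>) * ennreal (F y powr P * G x powr (1 - Q)) \<le> (\<psi> x y + ennreal (G x)) * ennreal (F y) + \<psi> x y * ennreal (G x) + 0"
        using nonneg t by (simp add: t_def[symmetric] \<psi>_def ennreal_mult ennreal_plus distrib_right distrib_left mult_ac)
      have "(\<integral>\<^sup>+x. \<psi> x y + ennreal (G x) \<partial>lborel_pos) = (\<integral>\<^sup>+x. \<psi> x y \<partial>lborel_pos) + (\<integral>\<^sup>+x. ennreal (G x) \<partial>lborel_pos)"
        unfolding \<psi>_def by (intro nn_integral_add borel_imp_lborel_pos) measurable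
      also have "\<dots> \<le> 2 * I + 1" by (intro add_mono \<psi>1 nn_integral_subdensity_le G)
      finally show "(\<integral>\<^sup>+x. \<psi> x y + ennreal (G x) \<partial>lborel_pos) \<le> 2 * I + 1" .
    qed auto
  qed
qed

text \<open>
  For $P < Q$ a convolution alone cannot be bounded, but a weight provides the missing integrability:
  $w \phi F^P G^{1-Q} = (\phi F)^P (\phi G)^{1-Q} (\phi w^{1/(Q-P)})^{Q-P}$.
\<close>

lemma bilinear_bounded_weighted_convolution:
  fixes \<phi> w :: "real \<Rightarrow> real"
  assumes [measurable]: "\<phi> \<in> borel_measurable borel" "w \<in> borel_measurable borel" 
    and \<phi>: "\<And>u. \<phi> u \<ge> 0" and w: "\<And>x. w x \<ge> 0"
    and PQ: "0 \<le> P" "P < Q" "Q \<le> 1"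
    and int: "(\<integral>\<^sup>+u. ennreal (\<phi> u) \<partial>lborel_pos) < \<infinity>"
      "(\<integral>\<^sup>+x. ennreal (w x powr (1 / (Q - P))) \<partial>lborel_pos) < \<infinity>"
  shows "bilinear_bounded (\<lambda>x y. ennreal (w x * \<phi> \<bar>x - y\<bar>)) P Q"
proof -
  define I where "I = (\<integral>\<^sup>+u. ennreal (\<phi> u) \<partial>lborel_pos)"
  define W where "W = (\<integral>\<^sup>+x. ennreal (w x powr (1 / (Q - P))) \<partial>lborel_pos)"
  show ?thesis
  proof (rule bilinear_boundedI[where B = "2 * I * (W + 1)"])
    show "2 * I * (W + 1) < \<infinity>" using int by (simp add: I_def W_def ennreal_mult_less_top)
    fix F G assume F: "subdensity F" and G: "subdensity G"
    have [measurable]: "F \<in> borel_measurable borel" "G \<in> borel_measurable borel"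
      using F G by (auto simp: subdensity_def)
    have nonneg: "F y \<ge> 0" "G y \<ge> 0" for y using F G by (auto simp: subdensity_def)
    define \<psi> where "\<psi> x y = ennreal (\<phi> \<bar>x - y\<bar>)" for x y
    have \<psi>1: "(\<integral>\<^sup>+x. \<psi> x y \<partial>lborel_pos) \<le> 2 * I" for y
      unfolding \<psi>_def I_def by (rule nn_integral_abs_diff_le[of "\<lambda>u. ennreal (\<phi> u)"]) measurable
    have IW: "2 * I \<le> 2 * I * (W + 1)" by (simp add: distrib_left)
    have \<psi>2: "(\<integral>\<^sup>+y. \<psi> x y \<partial>lborel_pos) \<le> 2 * I" for x
      using \<psi>1[of x] by (simp add: \<psi>_def abs_minus_commute)
    show "\<exists>M1 M2 N. bilinear_majorant (\<lambda>x y. ennreal (w x * \<phi> \<bar>x - y\<bar>)) P Q (2 * I * (W + 1)) F G M1 M2 N"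
    proof (intro exI, unfold bilinear_majorant_def, intro conjI allI impI)
      show "case_prod \<psi> \<in> borel_measurable (borel \<Otimes>\<^sub>M borel)" unfolding \<psi>_def by measurable
      show "case_prod \<psi> \<in> borel_measurable (borel \<Otimes>\<^sub>M borel)" unfolding \<psi>_def by measurable
      show "case_prod (\<lambda>x y. \<psi> x y * ennreal (w x powr (1 / (Q - P)))) \<in> borel_measurable (borel \<Otimes>\<^sub>M borel)" unfolding \<psi>_def by measurable
      show "(\<integral>\<^sup>+x. \<psi> x y \<partial>lborel_pos) \<le> 2 * I * (W + 1)" for y by (rule order_trans[OF \<psi>1 IW])
      show "(\<integral>\<^sup>+y. \<psi> x y \<partial>lborel_pos) \<le> 2 * I * (W + 1)" for x by (rule order_trans[OF \<psi>2 IW])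
      have "(\<integral>\<^sup>+x. \<integral>\<^sup>+y. \<psi> x y * ennreal (w x powr (1 / (Q - P))) \<partial>lborel_pos \<partial>lborel_pos)
         = (\<integral>\<^sup>+x. (\<integral>\<^sup>+y. \<psi> x y \<partial>lborel_pos) * ennreal (w x powr (1 / (Q - P))) \<partial>lborel_pos)"
        unfolding \<psi>_def by (intro nn_integral_cong nn_integral_multc borel_imp_lborel_pos) measurable
      also have "\<dots> \<le> (\<integral>\<^sup>+x. 2 * I * ennreal (w x powr (1 / (Q - P))) \<partial>lborel_pos)"
        by (intro nn_integral_mono mult_right_mono \<psi>2) auto
      also have "\<dots> = 2 * I * W" unfolding W_def by (intro nn_integral_cmult borel_imp_lborel_pos) measurable
      also have "\<dots> \<le> 2 * I * (W + 1)" by (intro mult_left_mono) auto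
      finally show "(\<integral>\<^sup>+x. \<integral>\<^sup>+y. \<psi> x y * ennreal (w x powr (1 / (Q - P))) \<partial>lborel_pos \<partial>lborel_pos) \<le> 2 * I * (W + 1)" .
      fix x y :: real
      define t where "t = \<phi> \<bar>x - y\<bar>"
      have t: "t \<ge> 0" using \<phi> by (simp add: t_def)
      define W' where "W' = w x powr (1 / (Q - P))"
      have W': "W' \<ge> 0" "W' powr (Q - P) = w x" using PQ w by (auto simp: W'_def powr_powr)
      have "w x * t * (F y powr P * G x powr (1 - Q)) = (t * F y) powr P * (t * G x) powr (1 - Q) * (t * W') powr (Q - P)"
      proof -
        have "t = t powr (P + (1 - Q) + (Q - P))" using t by simp
        also have "\<dots> = t powr P * t powr (1 - Q) * t powr (Q - P)" by (simp only: powr_add)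
        finally have 1: "t = t powr P * t powr (1 - Q) * t powr (Q - P)" .
        have "w x * t * (F y powr P * G x powr (1 - Q)) = w x * (t powr P * t powr (1 - Q) * t powr (Q - P)) * (F y powr P * G x powr (1 - Q))"
          using 1 by simp
        then show ?thesis unfolding powr_mult W' by (simp add: mult_ac)
      qed
      also have "\<dots> \<le> t * F y + t * G x + t * W'"
        using PQ nonneg t W' by (intro weighted_product_le_sum) auto
      finally have "ennreal (w x * t * (F y powr P * G x powr (1 - Q))) \<le> ennreal (t * F y + t * G x + t * W')"
        by (rule ennreal_leI)
      then show "ennreal (w x * \<phi> \<bar>x - y\<bar>) * ennreal (F y powr P * G x powr (1 - Q)) \<le> \<psi> x y * ennreal (F y) + \<psi> x y * ennreal (G x) + \<psi> x y * ennreal (w x powr (1 / (Q - P)))"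
        using nonneg t w W' by (simp add: t_def[symmetric] W'_def[symmetric] \<psi>_def ennreal_mult[symmetric] ennreal_plus[symmetric] del: ennreal_plus)
    qed
  qed
qed

section \<open>The Hardy--Littlewood--Sobolev inequality\<close>

text \<open>
  Up to the distance $1/a$ the bound $g \le a$ suffices. Beyond it, $g^R$ is paired with a power of
  the kernel that is integrable at infinity. Both cases have the scaling $a\,\Phi(au)$, so the
  integral over \<open>u\<close> does not depend on \<open>a\<close>.
\<close>

lemma riesz_kernel_pointwise:
  fixes a g u s R :: real
  assumes "a > 0" "0 \<le> g" "g \<le> a" "u > 0" and R: "0 \<le> R" "R < 1" and b: "b * (1 - R) = 1 - s"
  shows "a powr (s - R) * u powr (s - 1) * g powr R \<le> a * power_profile (1 - s) b (a * u) + g"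
proof (cases "a * u \<le> 1")
  case True
  have "a powr (s - R) * u powr (s - 1) * g powr R \<le> a powr (s - R) * u powr (s - 1) * a powr R"
    using assms by (intro mult_left_mono powr_mono2) auto
  also have "\<dots> = a powr (1 + (s - 1)) * u powr (s - 1)"
    by (simp add: mult_ac flip: powr_add)
  also have "\<dots> = a * (a powr (s - 1) * u powr (s - 1))"
    unfolding powr_add using assms(1) by simp
  also have "\<dots> = a * power_profile (1 - s) b (a * u)"
    using True assms by (simp add: power_profile_def powr_mult)
  finally show ?thesis using assms by simp
next
  case False
  define X where "X = a * power_profile (1 - s) b (a * u)"
  have X: "X = a * (a * u) powr (- b)" using False by (simp add: X_def power_profile_def)
  have "X powr (1 - R) = a powr (1 - R) * (a * u) powr (s - 1)"
  proof -
    have "- b * (1 - R) = s - 1" using b by simp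
    then show ?thesis unfolding X powr_mult[of a "(a * u) powr (- b)"] powr_powr by simp
  qed
  also have "\<dots> = a powr (s - R) * u powr (s - 1)"
    unfolding powr_mult by (simp add: mult.assoc[symmetric] flip: powr_add)
  finally have eq: "X powr (1 - R) = a powr (s - R) * u powr (s - 1)" .
  have "X powr (1 - R) * g powr R \<le> X + g"
  proof -
    have X0: "X \<ge> 0" using assms by (simp add: X)
    have "X powr (1 - R) * g powr R \<le> max X g powr (1 - R) * max X g powr R"
      using assms X0 by (intro mult_mono powr_mono2) auto
    also have "\<dots> = max X g" using assms X0 by (simp flip: powr_add)
    finally show ?thesis using X0 assms by simp
  qed
  then have "a powr (s - R) * u powr (s - 1) * g powr R \<le> X + g" by (simp only: eq)
  then show ?thesis unfolding X_def .
qed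

text \<open>
  On the set where $G(x) \le F(y)$ fix \<open>y\<close> and put $a = F(y)$. The integral over \<open>x\<close> of
  $|x-y|^{s-1} G(x)^{1-Q}$ is at most a constant times $a^{1-P}$ by the pointwise bound with
  $R = 1-Q$, so that a multiple of $a^P a^{1-P} = F(y)$ remains. On the complement the roles of
  \<open>F\<close> and \<open>G\<close> are exchanged, and $R = P$. The hypotheses $0 < Q$ and $P < 1$ are what makes the
  profiles integrable at infinity.
\<close>

lemma bilinear_bounded_riesz:
  assumes s: "s = P - Q" "0 < s" and PQ: "0 < Q" "P < 1"
  shows "bilinear_bounded (\<lambda>x y. ennreal (\<bar>x - y\<bar> powr (s - 1))) P Q"
proof -
  define b1 where "b1 = (1 - s) / Q"
  define b2 where "b2 = (1 - s) / (1 - P)"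
  have b: "b1 > 1" "b2 > 1" "1 - s < 1" using s PQ by (auto simp: b1_def b2_def field_simps)
  have be: "b1 * (1 - (1 - Q)) = 1 - s" "b2 * (1 - P) = 1 - s" using PQ by (auto simp: b1_def b2_def)
  define I1 where "I1 = (\<integral>\<^sup>+u. ennreal (power_profile (1 - s) b1 u) \<partial>lborel_pos)"
  define I2 where "I2 = (\<integral>\<^sup>+u. ennreal (power_profile (1 - s) b2 u) \<partial>lborel_pos)"
  have I: "I1 < \<infinity>" "I2 < \<infinity>" unfolding I1_def I2_def by (intro nn_integral_power_profile_finite b)+
  show ?thesis
  proof (rule bilinear_boundedI[where B = "2 * I1 + 2 * I2 + 1"])
    show "2 * I1 + 2 * I2 + 1 < \<infinity>" using I by (simp add: ennreal_mult_less_top)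
    fix F G assume F: "subdensity F" and G: "subdensity G"
    have [measurable]: "F \<in> borel_measurable borel" "G \<in> borel_measurable borel"
      using F G by (auto simp: subdensity_def)
    have nonneg: "F y \<ge> 0" "G y \<ge> 0" for y using F G by (auto simp: subdensity_def)
    define M1 where "M1 x y = (if 0 < F y \<and> G x \<le> F y \<and> x \<noteq> y then ennreal (F y powr (P - 1) * \<bar>x - y\<bar> powr (s - 1) * G x powr (1 - Q)) else 0)" for x y
    define M2 where "M2 x y = (if F y < G x \<and> x \<noteq> y then ennreal (G x powr (- Q) * \<bar>x - y\<bar> powr (s - 1) * F y powr P) else 0)" for x y
    show "\<exists>M1 M2 N. bilinear_majorant (\<lambda>x y. ennreal (\<bar>x - y\<bar> powr (s - 1))) P Q (2 * I1 + 2 * I2 + 1) F G M1 M2 N"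
    proof (intro exI, unfold bilinear_majorant_def, intro conjI allI impI)
      show "case_prod M1 \<in> borel_measurable (borel \<Otimes>\<^sub>M borel)" unfolding M1_def by measurable
      show "case_prod M2 \<in> borel_measurable (borel \<Otimes>\<^sub>M borel)" unfolding M2_def by measurable
      show "case_prod (\<lambda>x y::real. 0 :: ennreal) \<in> borel_measurable (borel \<Otimes>\<^sub>M borel)" by measurable
      show "ennreal (\<bar>x - y\<bar> powr (s - 1)) * ennreal (F y powr P * G x powr (1 - Q)) \<le> M1 x y * ennreal (F y) + M2 x y * ennreal (G x) + 0"
        if "x \<noteq> y" for x y
      proof (cases "F y < G x")
        case True
        have "G x powr (1 - Q) = G x * G x powr (- Q)" using nonneg[of x] True nonneg(1)[of y] by (simp add: powr_diff powr_minus divide_inverse)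
        then have "ennreal (\<bar>x - y\<bar> powr (s - 1)) * ennreal (F y powr P * G x powr (1 - Q)) = M2 x y * ennreal (G x)"
          using True that nonneg by (simp add: M2_def mult_ac flip: ennreal_mult)
        then show ?thesis by simp
      next
        case False
        show ?thesis
        proof (cases "F y = 0")
          case True
          then have "F y powr P = 0" by simp
          then show ?thesis by simp
        next
          case Fn: False
          have "F y powr P = F y * F y powr (P - 1)" using nonneg[of y] Fn by (simp add: powr_diff)
          then have "ennreal (\<bar>x - y\<bar> powr (s - 1)) * ennreal (F y powr P * G x powr (1 - Q)) = M1 x y * ennreal (F y)"
            using False Fn that nonneg[of y] nonneg[of x] by (simp add: M1_def mult_ac flip: ennreal_mult)
          then show ?thesis by simp
        qed
      qed
      show "(\<integral>\<^sup>+x. M1 x y \<partial>lborel_pos) \<le> 2 * I1 + 2 * I2 + 1" for y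
      proof (cases "F y > 0")
        case True
        define a where "a = F y"
        have a: "a > 0" using True by (simp add: a_def)
        have "(\<integral>\<^sup>+x. M1 x y \<partial>lborel_pos) \<le> (\<integral>\<^sup>+x. ennreal a * ennreal (power_profile (1 - s) b1 (a * \<bar>x - y\<bar>)) + ennreal (G x) \<partial>lborel_pos)"
        proof (rule nn_integral_mono)
          fix x
          show "M1 x y \<le> ennreal a * ennreal (power_profile (1 - s) b1 (a * \<bar>x - y\<bar>)) + ennreal (G x)"
          proof (cases "G x \<le> F y \<and> x \<noteq> y")
            case xy: True
            have e: "P - 1 = s - (1 - Q)" using s by simp
            have "F y powr (P - 1) * \<bar>x - y\<bar> powr (s - 1) * G x powr (1 - Q) \<le> a * power_profile (1 - s) b1 (a * \<bar>x - y\<bar>) + G x"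
              unfolding e a_def using xy True nonneg[of x] s PQ be by (intro riesz_kernel_pointwise) auto
            then have "ennreal (F y powr (P - 1) * \<bar>x - y\<bar> powr (s - 1) * G x powr (1 - Q)) \<le> ennreal (a * power_profile (1 - s) b1 (a * \<bar>x - y\<bar>) + G x)"
              by (rule ennreal_leI)
            then show ?thesis using xy True a nonneg[of x] by (simp add: M1_def ennreal_mult)
          qed (auto simp: M1_def)
        qed
        also have "\<dots> = (\<integral>\<^sup>+x. ennreal a * ennreal (power_profile (1 - s) b1 (a * \<bar>x - y\<bar>)) \<partial>lborel_pos) + (\<integral>\<^sup>+x. ennreal (G x) \<partial>lborel_pos)"
          by (intro nn_integral_add borel_imp_lborel_pos) measurable
        also have "\<dots> \<le> 2 * I1 + 1" unfolding I1_def
          by (intro add_mono nn_integral_subdensity_le G nn_integral_abs_scaled_le[of "\<lambda>u. ennreal (power_profile (1 - s) b1 u)"] a) measurable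
        also have "\<dots> \<le> 2 * I1 + 2 * I2 + 1" by (intro add_mono) auto
        finally show ?thesis .
      qed (auto simp: M1_def)
      show "(\<integral>\<^sup>+y. M2 x y \<partial>lborel_pos) \<le> 2 * I1 + 2 * I2 + 1" for x
      proof (cases "G x > 0")
        case True
        define a where "a = G x"
        have a: "a > 0" using True by (simp add: a_def)
        have "(\<integral>\<^sup>+y. M2 x y \<partial>lborel_pos) \<le> (\<integral>\<^sup>+y. ennreal a * ennreal (power_profile (1 - s) b2 (a * \<bar>y - x\<bar>)) + ennreal (F y) \<partial>lborel_pos)"
        proof (rule nn_integral_mono)
          fix y
          show "M2 x y \<le> ennreal a * ennreal (power_profile (1 - s) b2 (a * \<bar>y - x\<bar>)) + ennreal (F y)"
          proof (cases "F y < G x \<and> x \<noteq> y")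
            case xy: True
            have e: "- Q = s - P" using s by simp
            have "G x powr (- Q) * \<bar>y - x\<bar> powr (s - 1) * F y powr P \<le> a * power_profile (1 - s) b2 (a * \<bar>y - x\<bar>) + F y"
              unfolding e a_def using xy True nonneg[of y] s PQ be by (intro riesz_kernel_pointwise) auto
            then have "ennreal (G x powr (- Q) * \<bar>x - y\<bar> powr (s - 1) * F y powr P) \<le> ennreal (a * power_profile (1 - s) b2 (a * \<bar>y - x\<bar>) + F y)"
              by (simp only: abs_minus_commute ennreal_leI)
            then show ?thesis using xy True a nonneg[of y] by (simp add: M2_def ennreal_mult)
          qed (auto simp: M2_def)
        qed
        also have "\<dots> = (\<integral>\<^sup>+y. ennreal a * ennreal (power_profile (1 - s) b2 (a * \<bar>y - x\<bar>)) \<partial>lborel_pos) + (\<integral>\<^sup>+y. ennreal (F y) \<partial>lborel_pos)"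
          by (intro nn_integral_add borel_imp_lborel_pos) measurable
        also have "\<dots> \<le> 2 * I2 + 1" unfolding I2_def
          by (intro add_mono nn_integral_subdensity_le F nn_integral_abs_scaled_le[of "\<lambda>u. ennreal (power_profile (1 - s) b2 u)"] a) measurable
        also have "\<dots> \<le> 2 * I1 + 2 * I2 + 1" by (intro add_mono) auto
        finally show ?thesis .
      next
        case False
        then have "M2 x y = 0" for y using nonneg(1)[of y] by (auto simp: M2_def)
        then show ?thesis by simp
      qed
    qed auto
  qed
qed

section \<open>Homogeneous kernels singular on the axes\<close>

text \<open>
  The left-hand side is homogeneous of degree $-1$, hence $1/y$ times a function of $x/y$.
\<close>

lemma homogeneous_kernel_le_profile:
  fixes g e x y :: real
  assumes "x > 0" "y > 0" "g \<le> 1/2"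
  shows "x powr (- g - e) * y powr (e - g) * (x + y) powr (2 * g - 1) \<le> 1 / y * power_profile (g + e) (1 + e - g) (1 / y * x)"
proof -
  define v where "v = x / y"
  have v: "v > 0" "x = y * v" using assms by (auto simp: v_def)
  have sum: "x + y = y * (1 + v)" using v by (simp add: algebra_simps)
  have "x powr (- g - e) * y powr (e - g) * (x + y) powr (2 * g - 1)
     = (y powr (- g - e) * y powr (e - g) * y powr (2 * g - 1)) * (v powr (- g - e) * (1 + v) powr (2 * g - 1))"
  proof -
    have "x powr (- g - e) = y powr (- g - e) * v powr (- g - e)"
      by (simp only: v(2) powr_mult)
    moreover have "(x + y) powr (2 * g - 1) = y powr (2 * g - 1) * (1 + v) powr (2 * g - 1)"
      by (simp only: sum powr_mult)
    ultimately show ?thesis by simp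
  qed
  also have "y powr (- g - e) * y powr (e - g) * y powr (2 * g - 1) = y powr ((- g - e) + (e - g) + (2 * g - 1))"
    by (simp only: powr_add)
  also have "\<dots> = 1 / y" using assms by (simp add: powr_minus_divide)
  also have "v powr (- g - e) * (1 + v) powr (2 * g - 1) \<le> power_profile (g + e) (1 + e - g) v"
  proof (cases "v \<le> 1")
    case True
    have "(1 + v) powr (2 * g - 1) \<le> 1 powr (2 * g - 1)" using v assms by (intro powr_mono2') auto
    then have "v powr (- g - e) * (1 + v) powr (2 * g - 1) \<le> v powr (- g - e) * 1" by (intro mult_left_mono) auto
    then show ?thesis using True by (simp add: power_profile_def)
  next
    case False
    have "(1 + v) powr (2 * g - 1) \<le> v powr (2 * g - 1)" using v assms by (intro powr_mono2') auto
    then have "v powr (- g - e) * (1 + v) powr (2 * g - 1) \<le> v powr (- g - e) * v powr (2 * g - 1)" by (intro mult_left_mono) auto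
    also have "\<dots> = v powr (- (1 + e - g))" unfolding powr_add[symmetric] by (rule arg_cong[of _ _ "\<lambda>t. v powr t"]) simp
    finally show ?thesis using False by (simp add: power_profile_def)
  qed
  finally show ?thesis using assms by (simp add: v_def divide_right_mono)
qed

lemma nn_integral_homogeneous_kernel_le:
  assumes "y > 0" "g \<le> 1/2"
  shows "(\<integral>\<^sup>+x. ennreal (x powr (- g - e) * y powr (e - g) * (x + y) powr (2 * g - 1)) \<partial>lborel_pos)
     \<le> 2 * (\<integral>\<^sup>+u. ennreal (power_profile (g + e) (1 + e - g) u) \<partial>lborel_pos)"
proof -
  have "(\<integral>\<^sup>+x. ennreal (x powr (- g - e) * y powr (e - g) * (x + y) powr (2 * g - 1)) \<partial>lborel_pos)
    \<le> (\<integral>\<^sup>+x. ennreal (1 / y) * ennreal (power_profile (g + e) (1 + e - g) (1 / y * \<bar>x - 0\<bar>)) \<partial>lborel_pos)"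
    using assms homogeneous_kernel_le_profile[of _ y g e]
    by (intro nn_integral_mono) (auto simp: ennreal_mult[symmetric] simp del: times_divide_eq_left intro!: ennreal_leI)
  also have "\<dots> \<le> 2 * (\<integral>\<^sup>+u. ennreal (power_profile (g + e) (1 + e - g) u) \<partial>lborel_pos)"
    using assms by (intro nn_integral_abs_scaled_le[of "\<lambda>u. ennreal (power_profile (g + e) (1 + e - g) u)"]) auto
  finally show ?thesis .
qed

text \<open>
  This is Schur's test with power weights. For $r = 1/(1-s)$ the \<open>r\<close>-th power of the kernel is
  homogeneous of degree $-1$, namely $(xy)^{-g}(x+y)^{2g-1}$ with $g = \gamma r$. As in Young's
  inequality the integrand is the product of
  $(S_1 F)^Q$, $(FG)^s$ and $(S_2 G)^{1-P}$, but now the factors $S_1$ and $S_2$ carry weights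
  $(y/x)^{e_1}$ and $(x/y)^{e_2}$ which cancel in the product if $e_1 Q = e_2 (1-P)$. Their integrals
  converge for $g < e_i < 1-g$.
\<close>

lemma bilinear_bounded_homogeneous:
  assumes s: "s = P - Q" "0 < s" and \<gamma>: "0 < \<gamma>" "\<gamma> < Q" "P < 1 - \<gamma>"
  shows "bilinear_bounded (\<lambda>x y. ennreal ((x * y) powr (- \<gamma>) * (x + y) powr (s + 2 * \<gamma> - 1))) P Q"
proof -
  define P' where "P' = 1 - P"
  have P': "P' > \<gamma>" "1 - s = P' + Q" using \<gamma> s by (auto simp: P'_def)
  define g where "g = \<gamma> / (P' + Q)"
  have g: "g > 0" "g < 1/2" "g * (P' + Q) = \<gamma>" using P' \<gamma> by (auto simp: g_def field_simps)
  \<comment> \<open>The admissible range for the common value \<open>b\<close> of \<open>e1 * Q\<close> and \<open>e2 * P'\<close> is nonempty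
    since \<open>g * max P' Q + g * min P' Q = \<gamma> < min P' Q\<close>.\<close>
  obtain b where b: "g * max P' Q < b" "b < (1 - g) * min P' Q"
  proof -
    have "g * max P' Q < (1 - g) * min P' Q"
    proof -
      have "g * max P' Q + g * min P' Q = \<gamma>" using g(3) by (cases "P' \<le> Q") (auto simp: algebra_simps max_def min_def)
      moreover have "\<gamma> < min P' Q" using P' \<gamma> by auto
      ultimately show ?thesis unfolding left_diff_distrib by linarith
    qed
    then show ?thesis using dense that by blast
  qed
  define e1 where "e1 = b / Q"
  define e2 where "e2 = b / P'"
  have "g * Q \<le> g * max P' Q" "g * P' \<le> g * max P' Q" "(1 - g) * min P' Q \<le> (1 - g) * Q" "(1 - g) * min P' Q \<le> (1 - g) * P'"
    using g by (auto intro!: mult_left_mono)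
  then have "g * Q < b" "g * P' < b" "b < (1 - g) * Q" "b < (1 - g) * P'" using b by auto
  then have e: "g < e1" "e1 < 1 - g" "g < e2" "e2 < 1 - g"
    using P' \<gamma> by (auto simp: e1_def e2_def field_simps)
  have eb: "e1 * Q = b" "e2 * P' = b" using P' \<gamma> by (auto simp: e1_def e2_def)
  define I where "I e = (\<integral>\<^sup>+u. ennreal (power_profile (g + e) (1 + e - g) u) \<partial>lborel_pos)" for e
  have I: "I e1 < \<infinity>" "I e2 < \<infinity>" unfolding I_def using e by (intro nn_integral_power_profile_finite; simp)+
  define S where "S e x y = x powr (- g - e) * y powr (e - g) * (x + y) powr (2 * g - 1)" for e x y :: real
  have Sm [measurable]: "case_prod (S e) \<in> borel_measurable (borel \<Otimes>\<^sub>M borel)" for e unfolding S_def by measurable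
  have S0: "S e x y \<ge> 0" for e x y by (simp add: S_def)
  have SI: "(\<integral>\<^sup>+x. ennreal (S e x y) \<partial>lborel_pos) \<le> 2 * I e" if "y > 0" for e y
    unfolding S_def I_def using that g by (intro nn_integral_homogeneous_kernel_le) auto
  show ?thesis
  proof (rule bilinear_boundedI[where B = "2 * I e1 + 2 * I e2 + 1"])
    show "2 * I e1 + 2 * I e2 + 1 < \<infinity>" using I by (simp add: ennreal_mult_less_top)
    fix F G assume F: "subdensity F" and G: "subdensity G"
    have [measurable]: "F \<in> borel_measurable borel" "G \<in> borel_measurable borel"
      using F G by (auto simp: subdensity_def)
    have nonneg: "F y \<ge> 0" "G y \<ge> 0" for y using F G by (auto simp: subdensity_def)
    show "\<exists>M1 M2 N. bilinear_majorant (\<lambda>x y. ennreal ((x * y) powr (- \<gamma>) * (x + y) powr (s + 2 * \<gamma> - 1))) P Q (2 * I e1 + 2 * I e2 + 1) F G M1 M2 N"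
    proof (intro exI, unfold bilinear_majorant_def, intro conjI allI impI)
      show "case_prod (\<lambda>x y. ennreal (S e1 x y) + ennreal (G x)) \<in> borel_measurable (borel \<Otimes>\<^sub>M borel)" by measurable
      show "case_prod (\<lambda>x y. ennreal (S e2 y x)) \<in> borel_measurable (borel \<Otimes>\<^sub>M borel)" unfolding S_def by measurable
      show "case_prod (\<lambda>x y::real. 0 :: ennreal) \<in> borel_measurable (borel \<Otimes>\<^sub>M borel)" by measurable
      show "(\<integral>\<^sup>+y. ennreal (S e2 y x) \<partial>lborel_pos) \<le> 2 * I e1 + 2 * I e2 + 1" if "x > 0" for x
        using SI[OF that, of e2] by (rule order_trans) (simp add: add_increasing add_increasing2)
      show "(\<integral>\<^sup>+x. ennreal (S e1 x y) + ennreal (G x) \<partial>lborel_pos) \<le> 2 * I e1 + 2 * I e2 + 1" if "y > 0" for y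
      proof -
        have [measurable]: "(\<lambda>x. S e1 x y) \<in> borel_measurable borel" unfolding S_def by measurable
        have "(\<integral>\<^sup>+x. ennreal (S e1 x y) + ennreal (G x) \<partial>lborel_pos) = (\<integral>\<^sup>+x. ennreal (S e1 x y) \<partial>lborel_pos) + (\<integral>\<^sup>+x. ennreal (G x) \<partial>lborel_pos)"
          by (intro nn_integral_add borel_imp_lborel_pos) measurable
        also have "\<dots> \<le> 2 * I e1 + 1" by (intro add_mono SI that nn_integral_subdensity_le G)
        also have "\<dots> \<le> 2 * I e1 + 2 * I e2 + 1" by (intro add_mono) auto
        finally show ?thesis .
      qed
      fix x y :: real assume xy: "x > 0" "y > 0"
      have "(x * y) powr (- \<gamma>) * (x + y) powr (s + 2 * \<gamma> - 1) * (F y powr P * G x powr (1 - Q))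
        = (S e1 x y * F y) powr Q * (F y * G x) powr (P - Q) * (S e2 y x * G x) powr (1 - P)"
      proof -
        have x: "x powr (- \<gamma>) = x powr ((- g - e1) * Q) * x powr ((e2 - g) * P')"
        proof -
          have "- \<gamma> = (- g - e1) * Q + (e2 - g) * P'" using g(3) eb by (simp add: algebra_simps)
          then show ?thesis by (simp add: powr_add)
        qed
        have y: "y powr (- \<gamma>) = y powr ((e1 - g) * Q) * y powr ((- g - e2) * P')"
        proof -
          have "- \<gamma> = (e1 - g) * Q + (- g - e2) * P'" using g(3) eb by (simp add: algebra_simps)
          then show ?thesis by (simp add: powr_add)
        qed
        have xy: "(x + y) powr (s + 2 * \<gamma> - 1) = (x + y) powr ((2 * g - 1) * Q) * (x + y) powr ((2 * g - 1) * P')"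
        proof -
          have "s + 2 * \<gamma> - 1 = (2 * g - 1) * Q + (2 * g - 1) * P'" using g(3) P'(2) by (simp add: algebra_simps)
          then show ?thesis by (simp add: powr_add)
        qed
        have 2: "F y powr P = F y powr Q * F y powr (P - Q)" by (simp flip: powr_add)
        have 3: "G x powr (1 - Q) = G x powr (P - Q) * G x powr (1 - P)" by (simp flip: powr_add)
        show ?thesis unfolding S_def powr_mult powr_powr x y xy 2 3 P'_def[symmetric] by (simp add: mult_ac add.commute)
      qed
      also have "\<dots> \<le> S e1 x y * F y + F y * G x + S e2 y x * G x"
        using s \<gamma> nonneg S0 by (intro weighted_product_le_sum) auto
      finally have "ennreal ((x * y) powr (- \<gamma>) * (x + y) powr (s + 2 * \<gamma> - 1) * (F y powr P * G x powr (1 - Q))) \<le> ennreal (S e1 x y * F y + F y * G x + S e2 y x * G x)"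
        by (rule ennreal_leI)
      then show "ennreal ((x * y) powr (- \<gamma>) * (x + y) powr (s + 2 * \<gamma> - 1)) * ennreal (F y powr P * G x powr (1 - Q)) \<le> (ennreal (S e1 x y) + ennreal (G x)) * ennreal (F y) + ennreal (S e2 y x) * ennreal (G x) + 0"
        using nonneg S0 by (simp add: ennreal_mult distrib_right distrib_left mult_ac)
    qed auto
  qed
qed

text \<open>
  For a kernel that decays at infinity the exponents may be moved to the favourable side, as on a
  set of finite measure: with $w = (1+x)^{-2}$ one has
  $F^P w \le 2 F_1^{P_1}$ for the subdensity $F_1 = (F+w)/2$ and $P \le P_1 \le 1$.
\<close>

lemma bilinear_bounded_localized:
  assumes bb: "bilinear_bounded k P1 Q1" and k [measurable]: "case_prod k \<in> borel_measurable (borel \<Otimes>\<^sub>M borel)"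
    and PQ: "0 \<le> P" "P \<le> P1" "P1 \<le> 1" "0 \<le> Q1" "Q1 \<le> Q" "Q \<le> 1"
  shows "bilinear_bounded (\<lambda>x y. k x y * ennreal (1 / (1 + \<bar>x\<bar>)\<^sup>2 * (1 / (1 + \<bar>y\<bar>)\<^sup>2))) P Q"
proof -
  obtain B where B: "bilinear_bound k P1 Q1 B" using bb by (auto simp: bilinear_bounded_def)
  define w where "w x = 1 / (1 + \<bar>x\<bar>)\<^sup>2" for x :: real
  have w: "0 < w x" "w x \<le> 1" for x by (auto simp: w_def power2_eq_square intro!: mult_pos_pos add_pos_nonneg) (simp add: field_simps)
  have lift: "F x powr A * w x \<le> 2 * ((F x + w x) / 2) powr A1" if "0 \<le> F x" "0 \<le> A" "A \<le> A1" "A1 \<le> 1" for F x A A1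
  proof -
    have "w x = w x powr 1" using w[of x] by simp
    also have "\<dots> \<le> w x powr (A1 - A)" using w[of x] that by (intro powr_mono') auto
    finally have "F x powr A * w x \<le> F x powr A * w x powr (A1 - A)" by (intro mult_left_mono) auto
    also have "\<dots> \<le> (F x + w x) powr A * (F x + w x) powr (A1 - A)"
      using that w[of x] by (intro mult_mono powr_mono2) auto
    also have "\<dots> = (F x + w x) powr A1" by (simp flip: powr_add)
    also have "\<dots> = (2 * ((F x + w x) / 2)) powr A1" by (rule arg_cong[of _ _ "\<lambda>t. t powr A1"]) (simp add: field_simps)
    also have "\<dots> = 2 powr A1 * ((F x + w x) / 2) powr A1" by (rule powr_mult)
    also have "\<dots> \<le> 2 powr 1 * ((F x + w x) / 2) powr A1" using that by (intro mult_right_mono powr_mono) auto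
    finally show ?thesis by simp
  qed
  have dens: "subdensity (\<lambda>x. (F x + w x) / 2)" if F: "subdensity F" for F
  proof -
    have [measurable]: "F \<in> borel_measurable borel" and F0: "\<And>x. 0 \<le> F x"
      using F by (auto simp: subdensity_def)
    have [measurable]: "w \<in> borel_measurable borel" unfolding w_def by measurable
    have "(\<integral>\<^sup>+x. ennreal ((F x + w x) / 2) \<partial>lborel_pos) = (\<integral>\<^sup>+x. (ennreal (F x) + ennreal (w x)) * ennreal (1 / 2) \<partial>lborel_pos)"
    proof (rule nn_integral_cong)
      fix x
      have "(ennreal (F x) + ennreal (w x)) * ennreal (1 / 2) = ennreal (F x + w x) * ennreal (1 / 2)"
        using F0[of x] w[of x] by (simp add: ennreal_plus)
      also have "\<dots> = ennreal ((F x + w x) * (1 / 2))"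
        using F0[of x] w[of x] by (intro ennreal_mult[symmetric]) auto
      finally show "ennreal ((F x + w x) / 2) = (ennreal (F x) + ennreal (w x)) * ennreal (1 / 2)" by simp
    qed
    also have "\<dots> = (\<integral>\<^sup>+x. (ennreal (F x) + ennreal (w x)) \<partial>lborel_pos) * ennreal (1/2)"
      by (intro nn_integral_multc borel_imp_lborel_pos) measurable
    also have "(\<integral>\<^sup>+x. (ennreal (F x) + ennreal (w x)) \<partial>lborel_pos) = (\<integral>\<^sup>+x. ennreal (F x) \<partial>lborel_pos) + (\<integral>\<^sup>+x. ennreal (w x) \<partial>lborel_pos)"
      by (intro nn_integral_add borel_imp_lborel_pos) measurable
    also have "((\<integral>\<^sup>+x. ennreal (F x) \<partial>lborel_pos) + (\<integral>\<^sup>+x. ennreal (w x) \<partial>lborel_pos)) * ennreal (1/2) \<le> (1 + 1) * ennreal (1/2)" unfolding w_def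
      by (intro mult_right_mono add_mono nn_integral_subdensity_le F subdensity_inverse_square) auto
    also have "(1 + 1) * ennreal (1/2) = 1"
    proof -
      have "(1 + 1 :: ennreal) = ennreal 2" by simp
      then show ?thesis by (simp only: ennreal_mult'[symmetric]) simp
    qed
    finally show ?thesis using F0 w unfolding subdensity_def by (auto simp: less_imp_le intro: add_nonneg_nonneg)
  qed
  have "bilinear_bound (\<lambda>x y. k x y * ennreal (w x * w y)) P Q (4 * max 0 B)"
    unfolding bilinear_bound_def
  proof (intro allI impI)
    fix F G assume F: "subdensity F" and G: "subdensity G"
    define F1 where "F1 x = (F x + w x) / 2" for x
    define G1 where "G1 x = (G x + w x) / 2" for x
    have FG: "subdensity F1" "subdensity G1" using dens[OF F] dens[OF G] unfolding F1_def[abs_def] G1_def[abs_def] by auto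
    have [measurable]: "F1 \<in> borel_measurable borel" "G1 \<in> borel_measurable borel"
      using FG by (auto simp: subdensity_def)
    have nonneg: "F y \<ge> 0" "G y \<ge> 0" for y using F G by (auto simp: subdensity_def)
    have "(\<integral>\<^sup>+x. \<integral>\<^sup>+y. k x y * ennreal (w x * w y) * ennreal (F y powr P * G x powr (1 - Q)) \<partial>lborel_pos \<partial>lborel_pos)
       \<le> (\<integral>\<^sup>+x. \<integral>\<^sup>+y. 4 * (k x y * ennreal (F1 y powr P1 * G1 x powr (1 - Q1))) \<partial>lborel_pos \<partial>lborel_pos)"
    proof (intro nn_integral_mono)
      fix x y
      have "w x * w y * (F y powr P * G x powr (1 - Q)) = (F y powr P * w y) * (G x powr (1 - Q) * w x)" by simp
      also have "\<dots> \<le> (2 * F1 y powr P1) * (2 * G1 x powr (1 - Q1))"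
        unfolding F1_def G1_def using PQ nonneg w by (intro mult_mono lift) (auto simp: less_imp_le)
      finally have "ennreal (w x * w y * (F y powr P * G x powr (1 - Q))) \<le> ennreal (4 * (F1 y powr P1 * G1 x powr (1 - Q1)))"
        by (intro ennreal_leI) (simp add: mult_ac)
      then have "k x y * ennreal (w x * w y * (F y powr P * G x powr (1 - Q))) \<le> k x y * ennreal (4 * (F1 y powr P1 * G1 x powr (1 - Q1)))"
        by (intro mult_left_mono) auto
      then show "k x y * ennreal (w x * w y) * ennreal (F y powr P * G x powr (1 - Q)) \<le> 4 * (k x y * ennreal (F1 y powr P1 * G1 x powr (1 - Q1)))"
        using w[of x] w[of y] by (simp add: ennreal_mult less_imp_le mult_ac)
    qed
    also have "\<dots> = (\<integral>\<^sup>+x. 4 * (\<integral>\<^sup>+y. k x y * ennreal (F1 y powr P1 * G1 x powr (1 - Q1)) \<partial>lborel_pos) \<partial>lborel_pos)"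
      by (intro nn_integral_cong nn_integral_cmult borel_imp_lborel_pos) measurable
    also have "\<dots> = 4 * (\<integral>\<^sup>+x. (\<integral>\<^sup>+y. k x y * ennreal (F1 y powr P1 * G1 x powr (1 - Q1)) \<partial>lborel_pos) \<partial>lborel_pos)"
      unfolding nn_integral_lborel_pos[of "\<lambda>y. k x y * ennreal (F1 y powr P1 * G1 x powr (1 - Q1))" for x]
      by (intro nn_integral_cmult borel_imp_lborel_pos) measurable
    also have "\<dots> \<le> 4 * ennreal B" using B FG unfolding bilinear_bound_def by (intro mult_left_mono) auto
    also have "\<dots> = ennreal (4 * max 0 B)" by (subst ennreal_mult) (auto simp: max_def ennreal_neg)
    finally show "(\<integral>\<^sup>+x. \<integral>\<^sup>+y. k x y * ennreal (w x * w y) * ennreal (F y powr P * G x powr (1 - Q)) \<partial>lborel_pos \<partial>lborel_pos) \<le> ennreal (4 * max 0 B)" .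
  qed
  then show ?thesis unfolding bilinear_bounded_def w_def by blast
qed

section \<open>Hyperbolic functions and Gaussian factors\<close>

lemma sinh_ge_self:
  fixes t :: real assumes "t \<ge> 0" shows "sinh t \<ge> t"
proof -
  have "(\<lambda>t. sinh t - t) 0 \<le> (\<lambda>t. sinh t - t) t"
  proof (rule DERIV_nonneg_imp_nondecreasing[OF assms])
    fix u :: real
    show "\<exists>y. ((\<lambda>t. sinh t - t) has_real_derivative y) (at u) \<and> 0 \<le> y"
      by (rule exI[of _ "cosh u - 1"]) (auto intro!: derivative_eq_intros simp: cosh_real_ge_1)
  qed
  then show ?thesis by simp
qed

lemma sinh_le_self_times_cosh:
  fixes t :: real assumes "t \<ge> 0" shows "sinh t \<le> t * cosh t"
proof -
  have "(\<lambda>t. t * cosh t - sinh t) 0 \<le> (\<lambda>t. t * cosh t - sinh t) t"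
  proof (rule DERIV_nonneg_imp_nondecreasing[OF assms])
    fix u :: real assume "0 \<le> u"
    then show "\<exists>y. ((\<lambda>t. t * cosh t - sinh t) has_real_derivative y) (at u) \<and> 0 \<le> y"
      by (intro exI[of _ "u * sinh u"]) (auto intro!: derivative_eq_intros)
  qed
  then show ?thesis by simp
qed

lemma coth_ge_inverse:
  assumes "t > 0" shows "coth t \<ge> 1 / t"
  using sinh_le_self_times_cosh[of t] assms by (simp add: coth_def field_simps)

lemma coth_ge_1:
  assumes "t > 0" shows "coth t \<ge> 1"
  using assms sinh_less_cosh_real[of t] by (simp add: coth_def field_simps less_imp_le)

lemma cosh_le_2:
  fixes t :: real
  assumes "0 \<le> t" "t \<le> 1"
  shows "cosh t \<le> 2"
proof -
  have "exp t \<le> 3" using assms by (intro order_trans[OF _ exp_le]) simp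
  moreover have "exp (- t) \<le> 1" using assms by simp
  ultimately have "exp t + exp (- t) \<le> 4" by linarith
  then show ?thesis by (simp add: cosh_def)
qed

lemma tanh_ge_half:
  fixes t :: real
  shows "0 \<le> t \<Longrightarrow> t \<le> 1 \<Longrightarrow> tanh t \<ge> t / 2" and "t \<ge> 1 \<Longrightarrow> tanh t \<ge> 1 / 2"
proof -
  have 1: "tanh t \<ge> t / 2" if "0 \<le> t" "t \<le> 1" for t :: real
  proof -
    have "cosh t \<le> 2" using that by (intro cosh_le_2)
    then have "t * cosh t \<le> t * 2" using that by (intro mult_left_mono) auto
    also have "\<dots> \<le> 2 * sinh t" using sinh_ge_self[of t] that by simp
    finally show ?thesis by (simp add: tanh_def field_simps)
  qed
  show "0 \<le> t \<Longrightarrow> t \<le> 1 \<Longrightarrow> tanh t \<ge> t / 2" by (rule 1)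
  show "tanh t \<ge> 1 / 2" if "t \<ge> 1"
  proof -
    have "tanh 1 \<le> tanh t" using that by simp
    moreover have "tanh (1::real) \<ge> 1 / 2" using 1[of 1] by simp
    ultimately show ?thesis by linarith
  qed
qed

lemma sinh_double_ge_exp:
  fixes t :: real assumes "t \<ge> 1" shows "sinh (2 * t) \<ge> exp (2 * t) / 4"
proof -
  have "exp (- (2 * t)) \<le> 1" using assms by simp
  moreover have "exp (2 * t) \<ge> 1 + 2 * t" by (rule exp_ge_add_one_self)
  ultimately have "exp (- (2 * t)) * 2 \<le> exp (2 * t)" using assms by linarith
  then show ?thesis by (simp add: sinh_def)
qed

lemma powr_le_exp:
  fixes m :: real assumes "m \<ge> 0"
  obtains C where "C > 0" "\<And>v. v \<ge> 0 \<Longrightarrow> v powr m \<le> C * exp v"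
proof (cases "m = 0")
  case True
  show ?thesis by (rule that[of 1]) (use True in auto)
next
  case False
  then have m: "m > 0" using assms by simp
  show ?thesis
  proof (rule that[of "m powr m"])
    fix v :: real assume v: "v \<ge> 0"
    have "v / m \<le> exp (v / m)" using exp_ge_add_one_self[of "v / m"] by linarith
    then have "(v / m) powr m \<le> exp (v / m) powr m" using v m by (intro powr_mono2) auto
    also have "\<dots> = exp v" using m by (simp add: powr_def)
    finally show "v powr m \<le> m powr m * exp v" using m by (simp add: powr_divide field_simps)
  qed (use m in auto)
qed

lemma exp_minus_le_powr:
  fixes m c :: real assumes "m \<ge> 0" "c > 0"
  obtains C where "C > 0" "\<And>v. v > 0 \<Longrightarrow> exp (- c * v) \<le> C * v powr (- m)"
proof -
  obtain C where C: "C > 0" "\<And>v. v \<ge> 0 \<Longrightarrow> v powr m \<le> C * exp v" using powr_le_exp[OF assms(1)] by blast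
  show ?thesis
  proof (rule that[of "C / c powr m"])
    fix v :: real assume v: "v > 0"
    have "(c * v) powr m \<le> C * exp (c * v)" using C(2)[of "c * v"] v assms by simp
    then show "exp (- c * v) \<le> C / c powr m * v powr (- m)"
      using v assms by (simp add: powr_mult powr_minus exp_minus field_simps)
  qed (use C assms in auto)
qed

text \<open>
  The decay in \<open>x\<close> is bought with a singularity in \<open>t\<close>. This trade is what produces decay of
  order up to $2\sigma$ of the potential kernel.
\<close>

lemma gaussian_le_decay:
  fixes \<beta> c :: real
  assumes "\<beta> \<ge> 0" "c > 0"
  obtains C where "C > 0" 
    "\<And>t x. 0 < t \<Longrightarrow> t \<le> 1 \<Longrightarrow> 0 < x \<Longrightarrow> exp (- c * (t * x\<^sup>2)) \<le> C * (t powr (- (\<beta> / 2)) * (1 + x) powr (- \<beta>))"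
proof -
  obtain C where C: "C > 0" "\<And>v. v > 0 \<Longrightarrow> exp (- (c/2) * v) \<le> C * v powr (- (\<beta>/2))"
    using exp_minus_le_powr[of "\<beta>/2" "c/2"] assms by auto
  show ?thesis
  proof (rule that[of "exp c * C"])
    fix t x :: real assume tx: "0 < t" "t \<le> 1" "0 < x"
    have "t * (1 + x)\<^sup>2 \<le> 2 * (1 + t * x\<^sup>2)"
    proof -
      have "(1 + x)\<^sup>2 \<le> 2 * (1 + x\<^sup>2)" using zero_le_power2[of "1 - x"] by (simp add: power2_eq_square algebra_simps)
      then have "t * (1 + x)\<^sup>2 \<le> t * (2 * (1 + x\<^sup>2))" using tx by (intro mult_left_mono) auto
      then show ?thesis using tx by (simp add: algebra_simps)
    qed
    then have "c / 2 * (t * (1 + x)\<^sup>2) \<le> c / 2 * (2 * (1 + t * x\<^sup>2))" using assms by (intro mult_left_mono) auto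
    then have "- c * (t * x\<^sup>2) \<le> c + (- (c/2) * (t * (1 + x)\<^sup>2))" by (simp add: algebra_simps)
    then have "exp (- c * (t * x\<^sup>2)) \<le> exp c * exp (- (c/2) * (t * (1 + x)\<^sup>2))" by (simp flip: exp_add)
    also have "\<dots> \<le> exp c * (C * (t * (1 + x)\<^sup>2) powr (- (\<beta>/2)))" using tx by (intro mult_left_mono C) auto
    also have "(t * (1 + x)\<^sup>2) powr (- (\<beta>/2)) = t powr (- (\<beta> / 2)) * (1 + x) powr (- \<beta>)"
    proof -
      have "(1 + x)\<^sup>2 = (1 + x) powr 2" using tx by simp
      then show ?thesis by (simp add: powr_mult powr_powr)
    qed
    finally show "exp (- c * (t * x\<^sup>2)) \<le> exp c * C * (t powr (- (\<beta> / 2)) * (1 + x) powr (- \<beta>))" by (simp add: mult_ac)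
  qed (use C in auto)
qed

text \<open>
  The substitution $t = d^2 u$ determines the power of \<open>d\<close>. The Gaussian factor compensates the
  singularity at $u = 0$, and the remaining integrand is bounded by a power profile.
\<close>

lemma gaussian_singular_integral_le:
  assumes "\<kappa> > 0" "c > 0"
  obtains C where "C > 0"
    "\<And>d. d > 0 \<Longrightarrow> (\<integral>\<^sup>+t. ennreal (t powr (- 1 - \<kappa>) * exp (- c * (d\<^sup>2 / t))) \<partial>lborel_pos) \<le> ennreal (C * d powr (- 2 * \<kappa>))"
proof -
  obtain C where C: "C > 0" "\<And>v. v > 0 \<Longrightarrow> exp (- c * v) \<le> C * v powr (- (1 + \<kappa>))"
    using exp_minus_le_powr[of "1 + \<kappa>" c] assms by auto
  define D where "D = max C 1"
  define I where "I = (\<integral>\<^sup>+u. ennreal (power_profile 0 (1 + \<kappa>) u) \<partial>lborel_pos)"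
  have I: "I < \<infinity>" unfolding I_def using assms by (intro nn_integral_power_profile_finite) auto
  have pw: "t powr (- 1 - \<kappa>) * exp (- c * (d\<^sup>2 / t)) \<le> D * d powr (- 2 * \<kappa>) * (1 / d\<^sup>2 * power_profile 0 (1 + \<kappa>) (1 / d\<^sup>2 * \<bar>t - 0\<bar>))"
    if "d > 0" "t > 0" for d t
  proof -
    define u where "u = t / d\<^sup>2"
    have u: "u > 0" "t = d\<^sup>2 * u" "d\<^sup>2 / t = 1 / u" using that by (auto simp: u_def)
    have d2: "d\<^sup>2 = d powr 2" using that by simp
    have "u powr (- 1 - \<kappa>) * exp (- c * (1 / u)) \<le> D * power_profile 0 (1 + \<kappa>) u"
    proof (cases "u \<le> 1")
      case True
      have "u powr (- 1 - \<kappa>) * exp (- c * (1 / u)) \<le> u powr (- 1 - \<kappa>) * (C * (1 / u) powr (- (1 + \<kappa>)))"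
        using u by (intro mult_left_mono C) auto
      also have "(1 / u) powr (- (1 + \<kappa>)) = u powr (1 + \<kappa>)"
        proof -
          have "(1 / u) powr (- m) = u powr m" for m using u by (simp add: powr_divide powr_minus field_simps)
          then show ?thesis .
        qed
      also have "u powr (- 1 - \<kappa>) * (C * u powr (1 + \<kappa>)) = C * u powr (- 1 - \<kappa> + (1 + \<kappa>))"
        by (simp only: powr_add mult_ac)
      also have "\<dots> = C" using u by simp
      finally show ?thesis using True u by (simp add: power_profile_def D_def)
    next
      case False
      have "u powr (- 1 - \<kappa>) * exp (- c * (1 / u)) \<le> u powr (- 1 - \<kappa>) * 1"
        using u assms by (intro mult_left_mono) auto
      also have "\<dots> = 1 * power_profile 0 (1 + \<kappa>) u" using False by (simp add: power_profile_def)
      also have "\<dots> \<le> D * power_profile 0 (1 + \<kappa>) u" by (intro mult_right_mono) (auto simp: D_def)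
      finally show ?thesis .
    qed
    then have "(d\<^sup>2) powr (- 1 - \<kappa>) * (u powr (- 1 - \<kappa>) * exp (- c * (1 / u))) \<le> (d\<^sup>2) powr (- 1 - \<kappa>) * (D * power_profile 0 (1 + \<kappa>) u)"
      by (intro mult_left_mono) auto
    moreover have "(d\<^sup>2) powr (- 1 - \<kappa>) = d powr (- 2 * \<kappa>) * (1 / d\<^sup>2)"
    proof -
      have "(d\<^sup>2) powr (- 1 - \<kappa>) = d powr (- 2 * \<kappa> + (- 2))" unfolding d2 powr_powr by (simp add: algebra_simps)
      also have "\<dots> = d powr (- 2 * \<kappa>) * d powr (- 2)" by (rule powr_add)
      also have "d powr (- 2) = 1 / d\<^sup>2" using that by (simp add: powr_minus_divide)
      finally show ?thesis .
    qed
    moreover have "t powr (- 1 - \<kappa>) = (d\<^sup>2) powr (- 1 - \<kappa>) * u powr (- 1 - \<kappa>)" unfolding u(2) by (rule powr_mult)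
    moreover have "1 / d\<^sup>2 * \<bar>t - 0\<bar> = u" using that by (simp add: u_def)
    ultimately show ?thesis unfolding u(3) by (simp add: mult_ac)
  qed
  show ?thesis
  proof (rule that[of "D * (2 * enn2real I + 1)"])
    fix d :: real assume d: "d > 0"
    have "(\<integral>\<^sup>+t. ennreal (t powr (- 1 - \<kappa>) * exp (- c * (d\<^sup>2 / t))) \<partial>lborel_pos)
      \<le> (\<integral>\<^sup>+t. ennreal (D * d powr (- 2 * \<kappa>)) * (ennreal (1 / d\<^sup>2) * ennreal (power_profile 0 (1 + \<kappa>) (1 / d\<^sup>2 * \<bar>t - 0\<bar>))) \<partial>lborel_pos)"
      using pw[OF d] C d by (intro nn_integral_mono) (auto simp: D_def ennreal_mult[symmetric] simp del: times_divide_eq_left diff_zero intro!: ennreal_leI)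
    also have "\<dots> = ennreal (D * d powr (- 2 * \<kappa>)) * (\<integral>\<^sup>+t. ennreal (1 / d\<^sup>2) * ennreal (power_profile 0 (1 + \<kappa>) (1 / d\<^sup>2 * \<bar>t - 0\<bar>)) \<partial>lborel_pos)"
      by (intro nn_integral_cmult borel_imp_lborel_pos) measurable
    also have "\<dots> \<le> ennreal (D * d powr (- 2 * \<kappa>)) * (2 * I)"
      unfolding I_def using d by (intro mult_left_mono nn_integral_abs_scaled_le[of "\<lambda>u. ennreal (power_profile 0 (1 + \<kappa>) u)"]) auto
    also have "\<dots> \<le> ennreal (D * d powr (- 2 * \<kappa>)) * ennreal (2 * enn2real I + 1)"
      using I by (intro mult_left_mono) (cases I; simp add: ennreal_mult ennreal_plus)+
    also have "\<dots> = ennreal (D * (2 * enn2real I + 1) * d powr (- 2 * \<kappa>))"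
      by (subst ennreal_mult[symmetric]) (auto simp: D_def mult_ac)
    finally show "(\<integral>\<^sup>+t. ennreal (t powr (- 1 - \<kappa>) * exp (- c * (d\<^sup>2 / t))) \<partial>lborel_pos) \<le> ennreal (D * (2 * enn2real I + 1) * d powr (- 2 * \<kappa>))" .
  qed (auto simp: D_def intro!: mult_pos_pos add_nonneg_pos)
qed

lemma nn_integral_gamma_finite:
  assumes "\<sigma> > 0" "c > 0"
  shows "(\<integral>\<^sup>+t. ennreal (t powr (\<sigma> - 1) * exp (- c * t)) \<partial>lborel_pos) < \<infinity>"
proof -
  define f where "f u = ennreal (\<bar>u\<bar> powr (\<sigma> - 1) * exp (- \<bar>u\<bar>))" for u
  have [measurable]: "f \<in> borel_measurable borel" unfolding f_def by measurable
  have "(\<integral>\<^sup>+u. f u \<partial>lborel_pos) \<le> (\<integral>\<^sup>+u. ennreal (u powr (\<sigma> - 1) / exp u) * indicator {0..} u \<partial>lborel)"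
    unfolding nn_integral_lborel_pos f_def by (intro nn_integral_mono) (auto simp: exp_minus field_simps split: split_indicator)
  also have "\<dots> = ennreal (Gamma \<sigma>)"
    using Gamma_integral_real[OF assms(1)] by (intro nn_integral_has_integral_lebesgue') auto
  finally have F: "(\<integral>\<^sup>+u. f u \<partial>lborel_pos) < \<infinity>" by (auto intro: le_less_trans)
  have "(\<integral>\<^sup>+t. ennreal (t powr (\<sigma> - 1) * exp (- c * t)) \<partial>lborel_pos) = (\<integral>\<^sup>+t. ennreal (c powr (- \<sigma>)) * (ennreal c * f (c * \<bar>t - 0\<bar>)) \<partial>lborel_pos)"
  proof (rule nn_integral_cong)
    fix t :: real assume "t \<in> space lborel_pos"
    then have t: "t > 0" by simp
    have "c powr (- \<sigma>) * (c * ((c * t) powr (\<sigma> - 1))) = t powr (\<sigma> - 1)"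
      using assms t by (simp add: powr_mult powr_diff powr_minus)
    then have "t powr (\<sigma> - 1) * exp (- c * t) = c powr (- \<sigma>) * (c * ((c * t) powr (\<sigma> - 1) * exp (- (c * t))))"
      by (simp add: mult.assoc[symmetric])
    then show "ennreal (t powr (\<sigma> - 1) * exp (- c * t)) = ennreal (c powr (- \<sigma>)) * (ennreal c * f (c * \<bar>t - 0\<bar>))"
      using assms t by (simp add: f_def abs_mult ennreal_mult[symmetric])
  qed
  also have "\<dots> = ennreal (c powr (- \<sigma>)) * (\<integral>\<^sup>+t. ennreal c * f (c * \<bar>t - 0\<bar>) \<partial>lborel_pos)"
    by (intro nn_integral_cmult borel_imp_lborel_pos) measurable
  also have "\<dots> \<le> ennreal (c powr (- \<sigma>)) * (2 * (\<integral>\<^sup>+u. f u \<partial>lborel_pos))"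
    using assms by (intro mult_left_mono nn_integral_abs_scaled_le) auto
  also have "\<dots> < \<infinity>" using F by (simp add: ennreal_mult_less_top)
  finally show ?thesis .
qed

section \<open>The heat kernel\<close>

lemma bessel_I_measurable [measurable]: "bessel_I \<alpha> \<in> borel_measurable borel"
  unfolding bessel_I_def by measurable

lemma coth_measurable [measurable]: "coth \<in> borel_measurable borel"
proof -
  have "(cosh :: real \<Rightarrow> real) \<in> borel_measurable borel" "(sinh :: real \<Rightarrow> real) \<in> borel_measurable borel"
    by (auto intro!: borel_measurable_continuous_onI continuous_intros)
  then show ?thesis unfolding coth_def by measurable
qed

lemma hyperbolic_measurable [measurable]:
  "(sinh :: real \<Rightarrow> real) \<in> borel_measurable borel" "(tanh :: real \<Rightarrow> real) \<in> borel_measurable borel"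
proof -
  show [measurable]: "(sinh :: real \<Rightarrow> real) \<in> borel_measurable borel"
    by (auto intro!: borel_measurable_continuous_onI continuous_intros)
  have [measurable]: "(cosh :: real \<Rightarrow> real) \<in> borel_measurable borel"
    by (auto intro!: borel_measurable_continuous_onI continuous_intros)
  show "(tanh :: real \<Rightarrow> real) \<in> borel_measurable borel"
    unfolding tanh_def by measurable
qed

definition heat_kernel_H :: "real \<Rightarrow> real \<Rightarrow> real \<Rightarrow> real \<Rightarrow> real" where
  "heat_kernel_H \<alpha> t x y = (x * y) powr (\<alpha> + 1 / 2) * heat_kernel \<alpha> t x y"

lemma potential_kernel_H_eq:
  "potential_kernel_H \<alpha> \<sigma> x y =
     ennreal (1 / Gamma \<sigma>) * (\<integral>\<^sup>+t. ennreal (heat_kernel_H \<alpha> t x y * t powr (\<sigma> - 1)) \<partial>lborel_pos)"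
proof -
  have m: "(\<lambda>t. ennreal (heat_kernel \<alpha> t x y * t powr (\<sigma> - 1))) \<in> borel_measurable borel"
    unfolding heat_kernel_def by measurable
  have "(\<integral>\<^sup>+t. ennreal (heat_kernel_H \<alpha> t x y * t powr (\<sigma> - 1)) \<partial>lborel_pos) =
     (\<integral>\<^sup>+t. ennreal ((x * y) powr (\<alpha> + 1 / 2)) * ennreal (heat_kernel \<alpha> t x y * t powr (\<sigma> - 1)) \<partial>lborel_pos)"
    unfolding heat_kernel_H_def by (intro nn_integral_cong) (simp add: mult.assoc ennreal_mult')
  also have "\<dots> = ennreal ((x * y) powr (\<alpha> + 1 / 2)) * (\<integral>\<^sup>+t. ennreal (heat_kernel \<alpha> t x y * t powr (\<sigma> - 1)) \<partial>lborel_pos)"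
    by (intro nn_integral_cmult borel_imp_lborel_pos m)
  finally show ?thesis
    unfolding potential_kernel_H_def potential_kernel_def nn_integral_lebesgue_pos by (simp add: mult_ac)
qed

lemma potential_kernel_H_measurable [measurable]:
  "case_prod (potential_kernel_H \<alpha> \<sigma>) \<in> borel_measurable (borel \<Otimes>\<^sub>M borel)"
proof -
  have [measurable]: "case_prod (\<lambda>z t. ennreal (heat_kernel_H \<alpha> t (fst z) (snd z) * t powr (\<sigma> - 1)) * indicator {0<..} t)
     \<in> borel_measurable ((borel \<Otimes>\<^sub>M borel) \<Otimes>\<^sub>M lborel)"
    unfolding heat_kernel_H_def heat_kernel_def by measurable
  have "(\<lambda>z. ennreal (1 / Gamma \<sigma>) * (\<integral>\<^sup>+t. ennreal (heat_kernel_H \<alpha> t (fst z) (snd z) * t powr (\<sigma> - 1)) * indicator {0<..} t \<partial>lborel))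
     \<in> borel_measurable (borel \<Otimes>\<^sub>M borel)"
    by measurable
  then show ?thesis
    unfolding potential_kernel_H_eq nn_integral_lborel_pos by (simp add: case_prod_unfold)
qed

text \<open>
  All powers of $xy$ combine with $1/\sinh 2t$ to the argument $z = xy/\sinh 2t$ of the Bessel
  function, in the form $\sqrt z\, I_\alpha(z)$ whose growth is known.
\<close>

lemma heat_kernel_H_factorization:
  assumes "t > 0" "x > 0" "y > 0"
  shows "heat_kernel_H \<alpha> t x y = sinh (2 * t) powr (- 1/2) * (sqrt (x * y / sinh (2 * t)) * bessel_I \<alpha> (x * y / sinh (2 * t)))
     * exp (- (1/2) * coth (2 * t) * (x\<^sup>2 + y\<^sup>2))"
proof -
  define S where "S = sinh (2 * t)"
  have S: "S > 0" using assms by (simp add: S_def)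
  have 1: "(x * y) powr (\<alpha> + 1/2) * (x * y) powr (- \<alpha>) = sqrt (x * y)"
    using assms by (simp add: powr_half_sqrt flip: powr_add)
  have 2: "1 / S * sqrt (x * y) = S powr (- 1/2) * sqrt (x * y / S)"
  proof -
    have "S powr (- 1/2) = 1 / sqrt S" using S powr_minus_divide[of S "1/2"] by (simp add: powr_half_sqrt)
    then show ?thesis using S by (simp add: real_sqrt_divide)
  qed
  have "heat_kernel_H \<alpha> t x y = (1 / S * ((x * y) powr (\<alpha> + 1/2) * (x * y) powr (- \<alpha>))) * bessel_I \<alpha> (x * y / S) * exp (- (1/2) * coth (2 * t) * (x\<^sup>2 + y\<^sup>2))"
    by (simp add: heat_kernel_H_def heat_kernel_def S_def)
  also have "\<dots> = S powr (- 1/2) * (sqrt (x * y / S) * bessel_I \<alpha> (x * y / S)) * exp (- (1/2) * coth (2 * t) * (x\<^sup>2 + y\<^sup>2))"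
    unfolding 1 2 by simp
  finally show ?thesis unfolding S_def .
qed

text \<open>
  Up to a constant factor this is the heat kernel of the harmonic oscillator $-d^2/dx^2 + x^2$ on the
  line.
\<close>

definition mehler :: "real \<Rightarrow> real \<Rightarrow> real \<Rightarrow> real" where
  "mehler t x y = sinh (2 * t) powr (- 1/2) * exp (- (1/4) * (tanh t * (x + y)\<^sup>2) - (1/4) * (coth t * (x - y)\<^sup>2))"

text \<open>
  The size of the heat kernel in the range $xy \le \sinh 2t$, if $\gamma = -\alpha-1/2$.
\<close>

definition corner :: "real \<Rightarrow> real \<Rightarrow> real \<Rightarrow> real \<Rightarrow> real" where
  "corner \<gamma> t x y = (x * y) powr (- \<gamma>) * sinh (2 * t) powr (\<gamma> - 1/2) * exp (- (1/2) * coth (2 * t) * (x\<^sup>2 + y\<^sup>2))"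

lemma mehler_exponent:
  assumes "t > 0"
  shows "- (1/2) * coth (2 * t) * (x\<^sup>2 + y\<^sup>2) + x * y / sinh (2 * t) = - (1/4) * (tanh t * (x + y)\<^sup>2) - (1/4) * (coth t * (x - y)\<^sup>2)"
proof -
  have s: "sinh t > 0" "cosh t > 0" using assms by (auto simp: cosh_real_pos)
  have dbl: "sinh (2 * t) = 2 * sinh t * cosh t" "cosh (2 * t) = (cosh t)\<^sup>2 + (sinh t)\<^sup>2"
    by (rule sinh_double, rule cosh_double)
  have 1: "tanh t + coth t = 2 * coth (2 * t)"
    unfolding tanh_def coth_def dbl using s by (simp add: field_simps power2_eq_square)
  have 2: "coth t - tanh t = 2 / sinh (2 * t)"
    unfolding tanh_def coth_def dbl using s hyperbolic_pythagoras[of t] by (simp add: field_simps power2_eq_square)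
  have "- (1/4) * (tanh t * (x + y)\<^sup>2) - (1/4) * (coth t * (x - y)\<^sup>2) = - (1/4) * ((tanh t + coth t) * (x\<^sup>2 + y\<^sup>2)) + (1/2) * ((coth t - tanh t) * (x * y))"
    by (simp add: power2_eq_square algebra_simps)
  then show ?thesis unfolding 1 2 by simp
qed

lemma mehler_eq:
  assumes "t > 0"
  shows "mehler t x y = sinh (2 * t) powr (- 1/2) * exp (x * y / sinh (2 * t)) * exp (- (1/2) * coth (2 * t) * (x\<^sup>2 + y\<^sup>2))"
  unfolding mehler_def mehler_exponent[OF assms, symmetric] exp_add by simp

lemma corner_eq:
  assumes "t > 0" "x > 0" "y > 0"
  shows "corner \<gamma> t x y = sinh (2 * t) powr (- 1/2) * (x * y / sinh (2 * t)) powr (- \<gamma>) * exp (- (1/2) * coth (2 * t) * (x\<^sup>2 + y\<^sup>2))"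
proof -
  have "sinh (2 * t) powr (\<gamma> - 1/2) = sinh (2 * t) powr (- 1/2) * sinh (2 * t) powr \<gamma>" by (simp flip: powr_add)
  moreover have "(x * y / sinh (2 * t)) powr (- \<gamma>) = (x * y) powr (- \<gamma>) * sinh (2 * t) powr \<gamma>"
    unfolding powr_divide powr_minus_divide[of "sinh (2 * t)"] by simp
  ultimately show ?thesis by (simp add: corner_def)
qed

text \<open>
  For $\alpha \ge -1/2$ the factor $\min(1,z)^{\alpha+1/2}$ is at most $1$, so that Mehler's kernel
  dominates also in the range $z \le 1$.
\<close>

lemma heat_kernel_H_le_mehler:
  assumes "\<alpha> \<ge> - 1/2"
  obtains C where "C > 0" "\<And>t x y. t > 0 \<Longrightarrow> x > 0 \<Longrightarrow> y > 0 \<Longrightarrow> heat_kernel_H \<alpha> t x y \<le> C * mehler t x y"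
proof -
  have "\<alpha> > -1" using assms by simp
  then obtain c C where C: "C > 0" "\<And>z. z > 0 \<Longrightarrow> sqrt z * bessel_I \<alpha> z \<le> C * min 1 z powr (\<alpha> + 1/2) * exp z"
    by (rule bessel_I_bounds) blast
  show ?thesis
  proof (rule that[OF C(1)])
    fix t x y :: real assume p: "t > 0" "x > 0" "y > 0"
    define z where "z = x * y / sinh (2 * t)"
    have z: "z > 0" using p by (simp add: z_def)
    have "min 1 z powr (\<alpha> + 1/2) \<le> 1 powr (\<alpha> + 1/2)" using z assms by (intro powr_mono2) auto
    then have "C * min 1 z powr (\<alpha> + 1/2) * exp z \<le> C * 1 * exp z" using C by (intro mult_right_mono mult_left_mono) auto
    then have "sqrt z * bessel_I \<alpha> z \<le> C * exp z" using C(2)[OF z] by simp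
    then have "sinh (2 * t) powr (- 1/2) * (sqrt z * bessel_I \<alpha> z) * exp (- (1/2) * coth (2 * t) * (x\<^sup>2 + y\<^sup>2))
       \<le> sinh (2 * t) powr (- 1/2) * (C * exp z) * exp (- (1/2) * coth (2 * t) * (x\<^sup>2 + y\<^sup>2))"
      by (intro mult_right_mono mult_left_mono) auto
    then show "heat_kernel_H \<alpha> t x y \<le> C * mehler t x y"
      unfolding heat_kernel_H_factorization[OF p] mehler_eq[OF p(1)] z_def by (simp add: mult_ac)
  qed
qed

lemma heat_kernel_H_le_mehler_corner:
  assumes "\<alpha> > - 1" "\<alpha> < - 1/2"
  obtains C where "C > 0" "\<And>t x y. t > 0 \<Longrightarrow> x > 0 \<Longrightarrow> y > 0 \<Longrightarrow> heat_kernel_H \<alpha> t x y \<le> C * mehler t x y + C * corner (- \<alpha> - 1/2) t x y"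
proof -
  obtain c C where C: "C > 0" "\<And>z. z > 0 \<Longrightarrow> sqrt z * bessel_I \<alpha> z \<le> C * min 1 z powr (\<alpha> + 1/2) * exp z"
    using assms(1) by (rule bessel_I_bounds) blast
  show ?thesis
  proof (rule that[of "3 * C"])
    fix t x y :: real assume p: "t > 0" "x > 0" "y > 0"
    define z where "z = x * y / sinh (2 * t)"
    have z: "z > 0" using p by (simp add: z_def)
    have "min 1 z powr (\<alpha> + 1/2) * exp z \<le> 3 * exp z + 3 * z powr (\<alpha> + 1/2)"
    proof (cases "z \<ge> 1")
      case False
      have "exp z \<le> 3" using False by (intro order_trans[OF _ exp_le]) simp
      then have "z powr (\<alpha> + 1/2) * exp z \<le> z powr (\<alpha> + 1/2) * 3" by (intro mult_left_mono) auto
      then show ?thesis using False by (simp add: add_increasing mult.commute)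
    qed (simp add: add_increasing2)
    then have "C * (min 1 z powr (\<alpha> + 1/2) * exp z) \<le> C * (3 * exp z + 3 * z powr (\<alpha> + 1/2))" using C by (intro mult_left_mono) auto
    then have "sqrt z * bessel_I \<alpha> z \<le> 3 * C * exp z + 3 * C * z powr (\<alpha> + 1/2)" using C(2)[OF z] by (simp add: algebra_simps)
    then have "sinh (2 * t) powr (- 1/2) * (sqrt z * bessel_I \<alpha> z) * exp (- (1/2) * coth (2 * t) * (x\<^sup>2 + y\<^sup>2))
       \<le> sinh (2 * t) powr (- 1/2) * (3 * C * exp z + 3 * C * z powr (\<alpha> + 1/2)) * exp (- (1/2) * coth (2 * t) * (x\<^sup>2 + y\<^sup>2))"
      by (intro mult_right_mono mult_left_mono) auto
    moreover have "- (- \<alpha> - 1/2) = \<alpha> + 1/2" by simp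
    ultimately show "heat_kernel_H \<alpha> t x y \<le> 3 * C * mehler t x y + 3 * C * corner (- \<alpha> - 1/2) t x y"
      unfolding heat_kernel_H_factorization[OF p] mehler_eq[OF p(1)] corner_eq[OF p] z_def by (simp only: algebra_simps)
  qed (use C in auto)
qed

lemma heat_kernel_H_lower:
  assumes "\<alpha> > - 1"
  obtains c where "c > 0" 
    "\<And>t x y. t > 0 \<Longrightarrow> x > 0 \<Longrightarrow> y > 0 \<Longrightarrow> sinh (2 * t) \<le> x * y \<Longrightarrow> c * mehler t x y \<le> heat_kernel_H \<alpha> t x y"
    "\<And>t x y. t > 0 \<Longrightarrow> x > 0 \<Longrightarrow> y > 0 \<Longrightarrow> x * y \<le> sinh (2 * t) \<Longrightarrow> c * corner (- \<alpha> - 1/2) t x y \<le> heat_kernel_H \<alpha> t x y"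
    "\<And>t x y. t > 0 \<Longrightarrow> x > 0 \<Longrightarrow> y > 0 \<Longrightarrow> 0 \<le> heat_kernel_H \<alpha> t x y"
proof -
  obtain c C where c: "c > 0" "\<And>z. z > 0 \<Longrightarrow> c * min 1 z powr (\<alpha> + 1/2) * exp z \<le> sqrt z * bessel_I \<alpha> z"
    using assms by (rule bessel_I_bounds) blast
  have *: "sinh (2 * t) powr (- 1/2) * b * exp (- (1/2) * coth (2 * t) * (x\<^sup>2 + y\<^sup>2)) \<le> heat_kernel_H \<alpha> t x y"
    if p: "t > 0" "x > 0" "y > 0" and b: "b \<le> sqrt (x * y / sinh (2 * t)) * bessel_I \<alpha> (x * y / sinh (2 * t))" for t x y b
    unfolding heat_kernel_H_factorization[OF p] using b by (intro mult_right_mono mult_left_mono) auto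
  show ?thesis
  proof (rule that[OF c(1)])
    fix t x y :: real assume p: "t > 0" "x > 0" "y > 0"
    define z where "z = x * y / sinh (2 * t)"
    have z: "z > 0" using p by (simp add: z_def)
    {
      assume "sinh (2 * t) \<le> x * y"
      then have "z \<ge> 1" using p by (simp add: z_def)
      then have "c * exp z \<le> sqrt z * bessel_I \<alpha> z" using c(2)[OF z] by simp
      from *[OF p this[unfolded z_def]] show "c * mehler t x y \<le> heat_kernel_H \<alpha> t x y"
        unfolding mehler_eq[OF p(1)] by (simp add: mult_ac)
    }
    {
      assume "x * y \<le> sinh (2 * t)"
      then have z1: "z \<le> 1" using p by (simp add: z_def)
      have "c * z powr (\<alpha> + 1/2) * 1 \<le> c * z powr (\<alpha> + 1/2) * exp z" using c(1) z by (intro mult_left_mono) auto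
      also have "\<dots> \<le> sqrt z * bessel_I \<alpha> z" using c(2)[OF z] z1 by simp
      finally have "c * z powr (\<alpha> + 1/2) \<le> sqrt z * bessel_I \<alpha> z" by simp
      note *[OF p this[unfolded z_def]]
      moreover have "- (- \<alpha> - 1/2) = \<alpha> + 1/2" by simp
      ultimately show "c * corner (- \<alpha> - 1/2) t x y \<le> heat_kernel_H \<alpha> t x y"
        unfolding corner_eq[OF p] by (simp only: mult_ac)
    }
    have "0 \<le> c * min 1 z powr (\<alpha> + 1/2) * exp z" using c by auto
    then have "0 \<le> sqrt z * bessel_I \<alpha> z" using c(2)[OF z] by linarith
    from *[OF p this[unfolded z_def]] show "0 \<le> heat_kernel_H \<alpha> t x y" by simp
  qed
qed

section \<open>Upper estimates of the potential kernel\<close>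

definition mehler_potential :: "real \<Rightarrow> real \<Rightarrow> real \<Rightarrow> ennreal" where
  "mehler_potential \<sigma> x y = (\<integral>\<^sup>+t. ennreal (mehler t x y * t powr (\<sigma> - 1)) \<partial>lborel_pos)"

definition corner_potential :: "real \<Rightarrow> real \<Rightarrow> real \<Rightarrow> real \<Rightarrow> ennreal" where
  "corner_potential \<gamma> \<sigma> x y = (\<integral>\<^sup>+t. ennreal (corner \<gamma> t x y * t powr (\<sigma> - 1)) \<partial>lborel_pos)"

lemma mehler_measurable [measurable]: "(\<lambda>t. mehler t x y) \<in> borel_measurable borel"
  unfolding mehler_def by measurable

lemma corner_measurable [measurable]: "(\<lambda>t. corner \<gamma> t x y) \<in> borel_measurable borel"
  unfolding corner_def by measurable

lemma mehler_nonneg: "0 \<le> mehler t x y"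
  by (simp add: mehler_def)

lemma corner_nonneg: "0 \<le> corner \<gamma> t x y"
  by (simp add: corner_def)

lemma potential_kernel_H_le_mehler:
  assumes "\<alpha> \<ge> - 1/2"
  obtains C where "\<And>x y. x > 0 \<Longrightarrow> y > 0 \<Longrightarrow> potential_kernel_H \<alpha> \<sigma> x y \<le> ennreal C * mehler_potential \<sigma> x y"
proof -
  obtain C where C: "C > 0" "\<And>t x y. t > 0 \<Longrightarrow> x > 0 \<Longrightarrow> y > 0 \<Longrightarrow> heat_kernel_H \<alpha> t x y \<le> C * mehler t x y"
    using heat_kernel_H_le_mehler[OF assms] by blast
  show ?thesis
  proof (rule that[of "\<bar>1 / Gamma \<sigma>\<bar> * C"])
    fix x y :: real assume xy: "x > 0" "y > 0"
    have "(\<integral>\<^sup>+t. ennreal (heat_kernel_H \<alpha> t x y * t powr (\<sigma> - 1)) \<partial>lborel_pos) \<le> (\<integral>\<^sup>+t. ennreal C * ennreal (mehler t x y * t powr (\<sigma> - 1)) \<partial>lborel_pos)"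
    proof (rule nn_integral_mono)
      fix t :: real assume "t \<in> space lborel_pos"
      then have "heat_kernel_H \<alpha> t x y * t powr (\<sigma> - 1) \<le> C * mehler t x y * t powr (\<sigma> - 1)"
        using xy by (intro mult_right_mono C) auto
      then show "ennreal (heat_kernel_H \<alpha> t x y * t powr (\<sigma> - 1)) \<le> ennreal C * ennreal (mehler t x y * t powr (\<sigma> - 1))"
        using C(1) mehler_nonneg[of t x y] by (simp add: ennreal_mult[symmetric] mult.assoc ennreal_leI)
    qed
    also have "\<dots> = ennreal C * mehler_potential \<sigma> x y" unfolding mehler_potential_def
      by (intro nn_integral_cmult borel_imp_lborel_pos) measurable
    finally have "potential_kernel_H \<alpha> \<sigma> x y \<le> ennreal \<bar>1 / Gamma \<sigma>\<bar> * (ennreal C * mehler_potential \<sigma> x y)"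
      unfolding potential_kernel_H_eq by (intro mult_mono ennreal_leI abs_ge_self) auto
    then show "potential_kernel_H \<alpha> \<sigma> x y \<le> ennreal (\<bar>1 / Gamma \<sigma>\<bar> * C) * mehler_potential \<sigma> x y"
      using C(1) by (subst ennreal_mult) (auto simp only: mult.assoc abs_ge_zero less_imp_le)
  qed
qed

lemma potential_kernel_H_le_mehler_corner:
  assumes "\<alpha> > - 1" "\<alpha> < - 1/2"
  obtains C where "\<And>x y. x > 0 \<Longrightarrow> y > 0 \<Longrightarrow> potential_kernel_H \<alpha> \<sigma> x y \<le> ennreal C * (mehler_potential \<sigma> x y + corner_potential (- \<alpha> - 1/2) \<sigma> x y)"
proof -
  define \<gamma> where "\<gamma> = - \<alpha> - 1/2"
  obtain C where C: "C > 0" "\<And>t x y. t > 0 \<Longrightarrow> x > 0 \<Longrightarrow> y > 0 \<Longrightarrow> heat_kernel_H \<alpha> t x y \<le> C * mehler t x y + C * corner \<gamma> t x y"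
    using heat_kernel_H_le_mehler_corner[OF assms] unfolding \<gamma>_def by blast
  show ?thesis
  proof (rule that[of "\<bar>1 / Gamma \<sigma>\<bar> * C"], unfold \<gamma>_def[symmetric])
    fix x y :: real assume xy: "x > 0" "y > 0"
    have "(\<integral>\<^sup>+t. ennreal (heat_kernel_H \<alpha> t x y * t powr (\<sigma> - 1)) \<partial>lborel_pos)
       \<le> (\<integral>\<^sup>+t. ennreal C * (ennreal (mehler t x y * t powr (\<sigma> - 1)) + ennreal (corner \<gamma> t x y * t powr (\<sigma> - 1))) \<partial>lborel_pos)"
    proof (rule nn_integral_mono)
      fix t :: real assume "t \<in> space lborel_pos"
      then have "heat_kernel_H \<alpha> t x y * t powr (\<sigma> - 1) \<le> (C * mehler t x y + C * corner \<gamma> t x y) * t powr (\<sigma> - 1)"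
        using xy by (intro mult_right_mono C) auto
      also have "\<dots> = C * (mehler t x y * t powr (\<sigma> - 1) + corner \<gamma> t x y * t powr (\<sigma> - 1))"
        by (simp add: algebra_simps)
      finally have "ennreal (heat_kernel_H \<alpha> t x y * t powr (\<sigma> - 1)) \<le> ennreal (C * (mehler t x y * t powr (\<sigma> - 1) + corner \<gamma> t x y * t powr (\<sigma> - 1)))"
        by (rule ennreal_leI)
      also have "\<dots> = ennreal C * (ennreal (mehler t x y * t powr (\<sigma> - 1)) + ennreal (corner \<gamma> t x y * t powr (\<sigma> - 1)))"
        using C(1) mehler_nonneg[of t x y] corner_nonneg[of \<gamma> t x y] by (subst ennreal_plus[symmetric]) (auto simp: ennreal_mult)
      finally show "ennreal (heat_kernel_H \<alpha> t x y * t powr (\<sigma> - 1)) \<le> ennreal C * (ennreal (mehler t x y * t powr (\<sigma> - 1)) + ennreal (corner \<gamma> t x y * t powr (\<sigma> - 1)))" .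
    qed
    also have "\<dots> = ennreal C * (\<integral>\<^sup>+t. ennreal (mehler t x y * t powr (\<sigma> - 1)) + ennreal (corner \<gamma> t x y * t powr (\<sigma> - 1)) \<partial>lborel_pos)"
      by (intro nn_integral_cmult borel_imp_lborel_pos) measurable
    also have "(\<integral>\<^sup>+t. ennreal (mehler t x y * t powr (\<sigma> - 1)) + ennreal (corner \<gamma> t x y * t powr (\<sigma> - 1)) \<partial>lborel_pos)
       = mehler_potential \<sigma> x y + corner_potential \<gamma> \<sigma> x y"
      unfolding mehler_potential_def corner_potential_def
      by (intro nn_integral_add borel_imp_lborel_pos) measurable
    finally have "potential_kernel_H \<alpha> \<sigma> x y \<le> ennreal \<bar>1 / Gamma \<sigma>\<bar> * (ennreal C * (mehler_potential \<sigma> x y + corner_potential \<gamma> \<sigma> x y))"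
      unfolding potential_kernel_H_eq by (intro mult_mono ennreal_leI abs_ge_self) auto
    then show "potential_kernel_H \<alpha> \<sigma> x y \<le> ennreal (\<bar>1 / Gamma \<sigma>\<bar> * C) * (mehler_potential \<sigma> x y + corner_potential \<gamma> \<sigma> x y)"
      using C(1) by (subst ennreal_mult) (auto simp only: mult.assoc abs_ge_zero less_imp_le)
  qed
qed

text \<open>
  The integrals in \<open>t\<close> are estimated by a singular integral for $t \le 1$, where $\sinh 2t$ and $\tanh t$
  are comparable to \<open>t\<close>, and by a Gamma integral for $t > 1$, where $\sinh 2t$ grows exponentially.
\<close>

lemma nn_integral_split_at_1_le:
  fixes f g h :: "real \<Rightarrow> real"
  assumes "\<And>t. 0 < t \<Longrightarrow> t \<le> 1 \<Longrightarrow> f t \<le> a * g t" "\<And>t. t > 1 \<Longrightarrow> f t \<le> b * h t"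
    and [measurable]: "g \<in> borel_measurable borel" "h \<in> borel_measurable borel"
    and "\<And>t. g t \<ge> 0" "\<And>t. h t \<ge> 0" "a \<ge> 0" "b \<ge> 0"
  shows "(\<integral>\<^sup>+t. ennreal (f t) \<partial>lborel_pos) \<le> ennreal a * (\<integral>\<^sup>+t. ennreal (g t) \<partial>lborel_pos) + ennreal b * (\<integral>\<^sup>+t. ennreal (h t) \<partial>lborel_pos)"
proof -
  have "(\<integral>\<^sup>+t. ennreal (f t) \<partial>lborel_pos) \<le> (\<integral>\<^sup>+t. ennreal a * ennreal (g t) + ennreal b * ennreal (h t) \<partial>lborel_pos)"
  proof (rule nn_integral_mono)
    fix t :: real assume "t \<in> space lborel_pos"
    then have t: "t > 0" by simp
    have "f t \<le> a * g t + b * h t"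
      using assms(1)[OF t] assms(2)[of t] assms(5,6)[of t] assms(7,8)
      by (cases "t \<le> 1") (auto intro: add_increasing2 add_increasing)
    then have "ennreal (f t) \<le> ennreal (a * g t + b * h t)" by (rule ennreal_leI)
    then show "ennreal (f t) \<le> ennreal a * ennreal (g t) + ennreal b * ennreal (h t)"
      using assms(5,6)[of t] assms(7,8) by (simp add: ennreal_mult)
  qed
  also have "\<dots> = (\<integral>\<^sup>+t. ennreal a * ennreal (g t) \<partial>lborel_pos) + (\<integral>\<^sup>+t. ennreal b * ennreal (h t) \<partial>lborel_pos)"
    by (intro nn_integral_add borel_imp_lborel_pos) measurable
  also have "(\<integral>\<^sup>+t. ennreal a * ennreal (g t) \<partial>lborel_pos) = ennreal a * (\<integral>\<^sup>+t. ennreal (g t) \<partial>lborel_pos)"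
    by (intro nn_integral_cmult borel_imp_lborel_pos) measurable
  also have "(\<integral>\<^sup>+t. ennreal b * ennreal (h t) \<partial>lborel_pos) = ennreal b * (\<integral>\<^sup>+t. ennreal (h t) \<partial>lborel_pos)"
    by (intro nn_integral_cmult borel_imp_lborel_pos) measurable
  finally show ?thesis .
qed

lemma sinh_double_powr_le:
  fixes e t :: real
  assumes "e > 0"
  shows "0 < t \<Longrightarrow> sinh (2 * t) powr (- e) \<le> t powr (- e)"
    and "t \<ge> 1 \<Longrightarrow> sinh (2 * t) powr (- e) \<le> 4 powr e * exp (- (2 * e) * t)"
proof -
  show "sinh (2 * t) powr (- e) \<le> t powr (- e)" if "0 < t"
    using sinh_ge_self[of "2 * t"] that assms by (intro powr_mono2') auto
  assume t: "t \<ge> 1"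
  have "sinh (2 * t) powr (- e) \<le> (exp (2 * t) / 4) powr (- e)"
    using sinh_double_ge_exp[OF t] assms by (intro powr_mono2') auto
  also have "\<dots> = 4 powr e * exp (- (2 * e) * t)"
    unfolding powr_divide powr_minus_divide[of 4 e] by (simp add: powr_def mult_ac)
  finally show "sinh (2 * t) powr (- e) \<le> 4 powr e * exp (- (2 * e) * t)" .
qed

lemma gaussian_le_profile:
  assumes "c > 0" "0 < s" "s < 1"
  obtains C where "C > 0" "\<And>d. d > 0 \<Longrightarrow> exp (- c * d\<^sup>2) * d powr (s - 1) \<le> C * power_profile (1 - s) 2 d"
    "\<And>d. d > 0 \<Longrightarrow> exp (- c * d\<^sup>2) \<le> C * power_profile (1 - s) 2 d"
proof -
  have e: "exp (- c * d\<^sup>2) \<le> 1 / c * d powr (- 2)" if "d > 0" for d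
  proof -
    have "c * d\<^sup>2 \<le> exp (c * d\<^sup>2)" using exp_ge_add_one_self[of "c * d\<^sup>2"] by linarith
    then show ?thesis using that assms by (simp add: exp_minus powr_minus field_simps)
  qed
  have 1: "exp (- c * d\<^sup>2) \<le> 1" for d using assms by simp
  define D where "D = max 1 (1 / c)"
  have D: "D \<ge> 1" "D \<ge> 1 / c" by (auto simp: D_def)
  have large: "exp (- c * d\<^sup>2) \<le> D * power_profile (1 - s) 2 d" if "d > 1" for d
  proof -
    have "exp (- c * d\<^sup>2) \<le> 1 / c * d powr (- 2)" using that by (intro e) auto
    also have "\<dots> \<le> D * d powr (- 2)" using D by (intro mult_right_mono) auto
    finally show ?thesis using that by (simp add: power_profile_def)
  qed
  show ?thesis
  proof (rule that[of D])
    fix d :: real assume d: "d > 0"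
    show "exp (- c * d\<^sup>2) * d powr (s - 1) \<le> D * power_profile (1 - s) 2 d"
    proof (cases "d \<le> 1")
      case True
      have "exp (- c * d\<^sup>2) * d powr (s - 1) \<le> D * d powr (s - 1)"
        by (rule mult_right_mono[OF order_trans[OF 1 D(1)]]) simp
      then show ?thesis using True by (simp add: power_profile_def)
    next
      case False
      have "d powr (s - 1) \<le> d powr 0" using False assms by (intro powr_mono) auto
      then have "exp (- c * d\<^sup>2) * d powr (s - 1) \<le> exp (- c * d\<^sup>2) * 1" using d by (intro mult_left_mono) auto
      moreover have "exp (- c * d\<^sup>2) \<le> D * power_profile (1 - s) 2 d" using False by (intro large) auto
      ultimately show ?thesis by linarith
    qed
    show "exp (- c * d\<^sup>2) \<le> D * power_profile (1 - s) 2 d"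
    proof (cases "d \<le> 1")
      case True
      have "d powr 0 \<le> d powr (s - 1)" using True d assms by (intro powr_mono') auto
      then have "1 \<le> power_profile (1 - s) 2 d" using True d by (simp add: power_profile_def)
      then have "1 * 1 \<le> D * power_profile (1 - s) 2 d" using D by (intro mult_mono) auto
      then show ?thesis using 1[of d] by linarith
    qed (use large in auto)
  qed (use D in auto)
qed

lemma mehler_small_time_le:
  assumes "0 < t" "t \<le> 1" "x > 0" "y > 0"
  shows "mehler t x y \<le> t powr (- 1/2) * exp (- (1/8) * (t * x\<^sup>2)) * exp (- (1/4) * ((x - y)\<^sup>2 / t))"
proof -
  have "t / 2 * x\<^sup>2 \<le> tanh t * (x + y)\<^sup>2"
    using assms by (intro mult_mono tanh_ge_half power_mono) auto
  moreover have "1 / t * (x - y)\<^sup>2 \<le> coth t * (x - y)\<^sup>2"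
    using assms by (intro mult_right_mono coth_ge_inverse) auto
  ultimately have "exp (- (1/4) * (tanh t * (x + y)\<^sup>2) - (1/4) * (coth t * (x - y)\<^sup>2)) \<le> exp (- (1/8) * (t * x\<^sup>2) + - (1/4) * ((x - y)\<^sup>2 / t))"
    by simp
  then have "mehler t x y \<le> t powr (- 1/2) * exp (- (1/8) * (t * x\<^sup>2) + - (1/4) * ((x - y)\<^sup>2 / t))"
    unfolding mehler_def using sinh_double_powr_le(1)[of "1/2" t] assms by (intro mult_mono) auto
  then show ?thesis unfolding exp_add by (simp only: mult.assoc)
qed

lemma mehler_large_time_le:
  assumes "t \<ge> 1" "x > 0" "y > 0"
  shows "mehler t x y \<le> 2 * exp (- 1 * t) * (exp (- (1/16) * x\<^sup>2) * exp (- (1/16) * (x - y)\<^sup>2))"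
proof -
  have "1 / 2 * (x + y)\<^sup>2 \<le> tanh t * (x + y)\<^sup>2"
    using assms by (intro mult_right_mono tanh_ge_half) auto
  moreover have "x\<^sup>2 + (x - y)\<^sup>2 \<le> 2 * (x + y)\<^sup>2"
    using assms by (simp add: power2_eq_square algebra_simps)
  moreover have "0 \<le> coth t * (x - y)\<^sup>2" using coth_ge_1[of t] assms by simp
  ultimately have "exp (- (1/4) * (tanh t * (x + y)\<^sup>2) - (1/4) * (coth t * (x - y)\<^sup>2)) \<le> exp (- (1/16) * x\<^sup>2 + - (1/16) * (x - y)\<^sup>2)"
    by (subst exp_le_cancel_iff) linarith
  moreover have "sinh (2 * t) powr (- 1/2) \<le> 2 * exp (- 1 * t)"
    using sinh_double_powr_le(2)[of "1/2" t] assms by (simp add: powr_half_sqrt)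
  ultimately show ?thesis unfolding mehler_def exp_add[symmetric] by (intro mult_mono) auto
qed

text \<open>
  The parameters distribute the available order $2\sigma$: the part $\beta$ is used for decay at
  infinity, the part \<open>s\<close> for the singularity on the diagonal. Giving away some of the order,
  $s + \beta < 2\sigma$, is possible because $t \le 1$ in the singular range.
\<close>

lemma mehler_potential_le_profile:
  assumes s: "0 < s" "s < 1" and \<beta>: "\<beta> \<ge> 0" "s + \<beta> \<le> 2 * \<sigma>"
  obtains C where "\<And>x y. x > 0 \<Longrightarrow> y > 0 \<Longrightarrow> x \<noteq> y \<Longrightarrow>
    mehler_potential \<sigma> x y \<le> ennreal C * ennreal ((1 + \<bar>x\<bar>) powr (- \<beta>) * power_profile (1 - s) 2 \<bar>x - y\<bar>)"
proof -
  have \<sigma>: "\<sigma> > 0" using s \<beta> by simp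
  obtain A where A: "A > 0" "\<And>t x. 0 < t \<Longrightarrow> t \<le> 1 \<Longrightarrow> 0 < x \<Longrightarrow> exp (- (1/16) * (t * x\<^sup>2)) \<le> A * (t powr (- (\<beta> / 2)) * (1 + x) powr (- \<beta>))"
    using gaussian_le_decay[OF \<beta>(1), of "1/16"] by auto
  obtain D where D: "D > 0" "\<And>d. d > 0 \<Longrightarrow> exp (- (1/16) * d\<^sup>2) * d powr (s - 1) \<le> D * power_profile (1 - s) 2 d"
    "\<And>d. d > 0 \<Longrightarrow> exp (- (1/16) * d\<^sup>2) \<le> D * power_profile (1 - s) 2 d"
    using gaussian_le_profile[OF _ s, of "1/16"] by auto
  \<comment> \<open>so that \<open>d powr (- 2 * \<kappa>)\<close> is the singularity on the diagonal\<close>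
  define \<kappa> where "\<kappa> = (1 - s) / 2"
  have \<kappa>: "\<kappa> > 0" "- 2 * \<kappa> = s - 1" using s by (auto simp: \<kappa>_def)
  obtain E where E: "E > 0" "\<And>d. d > 0 \<Longrightarrow> (\<integral>\<^sup>+t. ennreal (t powr (- 1 - \<kappa>) * exp (- (1/8) * (d\<^sup>2 / t))) \<partial>lborel_pos) \<le> ennreal (E * d powr (- 2 * \<kappa>))"
    using gaussian_singular_integral_le[OF \<kappa>(1), of "1/8"] by auto
  define I where "I = enn2real (\<integral>\<^sup>+t. ennreal (t powr (\<sigma> - 1) * exp (- 1 * t)) \<partial>lborel_pos)"
  have I: "(\<integral>\<^sup>+t. ennreal (t powr (\<sigma> - 1) * exp (- 1 * t)) \<partial>lborel_pos) = ennreal I" "I \<ge> 0"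
    unfolding I_def using nn_integral_gamma_finite[OF \<sigma>, of 1] by auto
  show ?thesis
  proof (rule that[of "A * E * D + 2 * A * D * I"])
    fix x y :: real assume xy: "x > 0" "y > 0" "x \<noteq> y"
    define d where "d = \<bar>x - y\<bar>"
    have d: "d > 0" "(x - y)\<^sup>2 = d\<^sup>2" using xy by (auto simp: d_def)
    define W where "W = (1 + x) powr (- \<beta>)"
    have W: "W \<ge> 0" by (simp add: W_def)
    have small: "mehler t x y * t powr (\<sigma> - 1) \<le> A * W * exp (- (1/16) * d\<^sup>2) * (t powr (- 1 - \<kappa>) * exp (- (1/8) * (d\<^sup>2 / t)))"
      if t: "0 < t" "t \<le> 1" for t
    proof -
      have x: "exp (- (1/8) * (t * x\<^sup>2)) \<le> A * (t powr (- (\<beta> / 2)) * W)"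
      proof -
        have "exp (- (1/8) * (t * x\<^sup>2)) \<le> exp (- (1/16) * (t * x\<^sup>2))" using t by simp
        also have "\<dots> \<le> A * (t powr (- (\<beta> / 2)) * W)" unfolding W_def using t xy by (intro A(2))
        finally show ?thesis .
      qed
      have e: "exp (- (1/4) * (d\<^sup>2 / t)) \<le> exp (- (1/16) * d\<^sup>2) * exp (- (1/8) * (d\<^sup>2 / t))"
      proof -
        have "d\<^sup>2 \<le> d\<^sup>2 / t" using t mult_left_mono[of 1 "1 / t" "d\<^sup>2"] by simp
        then have "- (1/4) * (d\<^sup>2 / t) \<le> - (1/16) * d\<^sup>2 + - (1/8) * (d\<^sup>2 / t)" using zero_le_power2[of d] by linarith
        then show ?thesis unfolding exp_add[symmetric] by (subst exp_le_cancel_iff)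
      qed
      have p: "t powr (- 1/2) * t powr (- (\<beta> / 2)) * t powr (\<sigma> - 1) \<le> t powr (- 1 - \<kappa>)"
        unfolding powr_add[symmetric] using t \<beta> by (intro powr_mono') (auto simp: \<kappa>_def field_simps)
      have "mehler t x y * t powr (\<sigma> - 1) \<le> (t powr (- 1/2) * exp (- (1/8) * (t * x\<^sup>2)) * exp (- (1/4) * (d\<^sup>2 / t))) * t powr (\<sigma> - 1)"
        using mehler_small_time_le[OF t xy(1,2)] unfolding d(2) by (intro mult_right_mono) auto
      also have "\<dots> \<le> (t powr (- 1/2) * (A * (t powr (- (\<beta> / 2)) * W)) * (exp (- (1/16) * d\<^sup>2) * exp (- (1/8) * (d\<^sup>2 / t)))) * t powr (\<sigma> - 1)"
        using A(1) W by (intro mult_right_mono mult_mono mult_left_mono x e) auto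
      also have "\<dots> = A * W * exp (- (1/16) * d\<^sup>2) * ((t powr (- 1/2) * t powr (- (\<beta> / 2)) * t powr (\<sigma> - 1)) * exp (- (1/8) * (d\<^sup>2 / t)))"
        by (simp only: mult_ac)
      also have "\<dots> \<le> A * W * exp (- (1/16) * d\<^sup>2) * (t powr (- 1 - \<kappa>) * exp (- (1/8) * (d\<^sup>2 / t)))"
        using A(1) W by (intro mult_left_mono mult_right_mono p) auto
      finally show ?thesis .
    qed
    have large: "mehler t x y * t powr (\<sigma> - 1) \<le> 2 * A * W * exp (- (1/16) * d\<^sup>2) * (t powr (\<sigma> - 1) * exp (- 1 * t))" if t: "t > 1" for t
    proof -
      have "exp (- (1/16) * x\<^sup>2) \<le> A * W" using A(2)[of 1 x] xy by (simp add: W_def)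
      then have "2 * exp (- 1 * t) * (exp (- (1/16) * x\<^sup>2) * exp (- (1/16) * d\<^sup>2)) \<le> 2 * exp (- 1 * t) * (A * W * exp (- (1/16) * d\<^sup>2))"
        by (intro mult_left_mono mult_right_mono) auto
      then have "mehler t x y \<le> 2 * exp (- 1 * t) * (A * W * exp (- (1/16) * d\<^sup>2))"
        using mehler_large_time_le[of t x y] t xy unfolding d(2) by linarith
      then have "mehler t x y * t powr (\<sigma> - 1) \<le> 2 * exp (- 1 * t) * (A * W * exp (- (1/16) * d\<^sup>2)) * t powr (\<sigma> - 1)"
        by (intro mult_right_mono) auto
      then show ?thesis by (simp only: mult_ac)
    qed
    have "mehler_potential \<sigma> x y \<le> ennreal (A * W * exp (- (1/16) * d\<^sup>2)) * (\<integral>\<^sup>+t. ennreal (t powr (- 1 - \<kappa>) * exp (- (1/8) * (d\<^sup>2 / t))) \<partial>lborel_pos)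
       + ennreal (2 * A * W * exp (- (1/16) * d\<^sup>2)) * (\<integral>\<^sup>+t. ennreal (t powr (\<sigma> - 1) * exp (- 1 * t)) \<partial>lborel_pos)"
      unfolding mehler_potential_def using A(1) W by (intro nn_integral_split_at_1_le small large) (auto simp: mult_nonneg_nonneg)
    also have "\<dots> \<le> ennreal (A * W * exp (- (1/16) * d\<^sup>2)) * ennreal (E * d powr (- 2 * \<kappa>)) + ennreal (2 * A * W * exp (- (1/16) * d\<^sup>2)) * ennreal I"
      unfolding I(1) using d by (intro add_mono mult_left_mono E(2)) auto
    also have "\<dots> = ennreal (A * W * exp (- (1/16) * d\<^sup>2) * (E * d powr (s - 1)) + 2 * A * W * exp (- (1/16) * d\<^sup>2) * I)"
      using A(1) W E(1) I(2) unfolding \<kappa>(2) by (simp add: ennreal_mult[symmetric] ennreal_plus[symmetric] del: ennreal_plus)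
    also have "\<dots> \<le> ennreal ((A * E * D + 2 * A * D * I) * (W * power_profile (1 - s) 2 d))"
    proof (rule ennreal_leI)
      have "A * W * E * (exp (- (1/16) * d\<^sup>2) * d powr (s - 1)) \<le> A * W * E * (D * power_profile (1 - s) 2 d)"
        using A(1) W E(1) d by (intro mult_left_mono D(2)) auto
      moreover have "2 * A * W * I * exp (- (1/16) * d\<^sup>2) \<le> 2 * A * W * I * (D * power_profile (1 - s) 2 d)"
        using A(1) W I(2) d by (intro mult_left_mono D(3)) auto
      ultimately show "A * W * exp (- (1/16) * d\<^sup>2) * (E * d powr (s - 1)) + 2 * A * W * exp (- (1/16) * d\<^sup>2) * I \<le> (A * E * D + 2 * A * D * I) * (W * power_profile (1 - s) 2 d)"
        by (simp add: algebra_simps)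
    qed
    also have "\<dots> = ennreal (A * E * D + 2 * A * D * I) * ennreal (W * power_profile (1 - s) 2 d)"
      using A(1) D(1) E(1) I(2) W by (intro ennreal_mult) auto
    finally show "mehler_potential \<sigma> x y \<le> ennreal (A * E * D + 2 * A * D * I) * ennreal ((1 + \<bar>x\<bar>) powr (- \<beta>) * power_profile (1 - s) 2 \<bar>x - y\<bar>)"
      using xy by (simp add: W_def d_def)
  qed
qed

text \<open>
  For $\sigma > 1/2$ the power $t^{\sigma-3/2}$ is integrable at $0$ without the help of the Gaussian.
\<close>

lemma mehler_potential_bounded:
  assumes \<sigma>: "\<sigma> > 1/2"
  obtains C where "\<And>x y. x > 0 \<Longrightarrow> y > 0 \<Longrightarrow> mehler_potential \<sigma> x y \<le> ennreal C"
proof -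
  define g where "g t = (if t \<le> 1 then t powr (\<sigma> - 3/2) else 0)" for t :: real
  have [measurable]: "g \<in> borel_measurable borel" unfolding g_def by measurable
  have "(\<integral>\<^sup>+t. ennreal (g t) \<partial>lborel_pos) \<le> (\<integral>\<^sup>+t. ennreal (power_profile (3/2 - \<sigma>) 2 t) \<partial>lborel_pos)"
    by (intro nn_integral_mono ennreal_leI) (auto simp: g_def power_profile_def)
  also have "\<dots> < \<infinity>" using \<sigma> by (intro nn_integral_power_profile_finite) auto
  finally obtain J where J: "(\<integral>\<^sup>+t. ennreal (g t) \<partial>lborel_pos) = ennreal J" "J \<ge> 0" 
    by (cases "\<integral>\<^sup>+t. ennreal (g t) \<partial>lborel_pos") auto
  define I where "I = enn2real (\<integral>\<^sup>+t. ennreal (t powr (\<sigma> - 1) * exp (- 1 * t)) \<partial>lborel_pos)"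
  have I: "(\<integral>\<^sup>+t. ennreal (t powr (\<sigma> - 1) * exp (- 1 * t)) \<partial>lborel_pos) = ennreal I" "I \<ge> 0"
    unfolding I_def using nn_integral_gamma_finite[of \<sigma> 1] \<sigma> by auto
  show ?thesis
  proof (rule that[of "J + 2 * I"])
    fix x y :: real assume xy: "x > 0" "y > 0"
    have "mehler_potential \<sigma> x y \<le> ennreal 1 * (\<integral>\<^sup>+t. ennreal (g t) \<partial>lborel_pos)
       + ennreal 2 * (\<integral>\<^sup>+t. ennreal (t powr (\<sigma> - 1) * exp (- 1 * t)) \<partial>lborel_pos)"
      unfolding mehler_potential_def
    proof (rule nn_integral_split_at_1_le)
      fix t :: real assume t: "0 < t" "t \<le> 1"
      have "exp (- (1/8) * (t * x\<^sup>2)) \<le> 1" "exp (- (1/4) * ((x - y)\<^sup>2 / t)) \<le> 1" using t by auto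
      then have "t powr (- 1/2) * exp (- (1/8) * (t * x\<^sup>2)) * exp (- (1/4) * ((x - y)\<^sup>2 / t)) \<le> t powr (- 1/2) * 1 * 1"
        by (intro mult_mono) auto
      then have "mehler t x y \<le> t powr (- 1/2)" using mehler_small_time_le[OF t xy] by linarith
      then have "mehler t x y * t powr (\<sigma> - 1) \<le> t powr (- 1/2) * t powr (\<sigma> - 1)" by (intro mult_right_mono) auto
      also have "\<dots> = t powr (\<sigma> - 3/2)" unfolding powr_add[symmetric] by (rule arg_cong[of _ _ "\<lambda>a. t powr a"]) simp
      finally show "mehler t x y * t powr (\<sigma> - 1) \<le> 1 * g t" using t by (simp add: g_def)
    next
      fix t :: real assume t: "t > 1"
      have "exp (- (1/16) * x\<^sup>2) \<le> 1" "exp (- (1/16) * (x - y)\<^sup>2) \<le> 1" by auto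
      then have "2 * exp (- 1 * t) * (exp (- (1/16) * x\<^sup>2) * exp (- (1/16) * (x - y)\<^sup>2)) \<le> 2 * exp (- 1 * t) * (1 * 1)"
        by (intro mult_left_mono mult_mono) auto
      then have "mehler t x y \<le> 2 * exp (- 1 * t)" using mehler_large_time_le[of t x y] t xy by linarith
      then have "mehler t x y * t powr (\<sigma> - 1) \<le> 2 * exp (- 1 * t) * t powr (\<sigma> - 1)" by (intro mult_right_mono) auto
      then show "mehler t x y * t powr (\<sigma> - 1) \<le> 2 * (t powr (\<sigma> - 1) * exp (- 1 * t))" by (simp only: mult_ac)
    qed (auto simp: g_def)
    then show "mehler_potential \<sigma> x y \<le> ennreal (J + 2 * I)" using J I by (simp add: ennreal_mult)
  qed
qed

text \<open>
  As for Mehler's kernel, but with the exponent $\gamma - 1/2$ of $\sinh 2t$ and with $x^2+y^2$, which is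
  comparable to $(x+y)^2$, in place of $(x-y)^2$. Half of the Gaussian is kept for the decay.
\<close>

lemma corner_potential_le_homogeneous:
  assumes \<gamma>: "0 < \<gamma>" and s: "0 < s" "s \<le> 2 * \<sigma>" "s + 2 * \<gamma> < 1"
  obtains C where "\<And>x y. x > 0 \<Longrightarrow> y > 0 \<Longrightarrow>
    corner_potential \<gamma> \<sigma> x y \<le> ennreal C * (ennreal ((x * y) powr (- \<gamma>) * (x + y) powr (s + 2 * \<gamma> - 1)) * ennreal (1 / (1 + \<bar>x\<bar>)\<^sup>2 * (1 / (1 + \<bar>y\<bar>)\<^sup>2)))"
proof -
  have \<sigma>: "\<sigma> > 0" using s by simp
  define \<kappa> where "\<kappa> = (1 - s - 2 * \<gamma>) / 2"
  have \<kappa>: "\<kappa> > 0" "- 2 * \<kappa> = s + 2 * \<gamma> - 1" using s by (auto simp: \<kappa>_def)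
  obtain A where A0: "A > 0" "\<And>t x :: real. 0 < t \<Longrightarrow> t \<le> 1 \<Longrightarrow> 0 < x \<Longrightarrow> exp (- (1/4) * (t * x\<^sup>2)) \<le> A * (t powr (- (2 / 2)) * (1 + x) powr (- 2))"
    using gaussian_le_decay[of 2 "1/4"] by auto
  have A: "A > 0" "\<And>x. 0 < x \<Longrightarrow> exp (- (1/4) * x\<^sup>2) \<le> A * (1 + x) powr (- 2)"
    using A0(1) A0(2)[of 1] by simp_all
  obtain E where E: "E > 0" "\<And>d. d > 0 \<Longrightarrow> (\<integral>\<^sup>+t. ennreal (t powr (- 1 - \<kappa>) * exp (- (1/16) * (d\<^sup>2 / t))) \<partial>lborel_pos) \<le> ennreal (E * d powr (- 2 * \<kappa>))"
    using gaussian_singular_integral_le[OF \<kappa>(1), of "1/16"] by auto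
  obtain B where B: "B > 0" "\<And>v. v > 0 \<Longrightarrow> exp (- (1/8) * v) \<le> B * v powr (- \<kappa>)"
    using exp_minus_le_powr[of \<kappa> "1/8"] \<kappa> by auto
  define e where "e = 1/2 - \<gamma>"
  have e: "e > 0" using s by (simp add: e_def)
  define I where "I = enn2real (\<integral>\<^sup>+t. ennreal (t powr (\<sigma> - 1) * exp (- (2 * e) * t)) \<partial>lborel_pos)"
  have I: "(\<integral>\<^sup>+t. ennreal (t powr (\<sigma> - 1) * exp (- (2 * e) * t)) \<partial>lborel_pos) = ennreal I" "I \<ge> 0"
    unfolding I_def using nn_integral_gamma_finite[OF \<sigma>, of "2 * e"] e by auto
  show ?thesis
  proof (rule that[of "A * A * E + A * A * B * 4 powr e * I"])
    fix x y :: real assume xy: "x > 0" "y > 0"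
    define Z where "Z = (x * y) powr (- \<gamma>)"
    define W where "W = (1 + x) powr (- 2) * (1 + y) powr (- 2)"
    define d where "d = x + y"
    have d: "d > 0" "d\<^sup>2 \<le> 2 * (x\<^sup>2 + y\<^sup>2)" using xy zero_le_power2[of "x - y"] by (auto simp: d_def power2_eq_square algebra_simps)
    have ZW: "Z \<ge> 0" "W \<ge> 0" by (auto simp: Z_def W_def)
    have decay: "exp (- (1/4) * (x\<^sup>2 + y\<^sup>2)) \<le> A * A * W"
    proof -
      have "exp (- (1/4) * (x\<^sup>2 + y\<^sup>2)) = exp (- (1/4) * x\<^sup>2) * exp (- (1/4) * y\<^sup>2)" by (simp add: algebra_simps flip: exp_add)
      also have "\<dots> \<le> (A * (1 + x) powr (- 2)) * (A * (1 + y) powr (- 2))" using A xy by (intro mult_mono A(2)) auto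
      finally show ?thesis by (simp add: W_def mult_ac)
    qed
    have small: "corner \<gamma> t x y * t powr (\<sigma> - 1) \<le> A * A * W * Z * (t powr (- 1 - \<kappa>) * exp (- (1/16) * (d\<^sup>2 / t)))"
      if t: "0 < t" "t \<le> 1" for t
    proof -
      have "exp (- (1/2) * coth (2 * t) * (x\<^sup>2 + y\<^sup>2)) \<le> exp (- (1/4) * (x\<^sup>2 + y\<^sup>2)) * exp (- (1/16) * (d\<^sup>2 / t))"
      proof -
        have "1 * (x\<^sup>2 + y\<^sup>2) \<le> coth (2 * t) * (x\<^sup>2 + y\<^sup>2)" using t by (intro mult_right_mono coth_ge_1) auto
        moreover have "1 / (2 * t) * (x\<^sup>2 + y\<^sup>2) \<le> coth (2 * t) * (x\<^sup>2 + y\<^sup>2)" using t by (intro mult_right_mono coth_ge_inverse) auto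
        moreover have "1 / (2 * t) * (d\<^sup>2 / 2) \<le> 1 / (2 * t) * (x\<^sup>2 + y\<^sup>2)" using t d by (intro mult_left_mono) auto
        moreover have "1 / (2 * t) * (d\<^sup>2 / 2) = 1/4 * (d\<^sup>2 / t)" by simp
        ultimately have "- (1/2) * (coth (2 * t) * (x\<^sup>2 + y\<^sup>2)) \<le> - (1/4) * (x\<^sup>2 + y\<^sup>2) + - (1/16) * (d\<^sup>2 / t)"
          by linarith
        then show ?thesis unfolding exp_add[symmetric] by (subst exp_le_cancel_iff) (simp only: mult.assoc)
      qed
      also have "\<dots> \<le> A * A * W * exp (- (1/16) * (d\<^sup>2 / t))" by (intro mult_right_mono decay) auto
      finally have ex: "exp (- (1/2) * coth (2 * t) * (x\<^sup>2 + y\<^sup>2)) \<le> A * A * W * exp (- (1/16) * (d\<^sup>2 / t))" .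
      have sh: "sinh (2 * t) powr (\<gamma> - 1/2) \<le> t powr (- e)" using sinh_double_powr_le(1)[OF e t(1)] by (simp add: e_def)
      have p: "t powr (- e) * t powr (\<sigma> - 1) \<le> t powr (- 1 - \<kappa>)"
        unfolding powr_add[symmetric] using t s by (intro powr_mono') (auto simp: \<kappa>_def e_def field_simps)
      have "corner \<gamma> t x y * t powr (\<sigma> - 1) \<le> (Z * t powr (- e) * (A * A * W * exp (- (1/16) * (d\<^sup>2 / t)))) * t powr (\<sigma> - 1)"
        unfolding corner_def Z_def[symmetric] using ZW by (intro mult_right_mono mult_mono sh ex) auto
      also have "\<dots> = A * A * W * Z * ((t powr (- e) * t powr (\<sigma> - 1)) * exp (- (1/16) * (d\<^sup>2 / t)))" by (simp only: mult_ac)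
      also have "\<dots> \<le> A * A * W * Z * (t powr (- 1 - \<kappa>) * exp (- (1/16) * (d\<^sup>2 / t)))"
        using A(1) ZW by (intro mult_left_mono mult_right_mono p) auto
      finally show ?thesis .
    qed
    have dk: "(d\<^sup>2) powr (- \<kappa>) = d powr (- 2 * \<kappa>)"
    proof -
      have "d\<^sup>2 = d powr 2" using d by simp
      then show ?thesis by (simp add: powr_powr)
    qed
    have large: "corner \<gamma> t x y * t powr (\<sigma> - 1) \<le> A * A * W * Z * (B * d powr (- 2 * \<kappa>)) * 4 powr e * (t powr (\<sigma> - 1) * exp (- (2 * e) * t))" if t: "t > 1" for t
    proof -
      have "exp (- (1/2) * coth (2 * t) * (x\<^sup>2 + y\<^sup>2)) \<le> exp (- (1/4) * (x\<^sup>2 + y\<^sup>2)) * exp (- (1/8) * d\<^sup>2)"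
      proof -
        have "1 * (x\<^sup>2 + y\<^sup>2) \<le> coth (2 * t) * (x\<^sup>2 + y\<^sup>2)" using t by (intro mult_right_mono coth_ge_1) auto
        then have "- (1/2) * (coth (2 * t) * (x\<^sup>2 + y\<^sup>2)) \<le> - (1/4) * (x\<^sup>2 + y\<^sup>2) + - (1/8) * d\<^sup>2" using d(2) by linarith
        then show ?thesis unfolding exp_add[symmetric] by (subst exp_le_cancel_iff) (simp only: mult.assoc)
      qed
      also have "\<dots> \<le> A * A * W * (B * d powr (- 2 * \<kappa>))"
        unfolding dk[symmetric] using A(1) ZW d by (intro mult_mono decay B(2)) auto
      finally have ex: "exp (- (1/2) * coth (2 * t) * (x\<^sup>2 + y\<^sup>2)) \<le> A * A * W * (B * d powr (- 2 * \<kappa>))" .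
      have sh: "sinh (2 * t) powr (\<gamma> - 1/2) \<le> 4 powr e * exp (- (2 * e) * t)" using sinh_double_powr_le(2)[OF e, of t] t by (simp add: e_def)
      have "corner \<gamma> t x y * t powr (\<sigma> - 1) \<le> (Z * (4 powr e * exp (- (2 * e) * t)) * (A * A * W * (B * d powr (- 2 * \<kappa>)))) * t powr (\<sigma> - 1)"
        unfolding corner_def Z_def[symmetric] using ZW by (intro mult_right_mono mult_mono sh ex) auto
      then show ?thesis by (simp only: mult_ac)
    qed
    have "corner_potential \<gamma> \<sigma> x y \<le> ennreal (A * A * W * Z) * (\<integral>\<^sup>+t. ennreal (t powr (- 1 - \<kappa>) * exp (- (1/16) * (d\<^sup>2 / t))) \<partial>lborel_pos)
       + ennreal (A * A * W * Z * (B * d powr (- 2 * \<kappa>)) * 4 powr e) * (\<integral>\<^sup>+t. ennreal (t powr (\<sigma> - 1) * exp (- (2 * e) * t)) \<partial>lborel_pos)"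
      unfolding corner_potential_def using A(1) B(1) ZW by (intro nn_integral_split_at_1_le small large) (auto simp: mult_nonneg_nonneg)
    also have "\<dots> \<le> ennreal (A * A * W * Z) * ennreal (E * d powr (- 2 * \<kappa>)) + ennreal (A * A * W * Z * (B * d powr (- 2 * \<kappa>)) * 4 powr e) * ennreal I"
      unfolding I(1) using d by (intro add_mono mult_left_mono E(2)) auto
    also have "\<dots> = ennreal (A * A * W * Z * (E * d powr (- 2 * \<kappa>)) + A * A * W * Z * (B * d powr (- 2 * \<kappa>)) * 4 powr e * I)"
      using A(1) B(1) ZW E(1) I(2) by (simp add: ennreal_mult[symmetric] ennreal_plus[symmetric] del: ennreal_plus)
    also have "A * A * W * Z * (E * d powr (- 2 * \<kappa>)) + A * A * W * Z * (B * d powr (- 2 * \<kappa>)) * 4 powr e * I = (A * A * E + A * A * B * 4 powr e * I) * (Z * d powr (- 2 * \<kappa>) * W)"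
      by (simp add: algebra_simps)
    also have "ennreal \<dots> = ennreal (A * A * E + A * A * B * 4 powr e * I) * (ennreal (Z * d powr (- 2 * \<kappa>)) * ennreal W)"
      using ZW by (simp only: ennreal_mult'' mult_nonneg_nonneg powr_ge_zero)
    also have "W = 1 / (1 + \<bar>x\<bar>)\<^sup>2 * (1 / (1 + \<bar>y\<bar>)\<^sup>2)"
      using xy by (simp add: W_def powr_minus_divide)
    finally show "corner_potential \<gamma> \<sigma> x y \<le> ennreal (A * A * E + A * A * B * 4 powr e * I) * (ennreal ((x * y) powr (- \<gamma>) * (x + y) powr (s + 2 * \<gamma> - 1)) * ennreal (1 / (1 + \<bar>x\<bar>)\<^sup>2 * (1 / (1 + \<bar>y\<bar>)\<^sup>2)))"
      unfolding Z_def d_def \<kappa>(2) .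
  qed
qed

section \<open>Sufficiency\<close>

text \<open>
  The conditions on $(P,Q)$ fall into four cases: off the critical line, where a little less than the
  full order $2\sigma$ is enough and Young's inequality applies; the corner $P = 1$, $Q = 0$, where the
  kernel is bounded; the critical line without its endpoints; and $P < Q$, where the decay
  of the kernel is used.
\<close>

lemma bilinear_bounded_mehler_potential:
  assumes \<sigma>: "\<sigma> > 0" and PQ: "0 \<le> P" "P \<le> 1" "0 \<le> Q" "Q \<le> 1"
    and cond: "P - 2 * \<sigma> \<le> Q" "Q < P + 2 * \<sigma>" 
    and ends: "\<not> (P = 2 * \<sigma> \<and> Q = 0)" "\<not> (P = 1 \<and> Q = 1 - 2 * \<sigma>)"
  shows "bilinear_bounded (mehler_potential \<sigma>) P Q"
proof -
  consider (young) "Q \<le> P" "P - Q < 2 * \<sigma>" "P - Q < 1" | (extreme) "P = 1" "Q = 0" "2 * \<sigma> > 1"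
    | (critical) "P - Q = 2 * \<sigma>" | (decay) "P < Q"
    using cond PQ by linarith
  then show ?thesis
  proof cases
    case young
    \<comment> \<open>an order strictly between \<open>P - Q\<close> and \<open>min 1 (2 * \<sigma>)\<close>\<close>
    define s where "s = (P - Q + min 1 (2 * \<sigma>)) / 2"
    have s: "0 < s" "s < 1" "s + 0 \<le> 2 * \<sigma>" "P - Q < s"
      using young \<sigma> by (auto simp: s_def min_def field_simps)
    obtain C where C: "\<And>x y. x > 0 \<Longrightarrow> y > 0 \<Longrightarrow> x \<noteq> y \<Longrightarrow>
        mehler_potential \<sigma> x y \<le> ennreal C * ennreal ((1 + \<bar>x\<bar>) powr (- 0) * power_profile (1 - s) 2 \<bar>x - y\<bar>)"
      using mehler_potential_le_profile[OF s(1,2) order_refl s(3)] by blast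
    define r where "r = 1 / (1 - (P - Q))"
    have r: "(1 - s) * r < 1" "2 * r > 1" using young s by (auto simp: r_def field_simps)
    have "bilinear_bounded (\<lambda>x y. ennreal (power_profile (1 - s) 2 \<bar>x - y\<bar>)) P Q"
      using young PQ nn_integral_power_profile_finite[OF r]
      by (intro bilinear_bounded_young) (auto simp: power_profile_powr r_def)
    then show ?thesis
    proof (rule bilinear_bounded_mono[where c = C])
      fix x y :: real assume xy: "x > 0" "y > 0" "x \<noteq> y"
      show "mehler_potential \<sigma> x y \<le> ennreal C * ennreal (power_profile (1 - s) 2 \<bar>x - y\<bar>)"
        using C[OF xy] xy by simp
    qed measurable
  next
    case extreme
    obtain C where C: "\<And>x y. x > 0 \<Longrightarrow> y > 0 \<Longrightarrow> mehler_potential \<sigma> x y \<le> ennreal C"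
      using mehler_potential_bounded[of \<sigma>] extreme by auto
    show ?thesis unfolding extreme(1,2)
      by (rule bilinear_bounded_mono[OF bilinear_bounded_const[of C], where c = 1]) (auto intro: C)
  next
    case critical
    define s where "s = 2 * \<sigma>"
    have QP: "Q > 0" "P < 1" using critical ends PQ by (auto simp: less_le)
    then have s: "0 < s" "s < 1" "s + 0 \<le> 2 * \<sigma>" "s = P - Q" using critical \<sigma> PQ by (auto simp: s_def)
    obtain C where C: "\<And>x y. x > 0 \<Longrightarrow> y > 0 \<Longrightarrow> x \<noteq> y \<Longrightarrow>
        mehler_potential \<sigma> x y \<le> ennreal C * ennreal ((1 + \<bar>x\<bar>) powr (- 0) * power_profile (1 - s) 2 \<bar>x - y\<bar>)"
      using mehler_potential_le_profile[OF s(1,2) order_refl s(3)] by blast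
    show ?thesis
    proof (rule bilinear_bounded_mono[OF bilinear_bounded_riesz[OF s(4,1) QP], where c = C])
      fix x y :: real assume xy: "x > 0" "y > 0" "x \<noteq> y"
      have "mehler_potential \<sigma> x y \<le> ennreal C * ennreal (power_profile (1 - s) 2 \<bar>x - y\<bar>)" 
        using C[OF xy] xy by simp
      also have "\<dots> \<le> ennreal C * ennreal (\<bar>x - y\<bar> powr (s - 1))"
        using xy s by (intro mult_left_mono ennreal_leI) (auto simp: power_profile_def intro!: powr_mono)
      finally show "mehler_potential \<sigma> x y \<le> ennreal C * ennreal (\<bar>x - y\<bar> powr (s - 1))" .
    qed measurable
  next
    case decay
    \<comment> \<open>The decay \<open>\<beta>\<close> must exceed \<open>Q - P\<close> for the weight to be integrable, and leave some
      positive order \<open>s\<close> for the diagonal.\<close>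
    define \<beta> where "\<beta> = (Q - P + 2 * \<sigma>) / 2"
    define s where "s = min (1/2) (2 * \<sigma> - \<beta>)"
    have \<beta>: "\<beta> > Q - P" "\<beta> < 2 * \<sigma>" "\<beta> \<ge> 0" using decay cond \<sigma> by (auto simp: \<beta>_def field_simps)
    have s: "0 < s" "s < 1" "s + \<beta> \<le> 2 * \<sigma>" using \<beta> by (auto simp: s_def min_def)
    obtain C where C: "\<And>x y. x > 0 \<Longrightarrow> y > 0 \<Longrightarrow> x \<noteq> y \<Longrightarrow>
        mehler_potential \<sigma> x y \<le> ennreal C * ennreal ((1 + \<bar>x\<bar>) powr (- \<beta>) * power_profile (1 - s) 2 \<bar>x - y\<bar>)"
      using mehler_potential_le_profile[OF s(1,2) \<beta>(3) s(3)] by blast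
    have "bilinear_bounded (\<lambda>x y. ennreal ((1 + \<bar>x\<bar>) powr (- \<beta>) * power_profile (1 - s) 2 \<bar>x - y\<bar>)) P Q"
    proof (rule bilinear_bounded_weighted_convolution)
      show "(\<integral>\<^sup>+u. ennreal (power_profile (1 - s) 2 u) \<partial>lborel_pos) < \<infinity>" using s by (intro nn_integral_power_profile_finite) auto
      define b where "b = \<beta> / (Q - P)"
      have b: "b > 1" using \<beta> decay by (simp add: b_def)
      have "(\<integral>\<^sup>+x. ennreal (((1 + \<bar>x\<bar>) powr (- \<beta>)) powr (1 / (Q - P))) \<partial>lborel_pos) \<le> (\<integral>\<^sup>+x. ennreal (power_profile 0 b x) \<partial>lborel_pos)"
      proof (intro nn_integral_mono ennreal_leI)
        fix x :: real assume "x \<in> space lborel_pos"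
        then have x: "x > 0" by simp
        have e: "((1 + \<bar>x\<bar>) powr (- \<beta>)) powr (1 / (Q - P)) = (1 + x) powr (- b)" using x by (simp add: powr_powr b_def)
        have "(1 + x) powr (- b) \<le> 1 powr (- b)" "(1 + x) powr (- b) \<le> x powr (- b)"
          using x b by (intro powr_mono2'; simp)+
        then show "((1 + \<bar>x\<bar>) powr (- \<beta>)) powr (1 / (Q - P)) \<le> power_profile 0 b x"
          unfolding e power_profile_def using x by auto
      qed
      also have "\<dots> < \<infinity>" using b by (intro nn_integral_power_profile_finite) auto
      finally show "(\<integral>\<^sup>+x. ennreal (((1 + \<bar>x\<bar>) powr (- \<beta>)) powr (1 / (Q - P))) \<partial>lborel_pos) < \<infinity>" .
    qed (use decay PQ in auto)
    then show ?thesis by (rule bilinear_bounded_mono) (use C in auto)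
  qed
qed

text \<open>
  The piece near the origin decays rapidly, so it suffices to find $P_1 \ge P$ and $Q_1 \le Q$
  with $0 < P_1 - Q_1 \le 2\sigma$ that satisfy the same strict inequalities; for these the homogeneous
  kernel of the critical order $s = P_1 - Q_1$ is bounded.
\<close>

lemma bilinear_bounded_corner_potential:
  assumes \<sigma>: "\<sigma> > 0" and PQ: "0 \<le> P" "Q \<le> 1" and \<gamma>: "0 < \<gamma>" "\<gamma> < 1/2" "\<gamma> < Q" "P < 1 - \<gamma>"
    and cond: "P - Q \<le> 2 * \<sigma>"
  shows "bilinear_bounded (corner_potential \<gamma> \<sigma>) P Q"
proof -
  obtain P1 Q1 where 1: "P \<le> P1" "P1 < 1 - \<gamma>" "\<gamma> < Q1" "Q1 \<le> Q" "0 < P1 - Q1" "P1 - Q1 \<le> 2 * \<sigma>"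
  proof (cases "P > Q")
    case True
    then show ?thesis using that[of P Q] \<gamma> cond by auto
  next
    case False
    \<comment> \<open>a point of the interval between \<open>\<gamma>\<close> and \<open>1 - \<gamma>\<close> that lies in \<open>{P..Q}\<close>, to be moved
      slightly off the diagonal\<close>
    define Q1 where "Q1 = (if P > \<gamma> then P else min Q (1/2))"
    define \<epsilon> where "\<epsilon> = min (2 * \<sigma>) ((1 - \<gamma> - Q1) / 2)"
    have Q1: "\<gamma> < Q1" "Q1 \<le> Q" "P \<le> Q1" "Q1 < 1 - \<gamma>" using False \<gamma> by (auto simp: Q1_def min_def)
    have "0 < \<epsilon>" "\<epsilon> \<le> 2 * \<sigma>" "Q1 + \<epsilon> < 1 - \<gamma>" using Q1 \<sigma> by (auto simp: \<epsilon>_def min_def field_simps)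
    then show ?thesis using that[of "Q1 + \<epsilon>" Q1] Q1 by auto
  qed
  define s where "s = P1 - Q1"
  have s: "0 < s" "s \<le> 2 * \<sigma>" "s + 2 * \<gamma> < 1" using 1 by (auto simp: s_def)
  obtain C where C: "\<And>x y. x > 0 \<Longrightarrow> y > 0 \<Longrightarrow>
    corner_potential \<gamma> \<sigma> x y \<le> ennreal C * (ennreal ((x * y) powr (- \<gamma>) * (x + y) powr (s + 2 * \<gamma> - 1)) * ennreal (1 / (1 + \<bar>x\<bar>)\<^sup>2 * (1 / (1 + \<bar>y\<bar>)\<^sup>2)))"
    using corner_potential_le_homogeneous[OF \<gamma>(1) s] by blast
  have "bilinear_bounded (\<lambda>x y. ennreal ((x * y) powr (- \<gamma>) * (x + y) powr (s + 2 * \<gamma> - 1)) * ennreal (1 / (1 + \<bar>x\<bar>)\<^sup>2 * (1 / (1 + \<bar>y\<bar>)\<^sup>2))) P Q"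
  proof (rule bilinear_bounded_localized)
    show "bilinear_bounded (\<lambda>x y. ennreal ((x * y) powr (- \<gamma>) * (x + y) powr (s + 2 * \<gamma> - 1))) P1 Q1"
      using 1 \<gamma> s by (intro bilinear_bounded_homogeneous) (auto simp: s_def)
  qed (use 1 PQ \<gamma> in auto)
  then show ?thesis by (rule bilinear_bounded_mono) (use C in auto)
qed

lemma mehler_potential_measurable [measurable]:
  "case_prod (mehler_potential \<sigma>) \<in> borel_measurable (borel \<Otimes>\<^sub>M borel)"
proof -
  have [measurable]: "case_prod (\<lambda>z t. ennreal (mehler t (fst z) (snd z) * t powr (\<sigma> - 1)) * indicator {0<..} t)
     \<in> borel_measurable ((borel \<Otimes>\<^sub>M borel) \<Otimes>\<^sub>M lborel)"
    unfolding mehler_def by measurable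
  have "(\<lambda>z. (\<integral>\<^sup>+t. ennreal (mehler t (fst z) (snd z) * t powr (\<sigma> - 1)) * indicator {0<..} t \<partial>lborel))
     \<in> borel_measurable (borel \<Otimes>\<^sub>M borel)"
    by measurable
  then show ?thesis
    unfolding mehler_potential_def nn_integral_lborel_pos by (simp add: case_prod_unfold)
qed

lemma corner_potential_measurable [measurable]:
  "case_prod (corner_potential \<gamma> \<sigma>) \<in> borel_measurable (borel \<Otimes>\<^sub>M borel)"
proof -
  have [measurable]: "case_prod (\<lambda>z t. ennreal (corner \<gamma> t (fst z) (snd z) * t powr (\<sigma> - 1)) * indicator {0<..} t)
     \<in> borel_measurable ((borel \<Otimes>\<^sub>M borel) \<Otimes>\<^sub>M lborel)"
    unfolding corner_def by measurable
  have "(\<lambda>z. (\<integral>\<^sup>+t. ennreal (corner \<gamma> t (fst z) (snd z) * t powr (\<sigma> - 1)) * indicator {0<..} t \<partial>lborel))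
     \<in> borel_measurable (borel \<Otimes>\<^sub>M borel)"
    by measurable
  then show ?thesis
    unfolding corner_potential_def nn_integral_lborel_pos by (simp add: case_prod_unfold)
qed

lemma bilinear_bounded_imp_potential_H_bounded:
  assumes "1 \<le> p" "1 / p = ereal P" "1 \<le> q" "1 / q = ereal Q" "bilinear_bounded (potential_kernel_H \<alpha> \<sigma>) P Q"
  shows "potential_H_bounded \<alpha> \<sigma> p q"
proof -
  obtain B where "bilinear_bound (potential_kernel_H \<alpha> \<sigma>) P Q B" using assms(5) by (auto simp: bilinear_bounded_def)
  from bilinear_bound_imp_Lp_Lq_bounded[OF potential_kernel_H_measurable assms(1-4) this]
  show ?thesis unfolding potential_domain_H_def potential_H_def[abs_def] .
qed

lemma potential_H_bounded_regular:
  assumes \<alpha>: "\<alpha> \<ge> - 1/2" and \<sigma>: "\<sigma> > 0" and p: "1 \<le> p" "1 / p = ereal P" and q: "1 \<le> q" "1 / q = ereal Q"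
    and PQ: "0 \<le> P" "P \<le> 1" "0 \<le> Q" "Q \<le> 1"
    and cond: "P - 2 * \<sigma> \<le> Q" "Q < P + 2 * \<sigma>" 
    and ends: "\<not> (P = 2 * \<sigma> \<and> Q = 0)" "\<not> (P = 1 \<and> Q = 1 - 2 * \<sigma>)"
  shows "potential_H_bounded \<alpha> \<sigma> p q"
proof -
  obtain C where "\<And>x y. x > 0 \<Longrightarrow> y > 0 \<Longrightarrow> potential_kernel_H \<alpha> \<sigma> x y \<le> ennreal C * mehler_potential \<sigma> x y"
    using potential_kernel_H_le_mehler[OF \<alpha>] by blast
  then have "bilinear_bounded (potential_kernel_H \<alpha> \<sigma>) P Q"
    by (intro bilinear_bounded_mono[OF bilinear_bounded_mehler_potential[OF \<sigma> PQ cond ends]] mehler_potential_measurable) auto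
  then show ?thesis by (rule bilinear_bounded_imp_potential_H_bounded[OF p q])
qed

lemma potential_H_bounded_singular:
  assumes \<alpha>: "\<alpha> > - 1" "\<alpha> < - 1/2" and \<sigma>: "\<sigma> > 0" and p: "1 \<le> p" "1 / p = ereal P" and q: "1 \<le> q" "1 / q = ereal Q"
    and PQ: "0 \<le> P" "P < \<alpha> + 3/2" "- \<alpha> - 1/2 < Q" "Q \<le> 1"
    and cond: "P - 2 * \<sigma> \<le> Q" "Q < P + 2 * \<sigma>" 
  shows "potential_H_bounded \<alpha> \<sigma> p q"
proof -
  obtain C where C: "\<And>x y. x > 0 \<Longrightarrow> y > 0 \<Longrightarrow> potential_kernel_H \<alpha> \<sigma> x y \<le> ennreal C * (mehler_potential \<sigma> x y + corner_potential (- \<alpha> - 1/2) \<sigma> x y)"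
    using potential_kernel_H_le_mehler_corner[OF \<alpha>] by blast
  have "bilinear_bounded (mehler_potential \<sigma>) P Q" "bilinear_bounded (corner_potential (- \<alpha> - 1/2) \<sigma>) P Q"
    using assms by (auto intro!: bilinear_bounded_mehler_potential bilinear_bounded_corner_potential)
  then have "bilinear_bounded (\<lambda>x y. mehler_potential \<sigma> x y + corner_potential (- \<alpha> - 1/2) \<sigma> x y) P Q"
    by (intro bilinear_bounded_add mehler_potential_measurable corner_potential_measurable)
  then have "bilinear_bounded (potential_kernel_H \<alpha> \<sigma>) P Q"
    by (rule bilinear_bounded_mono[where c = C]) (use C in auto)
  then show ?thesis by (rule bilinear_bounded_imp_potential_H_bounded[OF p q])
qed

section \<open>Testing boundedness on nonnegative functions\<close>

text \<open>
  Where the integral is finite the kernel is infinite at most on a null set and where \<open>f\<close>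
  vanishes, so its real-valued version gives the same integral.
\<close>

lemma potential_H_nonneg_eq:
  fixes f :: "real \<Rightarrow> real"
  assumes [measurable]: "f \<in> borel_measurable borel" and f: "\<And>y. f y \<ge> 0"
    and fin: "(\<integral>\<^sup>+y. potential_kernel_H \<alpha> \<sigma> x y * ennreal (f y) \<partial>lborel_pos) < \<infinity>"
  shows "ennreal (norm (potential_H \<alpha> \<sigma> (\<lambda>y. complex_of_real (f y)) x)) = (\<integral>\<^sup>+y. potential_kernel_H \<alpha> \<sigma> x y * ennreal (f y) \<partial>lborel_pos)"
proof -
  have kx [measurable]: "potential_kernel_H \<alpha> \<sigma> x \<in> borel_measurable borel"
    by measurable
  define g where "g y = enn2real (potential_kernel_H \<alpha> \<sigma> x y) * f y" for y
  have g [measurable]: "g \<in> borel_measurable borel" unfolding g_def by measurable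
  have g0: "g y \<ge> 0" for y using f by (simp add: g_def)
  have "AE y in lborel_pos. potential_kernel_H \<alpha> \<sigma> x y * ennreal (f y) \<noteq> \<infinity>"
    using fin by (intro nn_integral_PInf_AE borel_imp_lborel_pos) auto
  then have "AE y in lborel_pos. ennreal (g y) = potential_kernel_H \<alpha> \<sigma> x y * ennreal (f y)"
  proof eventually_elim
    case (elim y)
    show ?case
    proof (cases "potential_kernel_H \<alpha> \<sigma> x y")
      case (real r)
      then show ?thesis using f by (simp add: g_def ennreal_mult)
    next
      case top
      then have "f y = 0" using elim f[of y] by (auto simp: ennreal_mult_eq_top_iff ennreal_eq_0_iff ennreal_top_mult split: if_splits)
      then show ?thesis by (simp add: g_def)
    qed
  qed
  then have gi: "(\<integral>\<^sup>+y. ennreal (g y) \<partial>lebesgue_pos) = (\<integral>\<^sup>+y. potential_kernel_H \<alpha> \<sigma> x y * ennreal (f y) \<partial>lborel_pos)"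
    unfolding nn_integral_lebesgue_pos by (rule nn_integral_cong_AE)
  have "potential_H \<alpha> \<sigma> (\<lambda>y. complex_of_real (f y)) x = (LINT y|lebesgue_pos. complex_of_real (g y))"
    unfolding potential_H_def g_def by (simp add: scaleR_conv_of_real)
  also have "\<dots> = complex_of_real (LINT y|lebesgue_pos. g y)" by simp
  also have "(LINT y|lebesgue_pos. g y) = enn2real (\<integral>\<^sup>+y. ennreal (g y) \<partial>lebesgue_pos)"
    by (intro integral_eq_nn_integral borel_imp_lebesgue_pos) (auto simp: g0)
  finally show ?thesis unfolding gi using fin by simp
qed

lemma Lp_norm_mono_AE:
  assumes [measurable]: "f \<in> borel_measurable M" "g \<in> borel_measurable M" and le: "AE x in M. norm (f x) \<le> norm (g x)" and p: "1 \<le> p"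
  shows "Lp_norm M p f \<le> Lp_norm M p g"
  using p
proof (cases rule: ereal_one_over_cases)
  case 1
  then show ?thesis using le unfolding Lp_norm_def by (auto intro!: esssup_AE_mono elim!: eventually_mono ennreal_leI)
next
  case (2 r)
  define J where "J f = (\<integral>\<^sup>+x. ennreal (norm (f x) powr r) \<partial>M)" for f :: "_ \<Rightarrow> complex"
  have "J f \<le> J g" unfolding J_def using 2 le
    by (intro nn_integral_mono_AE) (auto elim!: eventually_mono intro!: ennreal_leI powr_mono2)
  then have "J g = \<infinity> \<or> (J f \<noteq> \<infinity> \<and> enn2real (J f) \<le> enn2real (J g))"
    by (auto simp: top_unique enn2real_mono less_top)
  then show ?thesis using 2 unfolding Lp_norm_def
    by (auto simp: Let_def J_def intro!: ennreal_leI powr_mono2)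
qed

text \<open>
  The consequence of boundedness that the counterexamples contradict: every lower bound \<open>h\<close> for the
  image of a nonnegative function obeys the norm inequality.
\<close>

definition test_inequality :: "real \<Rightarrow> real \<Rightarrow> ereal \<Rightarrow> ereal \<Rightarrow> real \<Rightarrow> bool" where
  "test_inequality \<alpha> \<sigma> p q C \<longleftrightarrow>
     (\<forall>f h A. f \<in> borel_measurable borel \<longrightarrow> h \<in> borel_measurable borel \<longrightarrow> (\<forall>y. 0 \<le> f y) \<longrightarrow> (\<forall>x. 0 \<le> h x) \<longrightarrow>
        Lp_norm lebesgue_pos p (\<lambda>x. complex_of_real (f x)) \<le> ennreal A \<longrightarrow>
        (\<forall>x>0. ennreal (h x) \<le> (\<integral>\<^sup>+y. potential_kernel_H \<alpha> \<sigma> x y * ennreal (f y) \<partial>lborel_pos)) \<longrightarrow>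
        Lp_norm lebesgue_pos q (\<lambda>x. complex_of_real (h x)) \<le> ennreal (C * A))"

lemma test_inequalityD:
  assumes "test_inequality \<alpha> \<sigma> p q C" "f \<in> borel_measurable borel" "h \<in> borel_measurable borel"
    "\<And>y. 0 \<le> f y" "Lp_norm lebesgue_pos p (\<lambda>x. complex_of_real (f x)) \<le> ennreal A" "\<And>x. 0 \<le> h x"
    "\<And>x. x > 0 \<Longrightarrow> ennreal (h x) \<le> (\<integral>\<^sup>+y. potential_kernel_H \<alpha> \<sigma> x y * ennreal (f y) \<partial>lborel_pos)"
  shows "Lp_norm lebesgue_pos q (\<lambda>x. complex_of_real (h x)) \<le> ennreal (C * A)"
  using assms unfolding test_inequality_def by blast

lemma potential_H_bounded_imp_test_inequality:
  assumes b: "potential_H_bounded \<alpha> \<sigma> p q" and q: "1 \<le> q"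
  obtains C where "C \<ge> 0" "test_inequality \<alpha> \<sigma> p q C"
proof -
  obtain C where C: "C \<ge> 0" "\<And>f. f \<in> Lp_space lebesgue_pos p \<Longrightarrow> potential_H \<alpha> \<sigma> f \<in> Lp_space lebesgue_pos q \<and> Lp_norm lebesgue_pos q (potential_H \<alpha> \<sigma> f) \<le> ennreal C * Lp_norm lebesgue_pos p f"
    and dom: "Lp_space lebesgue_pos p \<subseteq> potential_domain_H \<alpha> \<sigma>"
    using b unfolding Lp_Lq_bounded_def by auto
  show ?thesis
  proof (rule that[OF C(1)], unfold test_inequality_def, intro allI impI)
    fix f h :: "real \<Rightarrow> real" and A
    assume fm [measurable]: "f \<in> borel_measurable borel" and hm [measurable]: "h \<in> borel_measurable borel" and f': "\<forall>y. 0 \<le> f y" and h': "\<forall>x. 0 \<le> h x"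
      and fA: "Lp_norm lebesgue_pos p (\<lambda>x. complex_of_real (f x)) \<le> ennreal A"
      and le': "\<forall>x>0. ennreal (h x) \<le> (\<integral>\<^sup>+y. potential_kernel_H \<alpha> \<sigma> x y * ennreal (f y) \<partial>lborel_pos)"
    have f: "\<And>y. 0 \<le> f y" and h: "\<And>x. 0 \<le> h x"
      and le: "\<And>x. x > 0 \<Longrightarrow> ennreal (h x) \<le> (\<integral>\<^sup>+y. potential_kernel_H \<alpha> \<sigma> x y * ennreal (f y) \<partial>lborel_pos)"
      using f' h' le' by auto
    define F where "F x = complex_of_real (f x)" for x
    have Fm: "F \<in> borel_measurable lebesgue_pos" unfolding F_def by (intro borel_imp_lebesgue_pos) measurable
    have FL: "F \<in> Lp_space lebesgue_pos p" using Fm fA unfolding Lp_space_def F_def[abs_def] by (auto intro: le_less_trans)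
    have "AE x in lebesgue_pos. (\<integral>\<^sup>+y. potential_kernel_H \<alpha> \<sigma> x y * ennreal (norm (F y)) \<partial>lebesgue_pos) < \<infinity>"
      using dom FL by (auto simp: potential_domain_H_def)
    then have fin: "AE x in lebesgue_pos. (\<integral>\<^sup>+y. potential_kernel_H \<alpha> \<sigma> x y * ennreal (f y) \<partial>lborel_pos) < \<infinity>"
      using f by (simp add: nn_integral_lebesgue_pos F_def)
    have "AE x in lebesgue_pos. norm (complex_of_real (h x)) \<le> norm (potential_H \<alpha> \<sigma> F x)"
      using fin AE_space
    proof eventually_elim
      case (elim x)
      have "ennreal (h x) \<le> ennreal (norm (potential_H \<alpha> \<sigma> F x))"
        unfolding F_def[abs_def] potential_H_nonneg_eq[OF fm f elim(1)] using elim(2) by (intro le) auto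
      then show ?case using h by simp
    qed
    then have "Lp_norm lebesgue_pos q (\<lambda>x. complex_of_real (h x)) \<le> Lp_norm lebesgue_pos q (potential_H \<alpha> \<sigma> F)"
    proof (intro Lp_norm_mono_AE q)
      show "(\<lambda>x. complex_of_real (h x)) \<in> borel_measurable lebesgue_pos" by (intro borel_imp_lebesgue_pos) measurable
      show "potential_H \<alpha> \<sigma> F \<in> borel_measurable lebesgue_pos" using C(2)[OF FL] by (simp add: Lp_space_def)
    qed
    also have "\<dots> \<le> ennreal C * Lp_norm lebesgue_pos p F" using C(2)[OF FL] by simp
    also have "\<dots> \<le> ennreal C * ennreal A" using fA unfolding F_def[abs_def] by (intro mult_left_mono) auto
    also have "\<dots> = ennreal (C * A)" using C(1) by (simp add: ennreal_mult')
    finally show "Lp_norm lebesgue_pos q (\<lambda>x. complex_of_real (h x)) \<le> ennreal (C * A)" .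
  qed
qed

lemma Lp_norm_indicator:
  assumes p: "1 \<le> p" "1 / p = ereal P" and "a \<ge> 0" "u \<ge> 0" "\<epsilon> > 0"
  shows "Lp_norm lebesgue_pos p (\<lambda>x. complex_of_real (a * indicator {u<..u + \<epsilon>} x)) = ennreal (a * \<epsilon> powr P)"
  using p(1)
proof (cases rule: ereal_one_over_cases)
  case 1
  then have P: "P = 0" using p by simp
  define g where "g x = ennreal (norm (complex_of_real (a * indicator {u<..u + \<epsilon>} x)))" for x
  have [measurable]: "g \<in> borel_measurable lebesgue_pos" unfolding g_def by (intro borel_imp_lebesgue_pos) measurable
  have "esssup lebesgue_pos g = ennreal a"
  proof (rule antisym)
    show "esssup lebesgue_pos g \<le> ennreal a" using assms by (intro esssup_I) (auto simp: g_def indicator_def)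
    have "AE x in lborel_pos. g x \<le> esssup lebesgue_pos g"
      using esssup_AE[of g lebesgue_pos] by (simp add: AE_lebesgue_pos_iff)
    then have ae: "AE x in lborel. x > 0 \<longrightarrow> g x \<le> esssup lebesgue_pos g" by (subst (asm) AE_restrict_space_iff) auto
    show "ennreal a \<le> esssup lebesgue_pos g"
    proof (rule ccontr)
      assume n: "\<not> ennreal a \<le> esssup lebesgue_pos g"
      have "AE x in lborel. x \<notin> {u<..u + \<epsilon>}" using ae
      proof eventually_elim
        case (elim x)
        show ?case
        proof
          assume "x \<in> {u<..u + \<epsilon>}"
          then have "g x = ennreal a" "x > 0" using assms by (auto simp: g_def)
          then show False using elim n by simp
        qed
      qed
      then have "emeasure lborel {u<..u + \<epsilon>} = 0" by (subst (asm) AE_iff_measurable[of "{u<..u + \<epsilon>}"]) auto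
      then show False using assms by (simp add: ennreal_eq_0_iff)
    qed
  qed
  then show ?thesis using 1 P assms unfolding Lp_norm_def g_def by simp
next
  case (2 r)
  then have P: "P = 1 / r" using p by simp
  have "(\<integral>\<^sup>+x. ennreal (norm (complex_of_real (a * indicator {u<..u + \<epsilon>} x)) powr r) \<partial>lebesgue_pos) = (\<integral>\<^sup>+x. ennreal (a powr r) * indicator {u<..u + \<epsilon>} x \<partial>lborel)"
    unfolding nn_integral_lebesgue_pos nn_integral_lborel_pos using assms by (intro nn_integral_cong) (auto split: split_indicator)
  also have "\<dots> = ennreal (a powr r) * ennreal \<epsilon>" using assms by (subst nn_integral_cmult_indicator) auto
  also have "\<dots> = ennreal (a powr r * \<epsilon>)" using assms by (simp add: ennreal_mult)
  finally have J: "(\<integral>\<^sup>+x. ennreal (norm (complex_of_real (a * indicator {u<..u + \<epsilon>} x)) powr r) \<partial>lebesgue_pos) = ennreal (a powr r * \<epsilon>)" .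
  have "(a powr r * \<epsilon>) powr (1 / r) = a * \<epsilon> powr P" using assms 2 by (simp add: powr_mult powr_powr P)
  then show ?thesis using 2 assms J unfolding Lp_norm_def by (simp add: Let_def)
qed

lemma nn_integral_inverse_interval:
  assumes "0 < a" "a \<le> b"
  shows "(\<integral>\<^sup>+x. ennreal (1 / (x - u)) * indicator {u + a..u + b} x \<partial>lborel) = ennreal (ln (b / a))"
proof -
  have "(\<integral>\<^sup>+x. ennreal (1 / (x - u)) * indicator {u + a..u + b} x \<partial>lborel) = ennreal (ln (u + b - u) - ln (u + a - u))"
    using assms by (intro nn_integral_FTC_Icc) (auto intro!: derivative_eq_intros)
  then show ?thesis using assms by (simp add: ln_div)
qed

text \<open>
  The exponent is the one for which the power just fails to be in $L^p$. The norm of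
  the truncation grows like a power of a logarithm, which distinguishes between two values of \<open>p\<close>.
\<close>

lemma Lp_norm_log_power:
  assumes p: "1 \<le> p" "1 / p = ereal P" "P > 0" and "c \<ge> 0" "u \<ge> 0" "0 < a" "a < b"
  shows "Lp_norm lebesgue_pos p (\<lambda>x. complex_of_real (c * (x - u) powr (- P) * indicator {u + a..u + b} x)) = ennreal (c * ln (b / a) powr P)"
  using p(1)
proof (cases rule: ereal_one_over_cases)
  case 1
  then show ?thesis using p by simp
next
  case (2 r)
  then have P: "P = 1 / r" using p by simp
  have "(\<integral>\<^sup>+x. ennreal (norm (complex_of_real (c * (x - u) powr (- P) * indicator {u + a..u + b} x)) powr r) \<partial>lebesgue_pos) 
     = (\<integral>\<^sup>+x. ennreal (c powr r) * (ennreal (1 / (x - u)) * indicator {u + a..u + b} x) \<partial>lborel)"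
    unfolding nn_integral_lebesgue_pos nn_integral_lborel_pos
  proof (intro nn_integral_cong)
    fix x
    show "ennreal (norm (complex_of_real (c * (x - u) powr (- P) * indicator {u + a..u + b} x)) powr r) * indicator {0<..} x = ennreal (c powr r) * (ennreal (1 / (x - u)) * indicator {u + a..u + b} x)"
    proof (cases "x \<in> {u + a..u + b}")
      case True
      then have x: "x > 0" "x - u > 0" using assms by auto
      have "(c * (x - u) powr (- P)) powr r = c powr r * (1 / (x - u))"
        using x 2 unfolding powr_mult powr_powr P by (simp add: powr_minus_divide)
      then show ?thesis using True x assms by (simp add: norm_mult ennreal_mult[symmetric])
    qed auto
  qed
  also have "\<dots> = ennreal (c powr r) * ennreal (ln (b / a))"
    using assms nn_integral_inverse_interval[of a b u] by (subst nn_integral_cmult) auto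
  also have "\<dots> = ennreal (c powr r * ln (b / a))" using assms by (simp add: ennreal_mult)
  finally have J: "(\<integral>\<^sup>+x. ennreal (norm (complex_of_real (c * (x - u) powr (- P) * indicator {u + a..u + b} x)) powr r) \<partial>lebesgue_pos) = ennreal (c powr r * ln (b / a))" .
  have l: "ln (b / a) \<ge> 0" using assms by simp
  have "(c powr r * ln (b / a)) powr (1 / r) = c * ln (b / a) powr P" using assms 2 l by (simp add: powr_mult powr_powr P)
  then show ?thesis using 2 assms l J unfolding Lp_norm_def by (simp add: Let_def)
qed

lemma power_growth_contradiction:
  fixes a b c C L0 :: real
  assumes "a < b" "c > 0" and le: "\<And>L. L > L0 \<Longrightarrow> L > 0 \<Longrightarrow> c * L powr b \<le> C * L powr a"
  shows False
proof -
  define M where "M = max C 0 / c + 1"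
  have M: "M \<ge> 1" using assms by (simp add: M_def)
  define L where "L = max (M powr (1 / (b - a))) (max (L0 + 1) 1)"
  have L: "L > L0" "L > 0" "L \<ge> M powr (1 / (b - a))" by (auto simp: L_def)
  have "M = (M powr (1 / (b - a))) powr (b - a)" using M assms by (simp add: powr_powr)
  also have "\<dots> \<le> L powr (b - a)" using L assms by (intro powr_mono2) auto
  finally have "c * (M * L powr a) \<le> c * (L powr (b - a) * L powr a)" using assms by (intro mult_left_mono mult_right_mono) auto
  also have "\<dots> = c * L powr b" by (simp flip: powr_add)
  also have "\<dots> \<le> C * L powr a" using L by (intro le)
  finally have "(c * M) * L powr a \<le> C * L powr a" by (simp add: mult_ac)
  then have "c * M \<le> C" using L by (simp add: mult_le_cancel_right)
  moreover have "c * M = max C 0 + c" using assms by (simp add: M_def distrib_left)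
  ultimately show False using assms by auto
qed

section \<open>Lower estimates of the potential kernel\<close>

text \<open>
  For $(x-y)^2 \le t \le (x+y)^{-2}$ both Gaussian factors are bounded below, and only the factor
  $t^{-1/2}$ remains.
\<close>

lemma mehler_ge:
  assumes t: "t > 0" and xy: "x \<ge> 1" "y \<ge> 1" and R: "t * (x + y)\<^sup>2 \<le> 1" and D: "(x - y)\<^sup>2 \<le> t"
  shows "sinh (2 * t) \<le> x * y" and "mehler t x y \<ge> exp (- 1) / 2 * t powr (- 1/2)"
proof -
  have "2\<^sup>2 \<le> (x + y)\<^sup>2" using xy by (intro power_mono) auto
  then have "t * 4 \<le> t * (x + y)\<^sup>2" using t by (intro mult_left_mono) auto
  then have t4: "t \<le> 1/4" using R by linarith
  have "sinh (2 * t) \<le> 2 * t * cosh (2 * t)" using sinh_le_self_times_cosh[of "2 * t"] t by simp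
  also have "\<dots> \<le> 2 * t * 2" using t t4 by (intro mult_left_mono cosh_le_2) auto
  finally have S: "sinh (2 * t) \<le> 4 * t" by simp
  have "1 * 1 \<le> x * y" using xy by (intro mult_mono) auto
  then show "sinh (2 * t) \<le> x * y" using S t4 by simp
  have "(4 * t) powr (- 1/2) \<le> sinh (2 * t) powr (- 1/2)" using S t by (intro powr_mono2') auto
  moreover have "(4 * t) powr (- 1/2) = 1/2 * t powr (- 1/2)"
    unfolding powr_mult using powr_minus_divide[of "4::real" "1/2"] by (simp add: powr_half_sqrt)
  ultimately have s: "1/2 * t powr (- 1/2) \<le> sinh (2 * t) powr (- 1/2)" by simp
  have th: "tanh t * (x + y)\<^sup>2 \<le> 1"
  proof -
    have "tanh t \<le> t" using sinh_le_self_times_cosh[of t] t by (simp add: tanh_def field_simps)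
    then have "tanh t * (x + y)\<^sup>2 \<le> t * (x + y)\<^sup>2" by (intro mult_right_mono) auto
    then show ?thesis using R by linarith
  qed
  have co: "coth t * (x - y)\<^sup>2 \<le> 2"
  proof -
    have "cosh t * t \<le> 2 * sinh t" using cosh_le_2[of t] sinh_ge_self[of t] t t4 by (intro mult_mono) auto
    then have "coth t \<le> 2 / t" using t by (simp add: coth_def field_simps)
    then have "coth t * (x - y)\<^sup>2 \<le> 2 / t * t" using D t by (intro mult_mono) auto
    then show ?thesis using t by simp
  qed
  have "exp (- 1) \<le> exp (- (1/4) * (tanh t * (x + y)\<^sup>2) - (1/4) * (coth t * (x - y)\<^sup>2))"
    using th co by (subst exp_le_cancel_iff) linarith
  with s have "(1/2 * t powr (- 1/2)) * exp (- 1) \<le> mehler t x y" unfolding mehler_def by (intro mult_mono) auto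
  then show "mehler t x y \<ge> exp (- 1) / 2 * t powr (- 1/2)" by (simp add: mult_ac)
qed

lemma potential_kernel_H_ge_integral:
  assumes "\<alpha> > -1" "\<sigma> > 0"
  obtains c where "c > 0" "\<And>x y D R. x \<ge> 1 \<Longrightarrow> y \<ge> 1 \<Longrightarrow> 0 < D \<Longrightarrow> (x - y)\<^sup>2 \<le> D \<Longrightarrow> R * (x + y)\<^sup>2 \<le> 1 \<Longrightarrow>
     ennreal c * (\<integral>\<^sup>+t. ennreal (t powr (\<sigma> - 3/2)) * indicator {D..R} t \<partial>lborel) \<le> potential_kernel_H \<alpha> \<sigma> x y"
proof -
  obtain c where c: "c > 0" "\<And>t x y. t > 0 \<Longrightarrow> x > 0 \<Longrightarrow> y > 0 \<Longrightarrow> sinh (2 * t) \<le> x * y \<Longrightarrow> c * mehler t x y \<le> heat_kernel_H \<alpha> t x y"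
    "\<And>t x y. t > 0 \<Longrightarrow> x > 0 \<Longrightarrow> y > 0 \<Longrightarrow> 0 \<le> heat_kernel_H \<alpha> t x y"
    using heat_kernel_H_lower[OF assms(1)] by metis
  have G: "Gamma \<sigma> > 0" using assms by (intro Gamma_real_pos)
  define c' where "c' = c * (exp (- 1) / 2)"
  have c': "c' > 0" using c by (simp add: c'_def)
  show ?thesis
  proof (rule that[of "1 / Gamma \<sigma> * c'"])
    fix x y D R :: real assume xy: "x \<ge> 1" "y \<ge> 1" and D: "0 < D" "(x - y)\<^sup>2 \<le> D" and R: "R * (x + y)\<^sup>2 \<le> 1"
    have "ennreal c' * (\<integral>\<^sup>+t. ennreal (t powr (\<sigma> - 3/2)) * indicator {D..R} t \<partial>lborel) = (\<integral>\<^sup>+t. ennreal c' * (ennreal (t powr (\<sigma> - 3/2)) * indicator {D..R} t) \<partial>lborel)"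
      by (rule nn_integral_cmult[symmetric]) measurable
    also have "\<dots> \<le> (\<integral>\<^sup>+t. ennreal (heat_kernel_H \<alpha> t x y * t powr (\<sigma> - 1)) * indicator {0<..} t \<partial>lborel)"
    proof (rule nn_integral_mono)
      fix t
      show "ennreal c' * (ennreal (t powr (\<sigma> - 3/2)) * indicator {D..R} t) \<le> ennreal (heat_kernel_H \<alpha> t x y * t powr (\<sigma> - 1)) * indicator {0<..} t"
      proof (cases "t \<in> {D..R}")
        case True
        then have t: "t > 0" "(x - y)\<^sup>2 \<le> t" using D by auto
        have "t * (x + y)\<^sup>2 \<le> R * (x + y)\<^sup>2" using True by (intro mult_right_mono) auto
        then have tR: "t * (x + y)\<^sup>2 \<le> 1" using R by linarith
        note m = mehler_ge[OF t(1) xy tR t(2)]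
        have "c * (exp (- 1) / 2 * t powr (- 1/2)) \<le> c * mehler t x y" using c(1) m(2) by (intro mult_left_mono) auto
        also have "\<dots> \<le> heat_kernel_H \<alpha> t x y" using t xy m(1) by (intro c(2)) auto
        finally have "c' * t powr (- 1/2) * t powr (\<sigma> - 1) \<le> heat_kernel_H \<alpha> t x y * t powr (\<sigma> - 1)"
          by (intro mult_right_mono) (auto simp: c'_def mult_ac)
        moreover have "t powr (- 1/2) * t powr (\<sigma> - 1) = t powr (\<sigma> - 3/2)" unfolding powr_add[symmetric] by (rule arg_cong[of _ _ "\<lambda>a. t powr a"]) simp
        ultimately have "c' * t powr (\<sigma> - 3/2) \<le> heat_kernel_H \<alpha> t x y * t powr (\<sigma> - 1)" by (simp add: mult.assoc)
        then show ?thesis using True t c' by (simp add: ennreal_mult[symmetric] ennreal_leI)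
      qed auto
    qed
    finally have "ennreal (1 / Gamma \<sigma>) * (ennreal c' * (\<integral>\<^sup>+t. ennreal (t powr (\<sigma> - 3/2)) * indicator {D..R} t \<partial>lborel)) \<le> potential_kernel_H \<alpha> \<sigma> x y"
      unfolding potential_kernel_H_eq nn_integral_lborel_pos by (intro mult_left_mono) auto
    then show "ennreal (1 / Gamma \<sigma> * c') * (\<integral>\<^sup>+t. ennreal (t powr (\<sigma> - 3/2)) * indicator {D..R} t \<partial>lborel) \<le> potential_kernel_H \<alpha> \<sigma> x y"
      using G c' by (simp only: ennreal_mult'' less_imp_le mult.assoc)
  qed (use G c' in auto)
qed

text \<open>
  The range $\tau \le t \le 2\tau$ alone gives the right order, both on the diagonal, with
  $\tau \approx (x-y)^2$, and at infinity, with $\tau \approx (x+y)^{-2}$.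
\<close>

lemma potential_kernel_H_ge_power:
  assumes "\<alpha> > -1" "\<sigma> > 0"
  obtains c where "c > 0" "\<And>x y \<tau>. x \<ge> 1 \<Longrightarrow> y \<ge> 1 \<Longrightarrow> 0 < \<tau> \<Longrightarrow> (x - y)\<^sup>2 \<le> \<tau> \<Longrightarrow> 2 * \<tau> * (x + y)\<^sup>2 \<le> 1 \<Longrightarrow>
     ennreal (c * \<tau> powr (\<sigma> - 1/2)) \<le> potential_kernel_H \<alpha> \<sigma> x y"
proof -
  obtain c where c: "c > 0" "\<And>x y D R. x \<ge> 1 \<Longrightarrow> y \<ge> 1 \<Longrightarrow> 0 < D \<Longrightarrow> (x - y)\<^sup>2 \<le> D \<Longrightarrow> R * (x + y)\<^sup>2 \<le> 1 \<Longrightarrow>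
     ennreal c * (\<integral>\<^sup>+t. ennreal (t powr (\<sigma> - 3/2)) * indicator {D..R} t \<partial>lborel) \<le> potential_kernel_H \<alpha> \<sigma> x y"
    using potential_kernel_H_ge_integral[OF assms] by blast
  define m where "m = min 1 (2 powr (\<sigma> - 3/2))"
  have m: "m > 0" by (simp add: m_def)
  show ?thesis
  proof (rule that[of "c * m"])
    fix x y \<tau> :: real assume xy: "x \<ge> 1" "y \<ge> 1" and \<tau>: "0 < \<tau>" "(x - y)\<^sup>2 \<le> \<tau>" "2 * \<tau> * (x + y)\<^sup>2 \<le> 1"
    have "ennreal (m * \<tau> powr (\<sigma> - 1/2)) = ennreal (m * \<tau> powr (\<sigma> - 3/2)) * ennreal \<tau>"
    proof -
      have "\<tau> powr (\<sigma> - 1/2) = \<tau> powr (\<sigma> - 3/2 + 1)" by (rule arg_cong[of _ _ "\<lambda>a. \<tau> powr a"]) simp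
      also have "\<dots> = \<tau> powr (\<sigma> - 3/2) * \<tau>" using \<tau> by (simp only: powr_add powr_one)
      finally show ?thesis using \<tau> m by (simp add: ennreal_mult[symmetric])
    qed
    also have "\<dots> = (\<integral>\<^sup>+t. ennreal (m * \<tau> powr (\<sigma> - 3/2)) * indicator {\<tau>..2 * \<tau>} t \<partial>lborel)"
      using \<tau> by (subst nn_integral_cmult_indicator) auto
    also have "\<dots> \<le> (\<integral>\<^sup>+t. ennreal (t powr (\<sigma> - 3/2)) * indicator {\<tau>..2 * \<tau>} t \<partial>lborel)"
    proof (rule nn_integral_mono)
      fix t
      have "m * \<tau> powr (\<sigma> - 3/2) \<le> t powr (\<sigma> - 3/2)" if t: "\<tau> \<le> t" "t \<le> 2 * \<tau>"
      proof (cases "\<sigma> \<ge> 3/2")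
        case True
        have "m * \<tau> powr (\<sigma> - 3/2) \<le> 1 * \<tau> powr (\<sigma> - 3/2)" by (intro mult_right_mono) (auto simp: m_def)
        also have "\<dots> \<le> t powr (\<sigma> - 3/2)" using True t \<tau> by (auto intro!: powr_mono2)
        finally show ?thesis .
      next
        case False
        have "m * \<tau> powr (\<sigma> - 3/2) \<le> 2 powr (\<sigma> - 3/2) * \<tau> powr (\<sigma> - 3/2)" by (intro mult_right_mono) (auto simp: m_def)
        also have "\<dots> = (2 * \<tau>) powr (\<sigma> - 3/2)" by (rule powr_mult[symmetric])
        also have "\<dots> \<le> t powr (\<sigma> - 3/2)" using False t \<tau> by (intro powr_mono2') auto
        finally show ?thesis .
      qed
      then show "ennreal (m * \<tau> powr (\<sigma> - 3/2)) * indicator {\<tau>..2 * \<tau>} t \<le> ennreal (t powr (\<sigma> - 3/2)) * indicator {\<tau>..2 * \<tau>} t"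
        by (auto split: split_indicator intro!: ennreal_leI)
    qed
    finally have "ennreal c * ennreal (m * \<tau> powr (\<sigma> - 1/2)) \<le> ennreal c * (\<integral>\<^sup>+t. ennreal (t powr (\<sigma> - 3/2)) * indicator {\<tau>..2 * \<tau>} t \<partial>lborel)"
      by (intro mult_left_mono) auto
    also have "\<dots> \<le> potential_kernel_H \<alpha> \<sigma> x y" using xy \<tau> by (intro c(2)) auto
    finally show "ennreal (c * m * \<tau> powr (\<sigma> - 1/2)) \<le> potential_kernel_H \<alpha> \<sigma> x y" using c m by (simp add: ennreal_mult mult.assoc)
  qed (use c m in auto)
qed

text \<open>
  In the limiting case $\sigma = 1/2$ the kernel has a logarithmic singularity, which a single dyadic
  range does not show.
\<close>

lemma potential_kernel_H_ge_log:
  assumes "\<alpha> > -1"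
  obtains c where "c > 0" "\<And>x y D R. x \<ge> 1 \<Longrightarrow> y \<ge> 1 \<Longrightarrow> 0 < D \<Longrightarrow> D \<le> R \<Longrightarrow> (x - y)\<^sup>2 \<le> D \<Longrightarrow> R * (x + y)\<^sup>2 \<le> 1 \<Longrightarrow>
     ennreal (c * ln (R / D)) \<le> potential_kernel_H \<alpha> (1/2) x y"
proof -
  obtain c where c: "c > 0" "\<And>x y D R. x \<ge> 1 \<Longrightarrow> y \<ge> 1 \<Longrightarrow> 0 < D \<Longrightarrow> (x - y)\<^sup>2 \<le> D \<Longrightarrow> R * (x + y)\<^sup>2 \<le> 1 \<Longrightarrow>
     ennreal c * (\<integral>\<^sup>+t. ennreal (t powr (1/2 - 3/2)) * indicator {D..R} t \<partial>lborel) \<le> potential_kernel_H \<alpha> (1/2) x y"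
    using potential_kernel_H_ge_integral[OF assms, of "1/2"] by auto
  show ?thesis
  proof (rule that[OF c(1)])
    fix x y D R :: real assume xy: "x \<ge> 1" "y \<ge> 1" and D: "0 < D" "D \<le> R" "(x - y)\<^sup>2 \<le> D" and R: "R * (x + y)\<^sup>2 \<le> 1"
    have "(\<integral>\<^sup>+t. ennreal (t powr (1/2 - 3/2)) * indicator {D..R} t \<partial>lborel) = (\<integral>\<^sup>+t. ennreal (1 / (t - 0)) * indicator {0 + D..0 + R} t \<partial>lborel)"
      using D by (intro nn_integral_cong) (auto split: split_indicator simp: powr_minus_divide)
    also have "\<dots> = ennreal (ln (R / D))" using D by (intro nn_integral_inverse_interval)
    finally show "ennreal (c * ln (R / D)) \<le> potential_kernel_H \<alpha> (1/2) x y"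
      using c(2)[OF xy D(1,3) R] c(1) D by (simp add: ennreal_mult)
  qed
qed

text \<open>
  Times $1 \le t \le 2$ satisfy $xy \le 2 \le \sinh 2t$, and everything except the power of $xy$ is
  bounded below there.
\<close>

lemma potential_kernel_H_ge_corner:
  assumes "\<alpha> > -1" "\<alpha> < - 1/2" "\<sigma> > 0"
  obtains c where "c > 0" "\<And>x y. 0 < x \<Longrightarrow> x \<le> 1 \<Longrightarrow> 1 \<le> y \<Longrightarrow> y \<le> 2 \<Longrightarrow> ennreal (c * x powr (\<alpha> + 1/2)) \<le> potential_kernel_H \<alpha> \<sigma> x y"
proof -
  obtain c where c: "c > 0" 
    "\<And>t x y. t > 0 \<Longrightarrow> x > 0 \<Longrightarrow> y > 0 \<Longrightarrow> x * y \<le> sinh (2 * t) \<Longrightarrow> c * corner (- \<alpha> - 1/2) t x y \<le> heat_kernel_H \<alpha> t x y"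
    using heat_kernel_H_lower[OF assms(1)] by metis
  have G: "Gamma \<sigma> > 0" using assms by (intro Gamma_real_pos)
  define \<gamma> where "\<gamma> = - \<alpha> - 1/2"
  have \<gamma>: "\<gamma> > 0" "\<gamma> < 1/2" "- \<gamma> = \<alpha> + 1/2" using assms by (auto simp: \<gamma>_def)
  define S4 where "S4 = sinh (4::real)"
  define M where "M = cosh (4::real) / sinh 2"
  define m where "m = min 1 (2 powr (\<sigma> - 1))"
  define c' where "c' = c * (2 powr (- \<gamma>) * S4 powr (\<gamma> - 1/2) * exp (- (1/2) * M * 5)) * m"
  have c': "c' > 0" using c by (simp add: c'_def S4_def m_def)
  show ?thesis
  proof (rule that[of "1 / Gamma \<sigma> * c'"])
    fix x y :: real assume xy: "0 < x" "x \<le> 1" "1 \<le> y" "y \<le> 2"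
    have "ennreal (c' * x powr (- \<gamma>)) = (\<integral>\<^sup>+t. ennreal (c' * x powr (- \<gamma>)) * indicator {1..2} (t::real) \<partial>lborel)"
      by (subst nn_integral_cmult_indicator) auto
    also have "\<dots> \<le> (\<integral>\<^sup>+t. ennreal (heat_kernel_H \<alpha> t x y * t powr (\<sigma> - 1)) * indicator {0<..} t \<partial>lborel)"
    proof (rule nn_integral_mono)
      fix t
      show "ennreal (c' * x powr (- \<gamma>)) * indicator {1..2} t \<le> ennreal (heat_kernel_H \<alpha> t x y * t powr (\<sigma> - 1)) * indicator {0<..} t"
      proof (cases "t \<in> {1..2}")
        case True
        then have t: "1 \<le> t" "t \<le> 2" by auto
        have "x * y \<le> 1 * 2" using xy by (intro mult_mono) auto
        also have "\<dots> \<le> 2 * t" using t by simp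
        also have "\<dots> \<le> sinh (2 * t)" using t by (intro sinh_ge_self) auto
        finally have xyS: "x * y \<le> sinh (2 * t)" .
        have SS: "sinh 2 \<le> sinh (2 * t)" "sinh (2 * t) \<le> S4" "cosh (2 * t) \<le> cosh 4" using t by (auto simp: S4_def cosh_real_nonneg_le_iff)
        have S2: "sinh (2::real) > 0" by simp
        have "coth (2 * t) \<le> M" unfolding coth_def M_def using SS S2 t by (intro frac_le) auto
        moreover have "x\<^sup>2 + y\<^sup>2 \<le> 1\<^sup>2 + 2\<^sup>2" using xy by (intro add_mono power_mono) auto
        ultimately have "coth (2 * t) * (x\<^sup>2 + y\<^sup>2) \<le> M * 5" using coth_ge_1[of "2 * t"] t by (intro mult_mono) auto
        then have e: "exp (- (1/2) * M * 5) \<le> exp (- (1/2) * coth (2 * t) * (x\<^sup>2 + y\<^sup>2))" by simp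
        have s: "S4 powr (\<gamma> - 1/2) \<le> sinh (2 * t) powr (\<gamma> - 1/2)" using SS S2 \<gamma> by (intro powr_mono2') auto
        have "(2 * x) powr (- \<gamma>) \<le> (x * y) powr (- \<gamma>)" using xy \<gamma> by (intro powr_mono2') auto
        then have z: "2 powr (- \<gamma>) * x powr (- \<gamma>) \<le> (x * y) powr (- \<gamma>)" unfolding powr_mult .
        have tm: "m \<le> t powr (\<sigma> - 1)"
        proof (cases "\<sigma> \<ge> 1")
          case True
          have "1 powr (\<sigma> - 1) \<le> t powr (\<sigma> - 1)" using True t by (intro powr_mono2) auto
          then show ?thesis by (simp add: m_def)
        next
          case False
          have "2 powr (\<sigma> - 1) \<le> t powr (\<sigma> - 1)" using False t by (intro powr_mono2') auto
          then show ?thesis by (simp add: m_def)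
        qed
        have "2 powr (- \<gamma>) * x powr (- \<gamma>) * S4 powr (\<gamma> - 1/2) * exp (- (1/2) * M * 5) \<le> corner \<gamma> t x y"
          unfolding corner_def by (intro mult_mono z s e) auto
        then have "c * (2 powr (- \<gamma>) * x powr (- \<gamma>) * S4 powr (\<gamma> - 1/2) * exp (- (1/2) * M * 5)) \<le> c * corner \<gamma> t x y"
          using c(1) by (intro mult_left_mono) auto
        also have "\<dots> \<le> heat_kernel_H \<alpha> t x y" unfolding \<gamma>_def using xy t xyS by (intro c(2)) auto
        finally have "c * (2 powr (- \<gamma>) * x powr (- \<gamma>) * S4 powr (\<gamma> - 1/2) * exp (- (1/2) * M * 5)) * m \<le> heat_kernel_H \<alpha> t x y * t powr (\<sigma> - 1)"
          using tm c(1) by (intro mult_mono) (auto simp: m_def intro: order_trans[rotated])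
        then have "c' * x powr (- \<gamma>) \<le> heat_kernel_H \<alpha> t x y * t powr (\<sigma> - 1)" unfolding c'_def by (simp only: mult_ac)
        then show ?thesis using True by (simp add: ennreal_leI)
      qed auto
    qed
    finally have "ennreal (1 / Gamma \<sigma>) * ennreal (c' * x powr (- \<gamma>)) \<le> potential_kernel_H \<alpha> \<sigma> x y"
      unfolding potential_kernel_H_eq nn_integral_lborel_pos by (intro mult_left_mono) auto
    moreover have "ennreal (1 / Gamma \<sigma>) * ennreal (c' * x powr (- \<gamma>)) = ennreal (1 / Gamma \<sigma> * c' * x powr (- \<gamma>))"
      using G c' by (subst ennreal_mult[symmetric]) (auto simp: mult.assoc)
    ultimately show "ennreal (1 / Gamma \<sigma> * c' * x powr (\<alpha> + 1/2)) \<le> potential_kernel_H \<alpha> \<sigma> x y" unfolding \<gamma>(3) by simp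
  qed (use G c' in auto)
qed

section \<open>Necessity of the conditions\<close>

lemma nn_integral_lborel_pos_ge:
  assumes "\<And>y. y \<in> S \<Longrightarrow> y > 0" "\<And>y. y \<in> S \<Longrightarrow> g y \<le> k y"
  shows "(\<integral>\<^sup>+y. g y * indicator S y \<partial>lborel) \<le> (\<integral>\<^sup>+y. k y \<partial>lborel_pos)"
  unfolding nn_integral_lborel_pos using assms by (intro nn_integral_mono) (auto split: split_indicator)

text \<open>
  The tests of the local behaviour of the kernel are placed near the point $2$. Within the distance
  $1/8$ the conditions of the lower estimates hold.
\<close>

lemma near_two_condition:
  fixes x y d :: real
  assumes "2 \<le> x" "x \<le> 2 + 1/8" "2 \<le> y" "y \<le> 2 + 1/8" "0 \<le> d" "d \<le> 1/8"
  shows "2 * d\<^sup>2 * (x + y)\<^sup>2 \<le> 1" and "1/32 * (x + y)\<^sup>2 \<le> 1"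
proof -
  have "(x + y)\<^sup>2 \<le> (4 + 1/4)\<^sup>2" using assms by (intro power_mono) auto
  moreover have "d\<^sup>2 \<le> (1/8)\<^sup>2" using assms by (intro power_mono) auto
  ultimately have "2 * d\<^sup>2 * (x + y)\<^sup>2 \<le> 2 * (1/8)\<^sup>2 * (4 + 1/4)\<^sup>2" by (intro mult_mono) auto
  also have "\<dots> \<le> (1::real)" by (simp add: power2_eq_square)
  finally show "2 * d\<^sup>2 * (x + y)\<^sup>2 \<le> 1" .
  show "1/32 * (x + y)\<^sup>2 \<le> 1" using \<open>(x + y)\<^sup>2 \<le> (4 + 1/4)\<^sup>2\<close> by (simp add: power2_eq_square)
qed

lemma square_powr: "d > 0 \<Longrightarrow> (d\<^sup>2) powr a = d powr (2 * a)" for d a :: real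
proof -
  assume "d > 0"
  then have "d\<^sup>2 = d powr 2" by simp
  then show ?thesis by (simp add: powr_powr)
qed

text \<open>
  On an interval of length $\epsilon$ the kernel is at least $c\,\epsilon^{2\sigma-1}$, so the image of its
  indicator is at least $c\,\epsilon^{2\sigma}$ there. Comparison of the norms gives
  $\epsilon^{2\sigma + Q} \le C \epsilon^P$.
\<close>

lemma potential_H_bounded_imp_lower_condition:
  assumes \<alpha>: "\<alpha> > -1" and \<sigma>: "\<sigma> > 0" and p: "1 \<le> p" "1 / p = ereal P" and q: "1 \<le> q" "1 / q = ereal Q"
    and b: "potential_H_bounded \<alpha> \<sigma> p q"
  shows "P - 2 * \<sigma> \<le> Q"
proof (rule ccontr)
  assume n: "\<not> P - 2 * \<sigma> \<le> Q"
  obtain c where c: "c > 0" "\<And>x y \<tau>. x \<ge> 1 \<Longrightarrow> y \<ge> 1 \<Longrightarrow> 0 < \<tau> \<Longrightarrow> (x - y)\<^sup>2 \<le> \<tau> \<Longrightarrow> 2 * \<tau> * (x + y)\<^sup>2 \<le> 1 \<Longrightarrow>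
     ennreal (c * \<tau> powr (\<sigma> - 1/2)) \<le> potential_kernel_H \<alpha> \<sigma> x y"
    using potential_kernel_H_ge_power[OF \<alpha> \<sigma>] by blast
  obtain C where C: "C \<ge> 0" "test_inequality \<alpha> \<sigma> p q C"
    using potential_H_bounded_imp_test_inequality[OF b q(1)] by blast
  show False
  proof (rule power_growth_contradiction[of "- P" "- (2 * \<sigma> + Q)" c 8 C])
    show "- P < - (2 * \<sigma> + Q)" using n by simp
    fix L :: real assume L: "L > 8" "L > 0"
    define \<epsilon> where "\<epsilon> = 1 / L"
    have \<epsilon>: "\<epsilon> > 0" "\<epsilon> \<le> 1/8" using L by (auto simp: \<epsilon>_def field_simps)
    have "Lp_norm lebesgue_pos q (\<lambda>x. complex_of_real (c * \<epsilon> powr (2 * \<sigma>) * indicator {2<..2 + \<epsilon>} x)) \<le> ennreal (C * \<epsilon> powr P)"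
    proof (rule test_inequalityD[OF C(2), where f = "\<lambda>x. 1 * indicator {2<..2 + \<epsilon>} x"])
      show "Lp_norm lebesgue_pos p (\<lambda>x. complex_of_real (1 * indicator {2<..2 + \<epsilon>} x)) \<le> ennreal (\<epsilon> powr P)"
        using Lp_norm_indicator[OF p, of 1 2 \<epsilon>] \<epsilon> by simp
      fix x :: real assume "x > 0"
      show "ennreal (c * \<epsilon> powr (2 * \<sigma>) * indicator {2<..2 + \<epsilon>} x) \<le> (\<integral>\<^sup>+y. potential_kernel_H \<alpha> \<sigma> x y * ennreal (1 * indicator {2<..2 + \<epsilon>} y) \<partial>lborel_pos)"
      proof (cases "x \<in> {2<..2 + \<epsilon>}")
        case True
        have e: "c * \<epsilon> powr (2 * \<sigma>) = c * (\<epsilon>\<^sup>2) powr (\<sigma> - 1/2) * \<epsilon>"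
        proof -
          have "\<epsilon> powr (2 * \<sigma>) = \<epsilon> powr (2 * (\<sigma> - 1/2) + 1)" by simp
          also have "\<dots> = (\<epsilon>\<^sup>2) powr (\<sigma> - 1/2) * \<epsilon>" using \<epsilon> unfolding square_powr[OF \<epsilon>(1)] by (simp only: powr_add powr_one)
          finally show ?thesis by simp
        qed
        have "ennreal (c * \<epsilon> powr (2 * \<sigma>)) = (\<integral>\<^sup>+y. ennreal (c * (\<epsilon>\<^sup>2) powr (\<sigma> - 1/2)) * indicator {2<..2 + \<epsilon>} y \<partial>lborel)"
          unfolding e using c(1) \<epsilon> by (subst nn_integral_cmult_indicator) (auto simp: ennreal_mult)
        also have "\<dots> \<le> (\<integral>\<^sup>+y. potential_kernel_H \<alpha> \<sigma> x y * ennreal (1 * indicator {2<..2 + \<epsilon>} y) \<partial>lborel_pos)"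
        proof (rule nn_integral_lborel_pos_ge)
          fix y assume y: "y \<in> {2<..2 + \<epsilon>}"
          have "\<bar>x - y\<bar> \<le> \<epsilon>" using True y by auto
          then have "(x - y)\<^sup>2 \<le> \<epsilon>\<^sup>2" using \<epsilon> by (subst abs_le_square_iff[symmetric]) auto
          then show "ennreal (c * (\<epsilon>\<^sup>2) powr (\<sigma> - 1/2)) \<le> potential_kernel_H \<alpha> \<sigma> x y * ennreal (1 * indicator {2<..2 + \<epsilon>} y)"
            using True y \<epsilon> near_two_condition(1)[of x y \<epsilon>] by (auto intro!: c(2))
        qed auto
        finally show ?thesis using True by simp
      qed auto
    qed (use c \<epsilon> in auto)
    moreover have "Lp_norm lebesgue_pos q (\<lambda>x. complex_of_real (c * \<epsilon> powr (2 * \<sigma>) * indicator {2<..2 + \<epsilon>} x)) = ennreal (c * \<epsilon> powr (2 * \<sigma>) * \<epsilon> powr Q)"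
      using Lp_norm_indicator[OF q, of "c * \<epsilon> powr (2 * \<sigma>)" 2 \<epsilon>] c \<epsilon> by simp
    ultimately have "c * \<epsilon> powr (2 * \<sigma>) * \<epsilon> powr Q \<le> C * \<epsilon> powr P" using C(1) by simp
    then have "c * \<epsilon> powr (2 * \<sigma> + Q) \<le> C * \<epsilon> powr P" by (simp add: powr_add mult.assoc)
    then show "c * L powr (- (2 * \<sigma> + Q)) \<le> C * L powr (- P)" unfolding \<epsilon>_def powr_divide powr_minus_divide by simp
  qed (use c in auto)
qed

text \<open>
  The integral of the kernel over the interval $[x - 1/(4x), x]$ is at least $c\,x^{-2\sigma}$. Hence the
  image of $x^{-P}$ on $[1,N]$ is at least $c\,x^{-2\sigma-P} \ge c\,x^{-Q}$ on $[2,N]$ if the condition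
  fails, and the norms are $(\ln N)^P$ and about $(\ln N)^Q$, where $P < Q$.
\<close>

lemma potential_H_bounded_imp_upper_condition:
  assumes \<alpha>: "\<alpha> > -1" and \<sigma>: "\<sigma> > 0" and p: "1 \<le> p" "1 / p = ereal P" and q: "1 \<le> q" "1 / q = ereal Q" and P0: "0 \<le> P"
    and b: "potential_H_bounded \<alpha> \<sigma> p q"
  shows "Q < P + 2 * \<sigma>"
proof (rule ccontr)
  assume n: "\<not> Q < P + 2 * \<sigma>"
  then have Q: "Q > 0" "P < Q" using \<sigma> P0 by auto
  obtain c where c: "c > 0" "\<And>x y \<tau>. x \<ge> 1 \<Longrightarrow> y \<ge> 1 \<Longrightarrow> 0 < \<tau> \<Longrightarrow> (x - y)\<^sup>2 \<le> \<tau> \<Longrightarrow> 2 * \<tau> * (x + y)\<^sup>2 \<le> 1 \<Longrightarrow>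
     ennreal (c * \<tau> powr (\<sigma> - 1/2)) \<le> potential_kernel_H \<alpha> \<sigma> x y"
    using potential_kernel_H_ge_power[OF \<alpha> \<sigma>] by blast
  obtain C where C: "C \<ge> 0" "test_inequality \<alpha> \<sigma> p q C"
    using potential_H_bounded_imp_test_inequality[OF b q(1)] by blast
  define c' where "c' = c * 4 powr (- (2 * \<sigma>))"
  have c': "c' > 0" using c by (simp add: c'_def)
  show False
  proof (rule power_growth_contradiction[of P Q "c' * (1/2) powr Q" 2 C])
    show "P < Q" by (rule Q)
    show "c' * (1/2) powr Q > 0" using c' by simp
    fix L :: real assume L: "L > 2" "L > 0"
    have eL: "2 < exp L" using L exp_ge_add_one_self[of L] by linarith
    define f where "f x = 1 * (x - 0) powr (- P) * indicator {0 + 1..0 + exp L} x" for x :: real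
    define h where "h x = c' * (x - 0) powr (- Q) * indicator {0 + 2..0 + exp L} x" for x :: real
    have [measurable]: "f \<in> borel_measurable borel" "h \<in> borel_measurable borel" unfolding f_def h_def by measurable
    have "Lp_norm lebesgue_pos q (\<lambda>x. complex_of_real (h x)) \<le> ennreal (C * L powr P)"
    proof (rule test_inequalityD[OF C(2), where f = f])
      show "Lp_norm lebesgue_pos p (\<lambda>x. complex_of_real (f x)) \<le> ennreal (L powr P)"
      proof (cases "P = 0")
        case True
        then have "p = \<infinity>" using p by (auto elim!: ereal_one_over_cases)
        moreover have "esssup lebesgue_pos (\<lambda>x. ennreal (norm (complex_of_real (f x)))) \<le> ennreal 1"
          using True by (intro esssup_I borel_imp_lebesgue_pos) (auto simp: f_def indicator_def)
        ultimately show ?thesis using True L by (simp add: Lp_norm_def)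
      next
        case False
        then show ?thesis using Lp_norm_log_power[OF p, of 1 0 1 "exp L"] P0 L unfolding f_def by simp
      qed
      fix x :: real assume "x > 0"
      show "ennreal (h x) \<le> (\<integral>\<^sup>+y. potential_kernel_H \<alpha> \<sigma> x y * ennreal (f y) \<partial>lborel_pos)"
      proof (cases "x \<in> {2..exp L}")
        case True
        \<comment> \<open>small enough that \<open>d\<^sup>2\<close>, a lower bound for the times used, is at most \<open>(x + y) powr (- 2) / 2\<close>\<close>
        define d where "d = 1 / (4 * x)"
        have x: "2 \<le> x" "x \<le> exp L" using True by auto
        have d: "d > 0" "d \<le> 1" "4 * x * d = 1" using x by (auto simp: d_def field_simps)
        define \<kappa> where "\<kappa> = c * (d\<^sup>2) powr (\<sigma> - 1/2) * x powr (- P)"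
        have \<kappa>0: "\<kappa> \<ge> 0" using c by (simp add: \<kappa>_def)
        have "h x \<le> \<kappa> * d"
        proof -
          have "(d\<^sup>2) powr (\<sigma> - 1/2) * d = d powr (2 * (\<sigma> - 1/2) + 1)"
            using d unfolding square_powr[OF d(1)] by (simp only: powr_add powr_one)
          also have "\<dots> = d powr (2 * \<sigma>)" by simp
          also have "\<dots> = 4 powr (- (2 * \<sigma>)) * x powr (- (2 * \<sigma>))"
            unfolding d_def powr_divide powr_mult powr_minus_divide by simp
          finally have "\<kappa> * d = c' * (x powr (- (2 * \<sigma>)) * x powr (- P))" by (simp add: \<kappa>_def c'_def mult_ac)
          moreover have "x powr (- Q) \<le> x powr (- (2 * \<sigma>)) * x powr (- P)"
            unfolding powr_add[symmetric] using n x by (intro powr_mono) auto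
          ultimately show ?thesis using True c' by (simp add: h_def mult_left_mono)
        qed
        then have "ennreal (h x) \<le> ennreal \<kappa> * ennreal d" using \<kappa>0 d by (simp add: ennreal_mult[symmetric] ennreal_leI)
        also have "\<dots> = (\<integral>\<^sup>+y. ennreal \<kappa> * indicator {x - d..x} y \<partial>lborel)"
          using d by (subst nn_integral_cmult_indicator) auto
        also have "\<dots> \<le> (\<integral>\<^sup>+y. potential_kernel_H \<alpha> \<sigma> x y * ennreal (f y) \<partial>lborel_pos)"
        proof (rule nn_integral_lborel_pos_ge)
          fix y assume y: "y \<in> {x - d..x}"
          then have y1: "1 \<le> y" "y \<le> x" using x d by auto
          then show "y > 0" by simp
          have xyd: "(x - y)\<^sup>2 \<le> d\<^sup>2" using y by (intro power_mono) auto
          have "d * (x + y) \<le> d * (2 * x)" using y1 d by (intro mult_left_mono) auto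
          moreover have "d * (2 * x) = 1/2" using d(3) by (simp add: algebra_simps)
          ultimately have "d * (x + y) \<le> 1/2" by linarith
          then have "(d * (x + y))\<^sup>2 \<le> (1/2)\<^sup>2" using d y1 x by (intro power_mono) auto
          then have "d\<^sup>2 * (x + y)\<^sup>2 \<le> 1/4" by (simp add: power_mult_distrib power_divide)
          then have "2 * d\<^sup>2 * (x + y)\<^sup>2 \<le> 1" by simp
          then have k: "ennreal (c * (d\<^sup>2) powr (\<sigma> - 1/2)) \<le> potential_kernel_H \<alpha> \<sigma> x y"
            using x y1 d xyd by (intro c(2)) auto
          have "x powr (- P) \<le> y powr (- P)" using y1 P0 by (intro powr_mono2') auto
          then have fy: "ennreal (x powr (- P)) \<le> ennreal (f y)" using y1 x by (intro ennreal_leI) (auto simp: f_def)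
          have "ennreal \<kappa> = ennreal (c * (d\<^sup>2) powr (\<sigma> - 1/2)) * ennreal (x powr (- P))" using c by (simp add: \<kappa>_def ennreal_mult)
          also have "\<dots> \<le> potential_kernel_H \<alpha> \<sigma> x y * ennreal (f y)" by (intro mult_mono k fy) auto
          finally show "ennreal \<kappa> \<le> potential_kernel_H \<alpha> \<sigma> x y * ennreal (f y)" .
        qed
        finally show ?thesis .
      qed (auto simp: h_def)
    qed (use c' in \<open>auto simp: f_def h_def\<close>)
    moreover have "Lp_norm lebesgue_pos q (\<lambda>x. complex_of_real (h x)) = ennreal (c' * ln (exp L / 2) powr Q)"
      using Lp_norm_log_power[OF q, of c' 0 2 "exp L"] Q c' eL unfolding h_def by simp
    ultimately have "c' * ln (exp L / 2) powr Q \<le> C * L powr P" using C(1) by simp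
    moreover have "(1/2 * L) powr Q \<le> ln (exp L / 2) powr Q"
      using L Q ln_le_minus_one[of "2::real"] by (intro powr_mono2) (auto simp: ln_div)
    then have "c' * (1/2 * L) powr Q \<le> c' * ln (exp L / 2) powr Q" using c' by (intro mult_left_mono) auto
    ultimately show "c' * (1/2) powr Q * L powr Q \<le> C * L powr P" unfolding powr_mult by (simp add: mult.assoc)
  qed
qed

text \<open>
  The kernel $|x-y|^{2\sigma-1}$ just fails to be in the dual of $L^p$: paired with $(y-2)^{-2\sigma}$ it
  produces a logarithm $L$, while the norm of that power is only $L^{2\sigma}$.
\<close>

lemma potential_H_bounded_imp_not_endpoint_infinity:
  assumes \<alpha>: "\<alpha> > -1" and \<sigma>: "\<sigma> > 0" and p: "1 \<le> p" "1 / p = ereal P" and q: "1 \<le> q" "1 / q = ereal Q"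
    and b: "potential_H_bounded \<alpha> \<sigma> p q" and s: "\<sigma> < 1/2" "P = 2 * \<sigma>" "Q = 0"
  shows False
proof -
  obtain c where c: "c > 0" "\<And>x y \<tau>. x \<ge> 1 \<Longrightarrow> y \<ge> 1 \<Longrightarrow> 0 < \<tau> \<Longrightarrow> (x - y)\<^sup>2 \<le> \<tau> \<Longrightarrow> 2 * \<tau> * (x + y)\<^sup>2 \<le> 1 \<Longrightarrow>
     ennreal (c * \<tau> powr (\<sigma> - 1/2)) \<le> potential_kernel_H \<alpha> \<sigma> x y"
    using potential_kernel_H_ge_power[OF \<alpha> \<sigma>] by blast
  obtain C where C: "C \<ge> 0" "test_inequality \<alpha> \<sigma> p q C"
    using potential_H_bounded_imp_test_inequality[OF b q(1)] by blast
  show False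
  proof (rule power_growth_contradiction[of P 1 c 0 C])
    show "P < 1" using s by simp
    fix L :: real assume L: "L > 0"
    define \<epsilon> where "\<epsilon> = exp (- L) / 8"
    have "1 / 8 / \<epsilon> = exp L" by (simp add: \<epsilon>_def exp_minus inverse_eq_divide)
    then have \<epsilon>: "\<epsilon> > 0" "\<epsilon> < 1/8" "ln (1 / 8 / \<epsilon>) = L" using L by (auto simp: \<epsilon>_def)
    define f where "f x = 1 * (x - 2) powr (- P) * indicator {2 + \<epsilon>..2 + 1/8} x" for x :: real
    define h where "h x = c * L * indicator {2<..2 + \<epsilon>} x" for x :: real
    have [measurable]: "f \<in> borel_measurable borel" "h \<in> borel_measurable borel" unfolding f_def h_def by measurable
    have "Lp_norm lebesgue_pos q (\<lambda>x. complex_of_real (h x)) \<le> ennreal (C * L powr P)"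
    proof (rule test_inequalityD[OF C(2), where f = f])
      show "Lp_norm lebesgue_pos p (\<lambda>x. complex_of_real (f x)) \<le> ennreal (L powr P)"
        using Lp_norm_log_power[OF p, of 1 2 \<epsilon> "1/8"] \<epsilon> s \<sigma> unfolding f_def by simp
      fix x :: real assume "x > 0"
      show "ennreal (h x) \<le> (\<integral>\<^sup>+y. potential_kernel_H \<alpha> \<sigma> x y * ennreal (f y) \<partial>lborel_pos)"
      proof (cases "x \<in> {2<..2 + \<epsilon>}")
        case True
        have "ennreal (h x) = ennreal c * ennreal (ln (1 / 8 / \<epsilon>))" using True c L \<epsilon>(3) by (simp add: h_def ennreal_mult)
        also have "\<dots> = ennreal c * (\<integral>\<^sup>+y. ennreal (1 / (y - 2)) * indicator {2 + \<epsilon>..2 + 1/8} y \<partial>lborel)"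
          using \<epsilon> by (subst nn_integral_inverse_interval) auto
        also have "\<dots> = (\<integral>\<^sup>+y. ennreal c * (ennreal (1 / (y - 2)) * indicator {2 + \<epsilon>..2 + 1/8} y) \<partial>lborel)"
          by (rule nn_integral_cmult[symmetric]) measurable
        also have "\<dots> = (\<integral>\<^sup>+y. (ennreal c * ennreal (1 / (y - 2))) * indicator {2 + \<epsilon>..2 + 1/8} y \<partial>lborel)"
          by (simp only: mult.assoc)
        also have "\<dots> \<le> (\<integral>\<^sup>+y. potential_kernel_H \<alpha> \<sigma> x y * ennreal (f y) \<partial>lborel_pos)"
        proof (rule nn_integral_lborel_pos_ge)
          fix y assume y: "y \<in> {2 + \<epsilon>..2 + 1/8}"
          then show "y > 0" using \<epsilon> by simp
          define d where "d = y - 2"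
          have d: "0 < d" "d \<le> 1/8" using y \<epsilon> by (auto simp: d_def)
          have "\<bar>x - y\<bar> \<le> d" using True y by (auto simp: d_def)
          then have "(x - y)\<^sup>2 \<le> d\<^sup>2" using d by (subst abs_le_square_iff[symmetric]) auto
          then have k: "ennreal (c * (d\<^sup>2) powr (\<sigma> - 1/2)) \<le> potential_kernel_H \<alpha> \<sigma> x y"
            using True y d \<epsilon> near_two_condition(1)[of x y d] by (intro c(2)) auto
          have "(d\<^sup>2) powr (\<sigma> - 1/2) * d powr (- P) = d powr (- 1)"
            unfolding square_powr[OF d(1)] powr_add[symmetric] s by (rule arg_cong[of _ _ "\<lambda>a. d powr a"]) simp
          also have "\<dots> = 1 / (y - 2)" using d by (simp add: powr_minus_divide d_def)
          finally have "ennreal c * ennreal (1 / (y - 2)) = ennreal (c * (d\<^sup>2) powr (\<sigma> - 1/2)) * ennreal (d powr (- P))"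
            using c d by (simp add: ennreal_mult[symmetric] mult.assoc d_def)
          also have "\<dots> \<le> potential_kernel_H \<alpha> \<sigma> x y * ennreal (f y)"
            using y by (intro mult_mono k) (auto simp: f_def d_def)
          finally show "ennreal c * ennreal (1 / (y - 2)) \<le> potential_kernel_H \<alpha> \<sigma> x y * ennreal (f y)" .
        qed
        finally show ?thesis .
      qed (auto simp: h_def)
    qed (use c L in \<open>auto simp: f_def h_def\<close>)
    moreover have "Lp_norm lebesgue_pos q (\<lambda>x. complex_of_real (h x)) = ennreal (c * L)"
      using Lp_norm_indicator[OF q, of "c * L" 2 \<epsilon>] c L \<epsilon> s unfolding h_def by simp
    ultimately have "c * L \<le> C * L powr P" using C(1) by simp
    then show "c * L powr 1 \<le> C * L powr P" using L by simp
  qed (use c in auto)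
qed

text \<open>
  The image of an approximate unit mass is about $|x-2|^{2\sigma-1} = |x-2|^{-Q}$, which just fails to
  be in $L^q$.
\<close>

lemma potential_H_bounded_imp_not_endpoint_one:
  assumes \<alpha>: "\<alpha> > -1" and \<sigma>: "\<sigma> > 0" and p: "1 \<le> p" "1 / p = ereal P" and q: "1 \<le> q" "1 / q = ereal Q"
    and b: "potential_H_bounded \<alpha> \<sigma> p q" and s: "P = 1" "Q = 1 - 2 * \<sigma>" "Q > 0"
  shows False
proof -
  obtain c where c: "c > 0" "\<And>x y \<tau>. x \<ge> 1 \<Longrightarrow> y \<ge> 1 \<Longrightarrow> 0 < \<tau> \<Longrightarrow> (x - y)\<^sup>2 \<le> \<tau> \<Longrightarrow> 2 * \<tau> * (x + y)\<^sup>2 \<le> 1 \<Longrightarrow>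
     ennreal (c * \<tau> powr (\<sigma> - 1/2)) \<le> potential_kernel_H \<alpha> \<sigma> x y"
    using potential_kernel_H_ge_power[OF \<alpha> \<sigma>] by blast
  obtain C where C: "C \<ge> 0" "test_inequality \<alpha> \<sigma> p q C"
    using potential_H_bounded_imp_test_inequality[OF b q(1)] by blast
  show False
  proof (rule power_growth_contradiction[of 0 Q c 0 C])
    fix L :: real assume L: "L > 0"
    define \<epsilon> where "\<epsilon> = exp (- L) / 8"
    have "1 / 8 / \<epsilon> = exp L" by (simp add: \<epsilon>_def exp_minus inverse_eq_divide)
    then have \<epsilon>: "\<epsilon> > 0" "\<epsilon> < 1/8" "ln (1 / 8 / \<epsilon>) = L" using L by (auto simp: \<epsilon>_def)
    define f where "f x = 1 / \<epsilon> * indicator {2<..2 + \<epsilon>} x" for x :: real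
    define h where "h x = c * (x - 2) powr (- Q) * indicator {2 + \<epsilon>..2 + 1/8} x" for x :: real
    have [measurable]: "f \<in> borel_measurable borel" "h \<in> borel_measurable borel" unfolding f_def h_def by measurable
    have "Lp_norm lebesgue_pos q (\<lambda>x. complex_of_real (h x)) \<le> ennreal (C * 1)"
    proof (rule test_inequalityD[OF C(2), where f = f])
      show "Lp_norm lebesgue_pos p (\<lambda>x. complex_of_real (f x)) \<le> ennreal 1"
        using Lp_norm_indicator[OF p, of "1 / \<epsilon>" 2 \<epsilon>] \<epsilon> s unfolding f_def by simp
      fix x :: real assume "x > 0"
      show "ennreal (h x) \<le> (\<integral>\<^sup>+y. potential_kernel_H \<alpha> \<sigma> x y * ennreal (f y) \<partial>lborel_pos)"
      proof (cases "x \<in> {2 + \<epsilon>..2 + 1/8}")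
        case True
        define d where "d = x - 2"
        have d: "0 < d" "d \<le> 1/8" using True \<epsilon> by (auto simp: d_def)
        have hx: "h x = c * (d\<^sup>2) powr (\<sigma> - 1/2)"
          using True unfolding square_powr[OF d(1)] by (simp add: h_def d_def s)
        have "ennreal (h x) = ennreal (h x / \<epsilon>) * ennreal \<epsilon>" using \<epsilon> c by (simp add: hx ennreal_mult[symmetric])
        also have "\<dots> = (\<integral>\<^sup>+y. ennreal (h x / \<epsilon>) * indicator {2<..2 + \<epsilon>} y \<partial>lborel)"
          using \<epsilon> by (subst nn_integral_cmult_indicator) auto
        also have "\<dots> \<le> (\<integral>\<^sup>+y. potential_kernel_H \<alpha> \<sigma> x y * ennreal (f y) \<partial>lborel_pos)"
        proof (rule nn_integral_lborel_pos_ge)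
          fix y assume y: "y \<in> {2<..2 + \<epsilon>}"
          then show "y > 0" by simp
          have "\<bar>x - y\<bar> \<le> d" using True y by (auto simp: d_def)
          then have "(x - y)\<^sup>2 \<le> d\<^sup>2" using d by (subst abs_le_square_iff[symmetric]) auto
          then have k: "ennreal (h x) \<le> potential_kernel_H \<alpha> \<sigma> x y"
            unfolding hx using True y d \<epsilon> near_two_condition(1)[of x y d] by (intro c(2)) auto
          have "ennreal (h x / \<epsilon>) = ennreal (h x) * ennreal (1 / \<epsilon>)" using \<epsilon> c by (simp add: hx ennreal_mult[symmetric])
          also have "\<dots> \<le> potential_kernel_H \<alpha> \<sigma> x y * ennreal (f y)"
            using y by (intro mult_mono k) (auto simp: f_def)
          finally show "ennreal (h x / \<epsilon>) \<le> potential_kernel_H \<alpha> \<sigma> x y * ennreal (f y)" .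
        qed
        finally show ?thesis .
      qed (auto simp: h_def)
    qed (use c \<epsilon> in \<open>auto simp: f_def h_def\<close>)
    moreover have "Lp_norm lebesgue_pos q (\<lambda>x. complex_of_real (h x)) = ennreal (c * L powr Q)"
      using Lp_norm_log_power[OF q, of c 2 \<epsilon> "1/8"] c \<epsilon> s unfolding h_def by simp
    ultimately have "c * L powr Q \<le> C" using C(1) by simp
    then show "c * L powr Q \<le> C * L powr 0" using L by simp
  qed (use c s in auto)
qed

text \<open>
  The corner where the two excluded endpoints coincide: an operator from $L^1$ to $L^\infty$ has a
  bounded kernel, but this one is logarithmically unbounded.
\<close>

lemma potential_H_bounded_imp_not_endpoint_one_infinity:
  assumes \<alpha>: "\<alpha> > -1" and p: "1 \<le> p" "1 / p = ereal 1" and q: "1 \<le> q" "1 / q = ereal 0"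
    and b: "potential_H_bounded \<alpha> (1/2) p q"
  shows False
proof -
  obtain c where c: "c > 0" "\<And>x y D R. x \<ge> 1 \<Longrightarrow> y \<ge> 1 \<Longrightarrow> 0 < D \<Longrightarrow> D \<le> R \<Longrightarrow> (x - y)\<^sup>2 \<le> D \<Longrightarrow> R * (x + y)\<^sup>2 \<le> 1 \<Longrightarrow>
     ennreal (c * ln (R / D)) \<le> potential_kernel_H \<alpha> (1/2) x y"
    using potential_kernel_H_ge_log[OF \<alpha>] by blast
  obtain C where C: "C \<ge> 0" "test_inequality \<alpha> (1/2) p q C"
    using potential_H_bounded_imp_test_inequality[OF b q(1)] by blast
  show False
  proof (rule power_growth_contradiction[of 0 1 c 0 C])
    fix L :: real assume L: "L > 0"
    define \<epsilon> where "\<epsilon> = exp (- L) / 8"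
    have \<epsilon>: "\<epsilon> > 0" "\<epsilon> < 1/8" using L by (auto simp: \<epsilon>_def)
    have "\<epsilon>\<^sup>2 \<le> (1/8)\<^sup>2" using \<epsilon> by (intro power_mono) auto
    then have \<epsilon>2: "\<epsilon>\<^sup>2 \<le> 1/32" by (simp add: power2_eq_square)
    have R: "L \<le> ln (1/32 / \<epsilon>\<^sup>2)"
    proof -
      have "1/32 / \<epsilon>\<^sup>2 = 2 * (exp L * exp L)" by (simp add: \<epsilon>_def power2_eq_square exp_minus inverse_eq_divide)
      moreover have "exp L * 1 \<le> exp L * (2 * exp L)" using L by (intro mult_left_mono) (auto intro: order_trans[of _ "exp L"])
      ultimately have "exp L \<le> 1/32 / \<epsilon>\<^sup>2" by simp
      then show ?thesis using \<epsilon> by (subst ln_ge_iff) auto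
    qed
    define f where "f x = 1 / \<epsilon> * indicator {2<..2 + \<epsilon>} x" for x :: real
    define h where "h x = c * L * indicator {2<..2 + \<epsilon>} x" for x :: real
    have [measurable]: "f \<in> borel_measurable borel" "h \<in> borel_measurable borel" unfolding f_def h_def by measurable
    have "Lp_norm lebesgue_pos q (\<lambda>x. complex_of_real (h x)) \<le> ennreal (C * 1)"
    proof (rule test_inequalityD[OF C(2), where f = f])
      show "Lp_norm lebesgue_pos p (\<lambda>x. complex_of_real (f x)) \<le> ennreal 1"
        using Lp_norm_indicator[OF p, of "1 / \<epsilon>" 2 \<epsilon>] \<epsilon> unfolding f_def by simp
      fix x :: real assume "x > 0"
      show "ennreal (h x) \<le> (\<integral>\<^sup>+y. potential_kernel_H \<alpha> (1/2) x y * ennreal (f y) \<partial>lborel_pos)"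
      proof (cases "x \<in> {2<..2 + \<epsilon>}")
        case True
        have "ennreal (h x) = ennreal (c * L / \<epsilon>) * ennreal \<epsilon>" using \<epsilon> c L True by (simp add: h_def ennreal_mult[symmetric])
        also have "\<dots> = (\<integral>\<^sup>+y. ennreal (c * L / \<epsilon>) * indicator {2<..2 + \<epsilon>} y \<partial>lborel)"
          using \<epsilon> by (subst nn_integral_cmult_indicator) auto
        also have "\<dots> \<le> (\<integral>\<^sup>+y. potential_kernel_H \<alpha> (1/2) x y * ennreal (f y) \<partial>lborel_pos)"
        proof (rule nn_integral_lborel_pos_ge)
          fix y assume y: "y \<in> {2<..2 + \<epsilon>}"
          then show "y > 0" by simp
          have "\<bar>x - y\<bar> \<le> \<epsilon>" using True y by auto
          then have "(x - y)\<^sup>2 \<le> \<epsilon>\<^sup>2" using \<epsilon> by (subst abs_le_square_iff[symmetric]) auto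
          then have "ennreal (c * ln (1/32 / \<epsilon>\<^sup>2)) \<le> potential_kernel_H \<alpha> (1/2) x y"
            using True y \<epsilon> \<epsilon>2 near_two_condition(2)[of x y \<epsilon>] by (intro c(2)) auto
          moreover have "ennreal (c * L) \<le> ennreal (c * ln (1/32 / \<epsilon>\<^sup>2))" using R c by (intro ennreal_leI mult_left_mono) auto
          ultimately have k: "ennreal (c * L) \<le> potential_kernel_H \<alpha> (1/2) x y" by (rule order_trans[rotated])
          have "ennreal (c * L / \<epsilon>) = ennreal (c * L) * ennreal (1 / \<epsilon>)" using \<epsilon> c L by (simp add: ennreal_mult[symmetric])
          also have "\<dots> \<le> potential_kernel_H \<alpha> (1/2) x y * ennreal (f y)"
            using y by (intro mult_mono k) (auto simp: f_def)
          finally show "ennreal (c * L / \<epsilon>) \<le> potential_kernel_H \<alpha> (1/2) x y * ennreal (f y)" .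
        qed
        finally show ?thesis .
      qed (auto simp: h_def)
    qed (use c \<epsilon> L in \<open>auto simp: f_def h_def\<close>)
    moreover have "Lp_norm lebesgue_pos q (\<lambda>x. complex_of_real (h x)) = ennreal (c * L)"
      using Lp_norm_indicator[OF q, of "c * L" 2 \<epsilon>] c L \<epsilon> unfolding h_def by simp
    ultimately have "c * L \<le> C" using C(1) by simp
    then show "c * L powr 1 \<le> C * L powr 0" using L by simp
  qed (use c in auto)
qed

text \<open>
  The image of the indicator of $(1,2]$ is at least $c\,x^{-\gamma}$ near the origin, and this is not in
  $L^q$ if $Q \le \gamma$.
\<close>

lemma potential_H_bounded_imp_corner_condition:
  assumes \<alpha>: "\<alpha> > -1" "\<alpha> < - 1/2" and \<sigma>: "\<sigma> > 0" and p: "1 \<le> p" "1 / p = ereal P" and q: "1 \<le> q" "1 / q = ereal Q" and Q0: "0 \<le> Q"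
    and b: "potential_H_bounded \<alpha> \<sigma> p q"
  shows "- \<alpha> - 1/2 < Q"
proof (rule ccontr)
  assume n: "\<not> - \<alpha> - 1/2 < Q"
  define \<gamma> where "\<gamma> = - \<alpha> - 1/2"
  have \<gamma>: "\<gamma> > 0" "Q \<le> \<gamma>" "\<alpha> + 1/2 = - \<gamma>" using \<alpha> n by (auto simp: \<gamma>_def)
  obtain c where c: "c > 0" "\<And>x y. 0 < x \<Longrightarrow> x \<le> 1 \<Longrightarrow> 1 \<le> y \<Longrightarrow> y \<le> 2 \<Longrightarrow> ennreal (c * x powr (- \<gamma>)) \<le> potential_kernel_H \<alpha> \<sigma> x y"
    using potential_kernel_H_ge_corner[OF \<alpha> \<sigma>] unfolding \<gamma>(3) by blast
  obtain C where C: "C \<ge> 0" "test_inequality \<alpha> \<sigma> p q C"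
    using potential_H_bounded_imp_test_inequality[OF b q(1)] by blast
  define f where "f x = (1::real) * indicator {1<..1 + 1} x" for x :: real
  have [measurable]: "f \<in> borel_measurable borel" unfolding f_def by measurable
  have fn: "Lp_norm lebesgue_pos p (\<lambda>x. complex_of_real (f x)) \<le> ennreal 1"
    using Lp_norm_indicator[OF p, of 1 1 1] unfolding f_def by simp
  have kf: "ennreal (c * x powr (- \<gamma>)) \<le> (\<integral>\<^sup>+y. potential_kernel_H \<alpha> \<sigma> x y * ennreal (f y) \<partial>lborel_pos)" if x: "0 < x" "x \<le> 1" for x
  proof -
    have "ennreal (c * x powr (- \<gamma>)) = (\<integral>\<^sup>+y. ennreal (c * x powr (- \<gamma>)) * indicator {1<..1 + 1} (y::real) \<partial>lborel)"
      by (subst nn_integral_cmult_indicator) auto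
    also have "\<dots> \<le> (\<integral>\<^sup>+y. potential_kernel_H \<alpha> \<sigma> x y * ennreal (f y) \<partial>lborel_pos)"
      using x c(2) by (intro nn_integral_lborel_pos_ge) (auto simp: f_def)
    finally show ?thesis .
  qed
  show False
  proof (cases "Q = 0")
    case True
    show False
    proof (rule power_growth_contradiction[of 0 \<gamma> c 1 C])
      fix L :: real assume L: "L > 1" "L > 0"
      define h where "h x = c * L powr \<gamma> * indicator {0<..0 + 1 / L} x" for x :: real
      have [measurable]: "h \<in> borel_measurable borel" unfolding h_def by measurable
      have "Lp_norm lebesgue_pos q (\<lambda>x. complex_of_real (h x)) \<le> ennreal (C * 1)"
      proof (rule test_inequalityD[OF C(2) _ _ _ fn])
        fix x :: real assume "x > 0"
        show "ennreal (h x) \<le> (\<integral>\<^sup>+y. potential_kernel_H \<alpha> \<sigma> x y * ennreal (f y) \<partial>lborel_pos)"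
        proof (cases "x \<in> {0<..1 / L}")
          case x: True
          then have x1: "0 < x" "x \<le> 1" using L by (auto intro: order_trans)
          have "L powr \<gamma> = (1 / L) powr (- \<gamma>)" unfolding powr_divide powr_minus_divide by simp
          also have "\<dots> \<le> x powr (- \<gamma>)" using x \<gamma> by (intro powr_mono2') auto
          finally have "h x \<le> c * x powr (- \<gamma>)" using x c by (simp add: h_def)
          then show ?thesis using kf[OF x1] by (meson ennreal_leI order_trans)
        qed (auto simp: h_def)
      qed (use c in \<open>auto simp: f_def h_def\<close>)
      moreover have "Lp_norm lebesgue_pos q (\<lambda>x. complex_of_real (h x)) = ennreal (c * L powr \<gamma>)"
        using Lp_norm_indicator[OF q, of "c * L powr \<gamma>" 0 "1 / L"] c L True unfolding h_def by simp
      ultimately show "c * L powr \<gamma> \<le> C * L powr 0" using C(1) L by simp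
    qed (use c \<gamma> in auto)
  next
    case False
    then have Q: "Q > 0" using Q0 by simp
    show False
    proof (rule power_growth_contradiction[of 0 Q c 0 C])
      fix L :: real assume L: "L > 0"
      define h where "h x = c * (x - 0) powr (- Q) * indicator {0 + exp (- L)..0 + 1} x" for x :: real
      have [measurable]: "h \<in> borel_measurable borel" unfolding h_def by measurable
      have "Lp_norm lebesgue_pos q (\<lambda>x. complex_of_real (h x)) \<le> ennreal (C * 1)"
      proof (rule test_inequalityD[OF C(2) _ _ _ fn])
        fix x :: real assume x0: "x > 0"
        show "ennreal (h x) \<le> (\<integral>\<^sup>+y. potential_kernel_H \<alpha> \<sigma> x y * ennreal (f y) \<partial>lborel_pos)"
        proof (cases "x \<in> {exp (- L)..1}")
          case x: True
          then have x1: "0 < x" "x \<le> 1" using x0 by auto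
          have "x powr (- Q) \<le> x powr (- \<gamma>)" using x1 \<gamma> by (intro powr_mono') auto
          then have "h x \<le> c * x powr (- \<gamma>)" using x c by (simp add: h_def)
          then show ?thesis using kf[OF x1] by (meson ennreal_leI order_trans)
        qed (auto simp: h_def)
      qed (use c in \<open>auto simp: f_def h_def\<close>)
      moreover have "Lp_norm lebesgue_pos q (\<lambda>x. complex_of_real (h x)) = ennreal (c * L powr Q)"
      proof -
        have e: "1 / exp (- L) = exp L" by (simp add: exp_minus inverse_eq_divide)
        show ?thesis using Lp_norm_log_power[OF q Q, of c 0 "exp (- L)" 1, unfolded e] c(1) L unfolding h_def by simp
      qed
      ultimately show "c * L powr Q \<le> C * L powr 0" using C(1) L by simp
    qed (use c Q in auto)
  qed
qed

section \<open>The characterization of boundedness\<close>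

theorem theorem2p3:
  fixes \<alpha> \<sigma> :: real and p q :: ereal
  assumes "\<alpha> > -1" and "\<sigma> > 0" and "1 \<le> p" and "1 \<le> q"
  shows "(\<alpha> \<ge> - 1 / 2 \<longrightarrow>
           (potential_H_bounded \<alpha> \<sigma> p q \<longleftrightarrow>
              1 / p - ereal (2 * \<sigma>) \<le> 1 / q \<and> 1 / q < 1 / p + ereal (2 * \<sigma>) \<and>
              (1 / p, 1 / q) \<notin> {(ereal (2 * \<sigma>), 0), (1, ereal (1 - 2 * \<sigma>))})) \<and>
         (\<alpha> < - 1 / 2 \<and> p > ereal (2 / (2 * \<alpha> + 3)) \<longrightarrow>
           (potential_H_bounded \<alpha> \<sigma> p q \<longleftrightarrow>
              1 / p - ereal (2 * \<sigma>) \<le> 1 / q \<and> 1 / q < 1 / p + ereal (2 * \<sigma>) \<and>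
              1 / q > ereal (- \<alpha> - 1 / 2)))"
proof -
  obtain P where P: "1 / p = ereal P" "0 \<le> P" "P \<le> 1"
    using assms(3) by (auto elim!: ereal_one_over_cases)
  obtain Q where Q: "1 / q = ereal Q" "0 \<le> Q" "Q \<le> 1"
    using assms(4) by (auto elim!: ereal_one_over_cases)
  note necessary = potential_H_bounded_imp_lower_condition[OF assms(1,2,3) P(1) assms(4) Q(1)]
    potential_H_bounded_imp_upper_condition[OF assms(1,2,3) P(1) assms(4) Q(1) P(2)]
  have ends: "\<not> (P = 2 * \<sigma> \<and> Q = 0)" "\<not> (P = 1 \<and> Q = 1 - 2 * \<sigma>)" if b: "potential_H_bounded \<alpha> \<sigma> p q"
  proof -
    have half: "\<not> (P = 1 \<and> Q = 0 \<and> \<sigma> = 1/2)"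
    proof
      assume h: "P = 1 \<and> Q = 0 \<and> \<sigma> = 1/2"
      then have \<sigma>: "\<sigma> = 1/2" by simp
      have "potential_H_bounded \<alpha> (1/2) p q" using b unfolding \<sigma> .
      then show False
        using potential_H_bounded_imp_not_endpoint_one_infinity[OF assms(1,3) _ assms(4)] h P(1) Q(1) by simp
    qed
    show "\<not> (P = 2 * \<sigma> \<and> Q = 0)"
      using potential_H_bounded_imp_not_endpoint_infinity[OF assms(1,2,3) P(1) assms(4) Q(1) b] half P(3) by force
    show "\<not> (P = 1 \<and> Q = 1 - 2 * \<sigma>)"
      using potential_H_bounded_imp_not_endpoint_one[OF assms(1,2,3) P(1) assms(4) Q(1) b] half Q(2) by force
  qed
  have small: "P < \<alpha> + 3/2" if "\<alpha> < - 1/2" "p > ereal (2 / (2 * \<alpha> + 3))"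
    using assms(3)
  proof (cases rule: ereal_one_over_cases)
    case 1
    then show ?thesis using P(1) assms(1) by simp
  next
    case (2 r)
    then have "r > 2 / (2 * \<alpha> + 3)" "P = 1 / r" using that P(1) by auto
    moreover from this(1) have "2 / r < 2 * \<alpha> + 3"
      using assms(1) 2 by (simp add: pos_divide_less_eq mult.commute)
    ultimately show ?thesis by simp
  qed
  have regular: "potential_H_bounded \<alpha> \<sigma> p q \<longleftrightarrow> P - 2 * \<sigma> \<le> Q \<and> Q < P + 2 * \<sigma> \<and> \<not> (P = 2 * \<sigma> \<and> Q = 0) \<and> \<not> (P = 1 \<and> Q = 1 - 2 * \<sigma>)"
    if "\<alpha> \<ge> - 1/2"
    using potential_H_bounded_regular[OF that assms(2,3) P(1) assms(4) Q(1) P(2,3) Q(2,3)] necessary ends by blast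
  have singular: "potential_H_bounded \<alpha> \<sigma> p q \<longleftrightarrow> P - 2 * \<sigma> \<le> Q \<and> Q < P + 2 * \<sigma> \<and> - \<alpha> - 1/2 < Q"
    if "\<alpha> < - 1/2" "p > ereal (2 / (2 * \<alpha> + 3))"
    using potential_H_bounded_singular[OF assms(1) that(1) assms(2,3) P(1) assms(4) Q(1) P(2) small[OF that] _ Q(3)] necessary
      potential_H_bounded_imp_corner_condition[OF assms(1) that(1) assms(2,3) P(1) assms(4) Q(1,2)] by blast
  show ?thesis
    using regular singular unfolding P(1) Q(1) by (simp add: zero_ereal_def one_ereal_def)
qed

end
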